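(* For $n\in\mathbb N$ let $\mu_n=\sum_{x\in\mathbb Z}\delta_{(n^{-\zeta}x,\;n^{1-\zeta}d(x))}$, a point process on $\mathbb R\times(0,\infty)$. As $n\to\infty$, $\mu_n$ converges in distribution, with respect to the vague topology, to the Poisson point process $\mu$ on $\mathbb R\times(0,\infty)$ with intensity function \[ (x,y)\mapsto q^2p_\kappa\,y^{2\kappa+1},\qquad p_\kappa=2\,\mathfrak B(\kappa+1,\kappa+1), \] where $\mathfrak B$ is the Euler beta function.
   Context: Let $c>0$, $q>0$, $\kappa>-1$. $F=(F(x))_{x\in\mathbb Z}$ is a family of i.i.d. random variables whose common density $\varrho$ is even, continuous, strictly positive on $(-c,c)$, zero outside $(-c,c)$, with $\lim_{x\to c}\varrho(x)/|c-x|^{\kappa}=q$. The discrepancy of the edge $\{x,x+1\}$ is $d(x)=2c-|F(x+1)-F(x)|$. Let $\zeta=\frac{2\kappa+2}{2\kappa+3}$. *)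

theory Defs
  imports "HOL-Probability.Probability"
begin

definition Espace :: "(real \<times> real) set" where
  "Espace = UNIV \<times> {0<..}"

definition Cc_plus :: "((real \<times> real) \<Rightarrow> real) set" where
  "Cc_plus = {f. continuous_on UNIV f \<and> (\<forall>z. 0 \<le> f z) \<and>
      (\<exists>K. compact K \<and> K \<subseteq> Espace \<and> (\<forall>z. z \<notin> K \<longrightarrow> f z = 0))}"

definition LFmeasures :: "(real \<times> real) measure set" where
  "LFmeasures = {m. sets m = sets borel \<and> emeasure m (- Espace) = 0 \<and>
      (\<forall>K. compact K \<and> K \<subseteq> Espace \<longrightarrow> emeasure m K < \<infinity>)}"

definition vague_topology :: "(real \<times> real) measure topology" where
  "vague_topology = subtopology
     (topology_generated_by
        {{m. (\<integral>\<^sup>+ z. ennreal (f z) \<partial>m) \<in> U} | f U. f \<in> Cc_plus \<and> open U})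
     LFmeasures"

definition conv_distr_vague ::
  "'a measure \<Rightarrow> (nat \<Rightarrow> 'a \<Rightarrow> (real \<times> real) measure) \<Rightarrow>
   'b measure \<Rightarrow> ('b \<Rightarrow> (real \<times> real) measure) \<Rightarrow> bool" where
  "conv_distr_vague M X N Y \<longleftrightarrow>
     (\<forall>g :: (real \<times> real) measure \<Rightarrow> real.
        continuous_map vague_topology euclidean g \<and> bounded (g ` LFmeasures) \<longrightarrow>
        (\<lambda>n. integral\<^sup>L M (\<lambda>\<omega>. g (X n \<omega>))) \<longlonglongrightarrow> integral\<^sup>L N (\<lambda>\<omega>. g (Y \<omega>)))"

definition Ebounded :: "(real \<times> real) set \<Rightarrow> bool" where
  "Ebounded B \<longleftrightarrow> B \<in> sets borel \<and> (\<exists>K. compact K \<and> K \<subseteq> Espace \<and> B \<subseteq> K)"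

definition intensity :: "((real \<times> real) \<Rightarrow> real) \<Rightarrow> (real \<times> real) set \<Rightarrow> real" where
  "intensity lam B = enn2real (\<integral>\<^sup>+ z \<in> B. ennreal (lam z) \<partial>lborel)"

definition poisson_process ::
  "'b measure \<Rightarrow> ('b \<Rightarrow> (real \<times> real) measure) \<Rightarrow> ((real \<times> real) \<Rightarrow> real) \<Rightarrow> bool" where
  "poisson_process N Y lam \<longleftrightarrow>
     prob_space N \<and> (\<forall>\<omega>\<in>space N. Y \<omega> \<in> LFmeasures) \<and>
     (\<forall>B. Ebounded B \<longrightarrow>
        (\<forall>k::nat. measure N {\<omega> \<in> space N. emeasure (Y \<omega>) B = of_nat k}
            = intensity lam B ^ k / fact k * exp (- intensity lam B))) \<and>
     (\<forall>(B :: nat \<Rightarrow> (real \<times> real) set) I. finite I \<and> disjoint_family_on B I \<and>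
        (\<forall>i\<in>I. Ebounded (B i)) \<longrightarrow>
        prob_space.indep_vars N (\<lambda>_. borel) (\<lambda>i \<omega>. emeasure (Y \<omega>) (B i)) I)"

definition discrepancy :: "real \<Rightarrow> (int \<Rightarrow> 'a \<Rightarrow> real) \<Rightarrow> 'a \<Rightarrow> int \<Rightarrow> real" where
  "discrepancy c F \<omega> x = 2 * c - \<bar>F (x + 1) \<omega> - F x \<omega>\<bar>"

text \<open>The rescaled point process mu_n = sum over x in Z of the Dirac mass at
  (n^(-zeta) x, n^(1-zeta) d(x)), restricted to E (points outside E occur with
  probability zero).\<close>
definition rescaled_pp ::
  "real \<Rightarrow> real \<Rightarrow> (int \<Rightarrow> 'a \<Rightarrow> real) \<Rightarrow> nat \<Rightarrow> 'a \<Rightarrow> (real \<times> real) measure" where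
  "rescaled_pp c \<zeta> F n \<omega> =
     (let pt = (\<lambda>x::int. (real n powr (- \<zeta>) * real_of_int x,
                          real n powr (1 - \<zeta>) * discrepancy c F \<omega> x))
      in distr (count_space {x. pt x \<in> Espace}) borel pt)"

end

theory Submission
  imports Defs
begin

text \<open>
  Half-open grid cells carry the whole argument. Every vaguely open set is an increasing union of sets
  described by the masses of finitely many dyadic cells, so weak convergence needs only a lower bound
  on the limit inferior of the probabilities of such sets, and no tightness. Cutting the cells into
  thin vertical strips makes multiple points in a strip unlikely, so the masses are determined by the
  set of occupied strips, and the law of that set is determined by void probabilities through
  inclusion and exclusion. The discrepancies are one-dependent and two neighbouring ones are rarely
  both small, so void probabilities are asymptotically $\exp(-\lambda)$, where $\lambda$ is the
  limiting expected number of points. Finally, a small discrepancy means that two neighbouring values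
  lie near opposite edges $\pm c$, and the integral of $u^\kappa v^\kappa$ over $u + v < \varepsilon$
  produces the Beta function and the intensity.
\<close>

section \<open>Grid cells and the vague topology\<close>

text \<open>The exponent \<zeta> comes from a balance. A unit of the rescaled axis holds about
  n^\<zeta> sites, and a rescaled discrepancy lies below y with probability of order (y / n^(1 -
  \<zeta>))^(2 \<kappa> + 2); the expected count converges to a positive limit exactly when \<zeta>
  = (1 - \<zeta>) (2 \<kappa> + 2). The factor 2 in the intensity counts the two signs of F(x + 1) -
  F(x), and y^(2 \<kappa> + 1) is the derivative of the tail y^(2 \<kappa> + 2) up to a constant.
  Void probabilities cannot see multiplicities. A first moment repairs this: if N counts the points
  of a cell, the indicator of N >= 2 is at most N minus the indicator of N >= 1, and for limiting
  mass w the expectation of that difference tends to w - (1 - exp(-w)) <= w^2. Cutting a cell into K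
  strips turns w^2 into K (w / K)^2 = w^2 / K. The cuts are vertical only because the masses are
  translation invariant in x, so all strips of a cell have equal mass.\<close>

definition grid_cell :: "nat \<Rightarrow> nat \<Rightarrow> int \<times> int \<Rightarrow> (real \<times> real) set" where
  "grid_cell a b k = {z. \<lfloor>real a * fst z\<rfloor> = fst k \<and> \<lfloor>real b * snd z\<rfloor> = snd k}"

text \<open>Since the floor of \<open>a * K * x\<close> divided by \<open>K\<close> is the floor of
  \<open>a * x\<close>, the indices of the subcells do not depend on the scales \<open>a\<close> and
  \<open>b\<close>. Separate factors \<open>K\<close> and \<open>L\<close> allow both dyadic
  refinement in two directions and strips cut in one.\<close>

definition refine_idx :: "nat \<Rightarrow> nat \<Rightarrow> int \<times> int \<Rightarrow> (int \<times> int) set" where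
  "refine_idx K L k = {k'. fst k' div int K = fst k \<and> snd k' div int L = snd k}"

lemma div_eq_iff_interval:
  fixes x i :: int
  assumes "K > 0"
  shows "x div int K = i \<longleftrightarrow> i * int K \<le> x \<and> x < i * int K + int K"
proof -
  have 1: "x = (x div int K) * int K + x mod int K" "0 \<le> x mod int K" "x mod int K < int K"
    using assms by simp_all
  have 2: "x div int K = i" if "i * int K \<le> x" "x < i * int K + int K"
  proof -
    have "x = i * int K + (x - i * int K)" by simp
    then have "x div int K = i + (x - i * int K) div int K"
      using assms by (metis add.commute div_mult_self3 less_numeral_extra(3) of_nat_eq_0_iff)
    also have "(x - i * int K) div int K = 0"
      using that by (intro div_pos_pos_trivial) auto
    finally show ?thesis by simp
  qed
  show ?thesis
  proof
    assume "x div int K = i"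
    then show "i * int K \<le> x \<and> x < i * int K + int K" using 1 by auto
  qed (use 2 in blast)
qed

lemma refine_idx_eq:
  assumes "K > 0" "L > 0"
  shows "refine_idx K L k =
    {fst k * int K..<fst k * int K + int K} \<times> {snd k * int L..<snd k * int L + int L}"
  unfolding refine_idx_def div_eq_iff_interval[OF assms(1)] div_eq_iff_interval[OF assms(2)]
  by auto

lemma finite_refine_idx: "K > 0 \<Longrightarrow> L > 0 \<Longrightarrow> finite (refine_idx K L k)"
  by (simp add: refine_idx_eq)

lemma card_refine_idx: "K > 0 \<Longrightarrow> L > 0 \<Longrightarrow> card (refine_idx K L k) = K * L"
  by (simp add: refine_idx_eq)

lemma floor_mult_div:
  assumes "K > 0"
  shows "\<lfloor>real (a * K) * x\<rfloor> div int K = \<lfloor>real a * x\<rfloor>"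
proof -
  have "\<lfloor>(real (a * K) * x) / real_of_int (int K)\<rfloor> = \<lfloor>real (a * K) * x\<rfloor> div int K"
    by (rule floor_divide_real_eq_div) simp
  then show ?thesis using assms by simp
qed

lemma grid_cell_refine:
  assumes "K > 0" "L > 0"
  shows "grid_cell a b k = (\<Union>k'\<in>refine_idx K L k. grid_cell (a * K) (b * L) k')"
  using floor_mult_div[OF assms(1), of a] floor_mult_div[OF assms(2), of b]
  unfolding grid_cell_def refine_idx_def by auto

lemma disjoint_grid_cell: "disjoint_family_on (grid_cell a b) A"
  unfolding disjoint_family_on_def grid_cell_def by (auto simp: prod_eq_iff)

lemma grid_cell_eq_Times:
  assumes "a > 0" "b > 0"
  shows "grid_cell a b k = {real_of_int (fst k) / real a ..< (real_of_int (fst k) + 1) / real a}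
    \<times> {real_of_int (snd k) / real b ..< (real_of_int (snd k) + 1) / real b}"
  using assms unfolding grid_cell_def by (auto simp: floor_eq_iff field_simps)

lemma sets_grid_cell [measurable]: "grid_cell a b k \<in> sets borel"
proof -
  have "{z \<in> space (borel \<Otimes>\<^sub>M borel). \<lfloor>real a * fst z\<rfloor> = fst k \<and> \<lfloor>real b * snd z\<rfloor> = snd k}
      \<in> sets (borel \<Otimes>\<^sub>M borel)"
    by measurable
  then show ?thesis unfolding grid_cell_def borel_prod by simp
qed

text \<open>Row 0 would touch y = 0, where the space ends. From row 1 on, the closed rectangle is
  compact inside \<open>Espace\<close>.\<close>

lemma Ebounded_grid_cell:
  assumes "a > 0" "b > 0" "snd k \<ge> 1"
  shows "Ebounded (grid_cell a b k)"
proof -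
  let ?K = "{real_of_int (fst k) / real a .. (real_of_int (fst k) + 1) / real a}
    \<times> {real_of_int (snd k) / real b .. (real_of_int (snd k) + 1) / real b}"
  have "real_of_int (snd k) / real b > 0" using assms by simp
  then have "?K \<subseteq> Espace" by (auto simp: Espace_def simp del: zero_less_divide_iff)
  moreover have "compact ?K" by (intro compact_Times) auto
  moreover have "grid_cell a b k \<subseteq> ?K" unfolding grid_cell_eq_Times[OF assms(1,2)] by auto
  ultimately show ?thesis unfolding Ebounded_def using sets_grid_cell by blast
qed

lemma Ebounded_Un:
  assumes "Ebounded A" "Ebounded B"
  shows "Ebounded (A \<union> B)"
proof -
  obtain K where "compact K" "K \<subseteq> Espace" "A \<subseteq> K" using assms(1) unfolding Ebounded_def by auto
  moreover obtain K' where "compact K'" "K' \<subseteq> Espace" "B \<subseteq> K'" using assms(2) unfolding Ebounded_def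
    by auto
  ultimately have "compact (K \<union> K')" "K \<union> K' \<subseteq> Espace" "A \<union> B \<subseteq> K \<union> K'"
    by (auto intro: compact_Un)
  then show ?thesis using assms unfolding Ebounded_def by (meson sets.Un)
qed

lemma Ebounded_UN:
  assumes "finite A" "\<And>k. k \<in> A \<Longrightarrow> Ebounded (B k)"
  shows "Ebounded (\<Union>k\<in>A. B k)"
  using assms
proof (induction A rule: finite_induct)
  case empty
  show ?case unfolding Ebounded_def by (auto intro!: exI[of _ "{}"])
next
  case (insert x A)
  then have "Ebounded (B x)" "Ebounded (\<Union>k\<in>A. B k)" by auto
  then show ?case using Ebounded_Un by simp
qed

lemma LFmeasures_sets: "m \<in> LFmeasures \<Longrightarrow> sets m = sets borel"
  by (simp add: LFmeasures_def)

lemma emeasure_Ebounded_finite: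
  assumes "m \<in> LFmeasures" "Ebounded B"
  shows "emeasure m B < \<infinity>"
proof -
  obtain K where K: "compact K" "K \<subseteq> Espace" "B \<subseteq> K" using assms(2) unfolding Ebounded_def by blast
  have "K \<in> sets m" using K(1) LFmeasures_sets[OF assms(1)] by (simp add: compact_imp_closed)
  then have "emeasure m B \<le> emeasure m K" by (intro emeasure_mono K(3))
  also have "\<dots> < \<infinity>" using assms(1) K unfolding LFmeasures_def by blast
  finally show ?thesis .
qed

lemma measure_grid_cell_refine:
  assumes "m \<in> LFmeasures" "K > 0" "L > 0" "a > 0" "b > 0" "snd k \<ge> 1"
  shows "measure m (grid_cell a b k) = (\<Sum>k'\<in>refine_idx K L k. measure m (grid_cell (a * K) (b * L) k'))"
proof -
  \<comment> \<open>\<open>measure\<close> returns 0 on sets of infinite mass, so additivity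
    requires finite mass of every subcell; this follows because subcells of a row of index at least
    1 again have row index at least 1.\<close>
  have "emeasure m (grid_cell (a * K) (b * L) k') \<noteq> \<infinity>" if "k' \<in> refine_idx K L k" for k'
  proof -
    have "snd k' \<ge> 1"
    proof (rule ccontr)
      assume "\<not> snd k' \<ge> 1"
      then have "snd k' div int L \<le> 0 div int L" by (intro zdiv_mono1) (use assms in auto)
      then show False using that assms(6) by (simp add: refine_idx_def)
    qed
    then show ?thesis using emeasure_Ebounded_finite[OF assms(1) Ebounded_grid_cell[of "a*K" "b*L"
      k']] assms
      by auto
  qed
  then show ?thesis
    unfolding grid_cell_refine[OF assms(2,3), of a b k]
    using finite_refine_idx[OF assms(2,3)] disjoint_grid_cell LFmeasures_sets[OF assms(1)]
    by (intro measure_finite_Union) (auto simp: sets_grid_cell)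
qed

text \<open>At mesh 2^-r these cells fill [-r, r) x [2^-r, r). Extent and mesh share one parameter,
  so the regions grow to the whole open half-plane while the mesh shrinks.\<close>

definition window :: "nat \<Rightarrow> (int \<times> int) set" where
  "window r = {- (int r * 2 ^ r)..<int r * 2 ^ r} \<times> {1..<int r * 2 ^ r}"

abbreviation dyadic_cell :: "nat \<Rightarrow> int \<times> int \<Rightarrow> (real \<times> real) set" where
  "dyadic_cell r \<equiv> grid_cell (2 ^ r) (2 ^ r)"

lemma finite_window [simp]: "finite (window r)"
  by (simp add: window_def)

lemma window_snd: "k \<in> window r \<Longrightarrow> snd k \<ge> 1"
  by (auto simp: window_def)

lemma refine_window:
  assumes "k \<in> window r" "k' \<in> refine_idx (2 ^ s) (2 ^ s) k"
  shows "k' \<in> window (r + s)"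
proof -
  have p: "(0::int) < 2 ^ s" by simp
  have k: "- (int r * 2 ^ r) \<le> fst k" "fst k + 1 \<le> int r * 2 ^ r" "1 \<le> snd k" "snd k + 1 \<le> int r * 2 ^ r"
    using assms(1) by (auto simp: window_def)
  have k': "fst k * 2 ^ s \<le> fst k'" "fst k' < (fst k + 1) * 2 ^ s"
     "snd k * 2 ^ s \<le> snd k'" "snd k' < (snd k + 1) * 2 ^ s"
    using assms(2) by (auto simp: refine_idx_eq algebra_simps)
  have e: "int r * 2 ^ r * 2 ^ s \<le> int (r + s) * 2 ^ (r + s)"
    by (simp add: power_add algebra_simps)
  have "- (int r * 2 ^ r) * 2 ^ s \<le> fst k * 2 ^ s" using k(1) by (intro mult_right_mono) auto
  moreover have "(fst k + 1) * 2 ^ s \<le> int r * 2 ^ r * 2 ^ s" using k(2) by (intro mult_right_mono) auto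
  moreover have "(snd k + 1) * 2 ^ s \<le> int r * 2 ^ r * 2 ^ s" using k(4) by (intro mult_right_mono) auto
  moreover have "1 * 2 ^ s \<le> snd k * 2 ^ s" using k(3) by (intro mult_right_mono) auto
  ultimately have "- (int (r + s) * 2 ^ (r + s)) \<le> fst k'" "fst k' < int (r + s) * 2 ^ (r + s)"
    "1 \<le> snd k'" "snd k' < int (r + s) * 2 ^ (r + s)"
    using k' e p by (simp_all only: mult_minus_left)
  then show ?thesis by (auto simp: window_def mem_Times_iff)
qed

text \<open>These sets need not be vaguely open, since an atom on a cell boundary can leave its cell
  under a small shift. What matters is the other direction: every vaguely open set contains such a
  neighbourhood of each of its points.\<close>

definition cells_close :: "nat \<Rightarrow> real \<Rightarrow> (real \<times> real) measure \<Rightarrow> (real \<times> real) measure \<Rightarrow> bool" where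
  "cells_close r e m m' \<longleftrightarrow>
     (\<forall>k\<in>window r. \<bar>measure m' (dyadic_cell r k) - measure m (dyadic_cell r k)\<bar> < e)"

text \<open>Each cell splits into 4^s subcells whose errors add up, hence the tolerance
  \<open>e / 4 ^ s\<close> at the finer scale.\<close>

lemma cells_close_refine:
  assumes "m \<in> LFmeasures" "m' \<in> LFmeasures" "cells_close (r + s) (e / 4 ^ s) m m'"
  shows "cells_close r e m m'"
  unfolding cells_close_def
proof
  fix k assume k: "k \<in> window r"
  let ?R = "refine_idx (2 ^ s) (2 ^ s) k"
  have ref: "measure x (dyadic_cell r k) = (\<Sum>k'\<in>?R. measure x (dyadic_cell (r + s) k'))"
    if "x \<in> LFmeasures" for x
    using measure_grid_cell_refine[OF that, of "2^s" "2^s" "2^r" "2^r" k] window_snd[OF k]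
    by (simp add: power_add)
  have fin: "finite ?R" "card ?R = 4 ^ s"
    by (simp_all add: finite_refine_idx card_refine_idx power_mult_distrib[symmetric])
  have "\<bar>measure m' (dyadic_cell r k) - measure m (dyadic_cell r k)\<bar>
    = \<bar>\<Sum>k'\<in>?R. measure m' (dyadic_cell (r + s) k') - measure m (dyadic_cell (r + s) k')\<bar>"
    by (simp add: ref assms(1,2) sum_subtractf)
  also have "\<dots> \<le> (\<Sum>k'\<in>?R. \<bar>measure m' (dyadic_cell (r + s) k') - measure m (dyadic_cell (r + s) k')\<bar>)"
    by (rule sum_abs)
  also have "\<dots> < (\<Sum>k'\<in>?R. e / 4 ^ s)"
  proof (rule sum_strict_mono)
    show "?R \<noteq> {}" using fin(2) by auto
  qed (use fin assms(3) refine_window[OF k] in \<open>auto simp: cells_close_def\<close>)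
  also have "\<dots> = e" by (simp add: fin)
  finally show "\<bar>measure m' (dyadic_cell r k) - measure m (dyadic_cell r k)\<bar> < e" .
qed

lemma cells_close_mono: "cells_close r e m m' \<Longrightarrow> e \<le> e' \<Longrightarrow> cells_close r e' m m'"
  unfolding cells_close_def by force

text \<open>A compact subset of the open half-plane has a positive minimal height and bounded norm.
  It suffices that 2^-r is below the former and r above the latter.\<close>

lemma compact_covered_by_window:
  assumes "compact K" "K \<subseteq> Espace"
  shows "\<exists>r. K \<subseteq> (\<Union>k\<in>window r. dyadic_cell r k)"
proof (cases "K = {}")
  case False
  obtain z0 where z0: "z0 \<in> K" "\<And>z. z \<in> K \<Longrightarrow> snd z0 \<le> snd z"
    using continuous_attains_inf[OF assms(1) False continuous_on_snd[OF continuous_on_id]] by auto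
  have pos: "snd z0 > 0" using z0(1) assms(2) by (auto simp: Espace_def)
  obtain B where B: "\<And>z. z \<in> K \<Longrightarrow> norm z \<le> B"
    using compact_imp_bounded[OF assms(1)] by (auto simp: bounded_iff)
  obtain r1 where r1: "(1/2::real) ^ r1 < snd z0" using real_arch_pow_inv[OF pos, of "1/2"] by auto
  obtain r2 where r2: "B < real r2" using reals_Archimedean2 by blast
  define r where "r = max r1 r2"
  have "(1/2::real) ^ r \<le> (1/2) ^ r1" unfolding r_def by (intro power_decreasing) auto
  with r1 have r3: "(1/2::real) ^ r < snd z0" by linarith
  have r4: "B < real r" using r2 unfolding r_def by simp
  have "z \<in> (\<Union>k\<in>window r. dyadic_cell r k)" if "z \<in> K" for z
  proof -
    have n: "\<bar>fst z\<bar> < real r" "\<bar>snd z\<bar> < real r"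
      using B[OF that] r4 norm_fst_le[of "fst z" "snd z"] norm_snd_le[of "snd z" "fst z"] by auto
    have s: "(1/2) ^ r < snd z" using r3 z0(2)[OF that] by simp
    have s1: "1 \<le> 2 ^ r * snd z" using s by (simp add: power_divide field_simps)
    have m: "2 ^ r * fst z < 2 ^ r * real r" "2 ^ r * (- fst z) < 2 ^ r * real r" "2 ^ r * snd z < 2
      ^ r * real r"
      using n by (intro mult_strict_left_mono; simp)+
    let ?k = "(\<lfloor>2 ^ r * fst z\<rfloor>, \<lfloor>2 ^ r * snd z\<rfloor>)"
    have "?k \<in> window r"
      unfolding window_def using m s1 by (auto simp: le_floor_iff floor_less_iff mult.commute)
    moreover have "z \<in> dyadic_cell r ?k" by (simp add: grid_cell_def)
    ultimately show ?thesis by blast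
  qed
  then show ?thesis by blast
qed auto


section \<open>Test functions, vaguely open sets and cell masses\<close>

lemma dist_dyadic_cell:
  assumes "z \<in> dyadic_cell r k" "z' \<in> dyadic_cell r k"
  shows "dist z z' < 2 * (1/2) ^ r"
proof -
  have *: "\<bar>2 ^ r * u - 2 ^ r * v\<bar> < 1" if "\<lfloor>2 ^ r * u\<rfloor> = \<lfloor>2 ^ r * v\<rfloor>" for u v :: real
    using that by linarith
  have **: "\<bar>u - v\<bar> < (1/2) ^ r" if "\<lfloor>2 ^ r * u\<rfloor> = \<lfloor>2 ^ r * v\<rfloor>" for u v :: real
  proof -
    have "2 ^ r * \<bar>u - v\<bar> = \<bar>2 ^ r * u - 2 ^ r * v\<bar>"
      by (simp add: abs_mult flip: right_diff_distrib)
    then show ?thesis using *[OF that] by (simp add: power_divide field_simps)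
  qed
  have "dist z z' \<le> dist (fst z) (fst z') + dist (snd z) (snd z')"
    unfolding dist_prod_def by (rule sqrt_sum_squares_le_sum) auto
  also have "\<dots> < (1/2) ^ r + (1/2) ^ r"
    using assms unfolding grid_cell_def dist_real_def by (intro add_strict_mono **) auto
  finally show ?thesis by simp
qed

text \<open>The half-open cells make the step function $\sum_k f(c_k) 1_{C_k}$, with $c_k \in C_k$, a uniform
  approximation of $f$ whose integral is a function of the cell masses alone, and this for every
  measure at once: no cell boundary has to be avoided.\<close>

lemma integral_Cc_plus_close:
  assumes f: "f \<in> Cc_plus" and m: "m \<in> LFmeasures" and t: "t > 0"
  shows "\<exists>r. \<exists>e>0. \<forall>m'\<in>LFmeasures. cells_close r e m m' \<longrightarrow>
    \<bar>integral\<^sup>L m' f - integral\<^sup>L m f\<bar> < t"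
proof -
  obtain K where K: "compact K" "K \<subseteq> Espace" "\<And>z. z \<notin> K \<Longrightarrow> f z = 0"
    and cont: "continuous_on UNIV f" and nonneg: "\<And>z. 0 \<le> f z"
    using f unfolding Cc_plus_def by auto
  obtain r0 where r0: "K \<subseteq> (\<Union>k\<in>window r0. dyadic_cell r0 k)"
    using compact_covered_by_window[OF K(1,2)] by blast
  \<comment> \<open>The region comes before the mesh: \<open>\<eta>\<close> depends on the mass of
    \<open>W\<close>, and the final scale \<open>r\<close> depends on \<open>\<eta>\<close> through
    the modulus of continuity of \<open>f\<close>.\<close>
  define W where "W = (\<Union>k\<in>window r0. dyadic_cell r0 k)"
  have EW: "Ebounded W" unfolding W_def
    by (intro Ebounded_UN Ebounded_grid_cell) (auto dest: window_snd)
  then obtain C where C: "compact C" "C \<subseteq> Espace" "W \<subseteq> C" and Wb: "W \<in> sets borel"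
    unfolding Ebounded_def by blast
  have bnd: "bounded (f ` C)"
    using C(1) cont by (meson compact_continuous_image compact_imp_bounded continuous_on_subset
      top_greatest)
  then obtain B0 where B0: "\<And>z. z \<in> C \<Longrightarrow> norm (f z) \<le> B0" unfolding bounded_iff by auto
  define B where "B = \<bar>B0\<bar> + 1"
  have B: "B > 0" "\<And>z. z \<in> W \<Longrightarrow> f z \<le> B" using B0 C(3) unfolding B_def by (auto dest!: subsetD; force)+
  have zW: "f z = 0" if "z \<notin> W" for z using that K(3) r0 unfolding W_def by blast
  \<comment> \<open>Gives \<open>\<eta> * (measure m W + 1) = t / 4\<close>. The added 1 leaves room
    for \<open>measure m' W\<close> to exceed \<open>measure m W\<close> and keeps the denominator
    positive.\<close>
  define \<eta> where "\<eta> = t / (4 * (measure m W + 1))"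
  have m0: "measure m W \<ge> 0" by simp
  have \<eta>: "\<eta> > 0" using t m0 unfolding \<eta>_def by (simp add: add_nonneg_pos)
  have "uniformly_continuous_on C f"
    using C(1) cont by (intro compact_uniformly_continuous) (auto intro: continuous_on_subset)
  then obtain \<delta> where \<delta>: "\<delta> > 0" "\<And>z z'. z \<in> C \<Longrightarrow> z' \<in> C \<Longrightarrow> dist z' z < \<delta> \<Longrightarrow> dist (f z') (f z) < \<eta>"
    using \<eta> unfolding uniformly_continuous_on_def by metis
  obtain s where s: "(1/2::real) ^ s < \<delta> / 2" using real_arch_pow_inv[of "\<delta>/2" "1/2"] \<delta>(1) by auto
  define r where "r = r0 + s"
  have rs: "2 * (1/2::real) ^ r < \<delta>"
  proof -
    have "(1/2::real) ^ r \<le> (1/2) ^ s" unfolding r_def by (intro power_decreasing) auto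
    then show ?thesis using s by linarith
  qed
  \<comment> \<open>Only the fine cells inside \<open>W\<close>: the error \<open>\<eta>\<close> is
    calibrated to the mass of \<open>W\<close>, and \<open>window r\<close> may reach beyond
    it.\<close>
  define V where "V = (\<Union>k\<in>window r0. refine_idx (2 ^ s) (2 ^ s) k)"
  have finV: "finite V" unfolding V_def by (intro finite_UN_I finite_refine_idx) auto
  have Vw: "V \<subseteq> window r" unfolding V_def r_def using refine_window by blast
  have Vs: "snd k \<ge> 1" if "k \<in> V" for k using that Vw window_snd[of k r] by blast
  have WV: "W = (\<Union>k\<in>V. dyadic_cell r k)"
    unfolding W_def V_def r_def power_add UN_UN_flatten
    by (intro SUP_cong refl grid_cell_refine) auto
  define corner where "corner k = (real_of_int (fst k) / 2 ^ r, real_of_int (snd k) / 2 ^ r)" for k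
    :: "int \<times> int"
  have corner: "corner k \<in> dyadic_cell r k" for k unfolding corner_def grid_cell_def by simp
  have fV: "f (corner k) \<le> B" if "k \<in> V" for k
    using corner[of k] that WV by (intro B(2)) blast
  define S where "S m' = (\<Sum>k\<in>V. f (corner k) * measure m' (dyadic_cell r k))" for m' :: "(real \<times>
    real) measure"
  have key: "\<bar>integral\<^sup>L m' f - S m'\<bar> \<le> \<eta> * measure m' W" if m': "m' \<in> LFmeasures" for m'
  proof -
    have sm: "sets m' = sets borel" using LFmeasures_sets[OF m'] .
    have fm: "f \<in> borel_measurable m'"
      using borel_measurable_continuous_onI[OF cont] sm by (simp cong: measurable_cong_sets)
    have fW: "emeasure m' W < \<infinity>" by (rule emeasure_Ebounded_finite[OF m' EW])
    have iW: "integrable m' (indicator W :: _ \<Rightarrow> real)"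
      using fW Wb sm by (intro integrable_real_indicator) auto
    have ifn: "integrable m' f"
    proof (rule Bochner_Integration.integrable_bound)
      show "integrable m' (\<lambda>z. B * indicator W z)" using iW by simp
      show "AE z in m'. norm (f z) \<le> norm (B * indicator W z :: real)"
        using B zW nonneg by (intro AE_I2) (auto simp: indicator_def)
    qed (rule fm)
    let ?s = "\<lambda>z. \<Sum>k\<in>V. f (corner k) * indicator (dyadic_cell r k) z"
    have fC: "emeasure m' (dyadic_cell r k) < \<infinity>" if "k \<in> V" for k
      using Vs[OF that] by (intro emeasure_Ebounded_finite[OF m'] Ebounded_grid_cell) auto
    have ic: "integrable m' (indicator (dyadic_cell r k) :: _ \<Rightarrow> real)" if "k \<in> V" for k
      using fC[OF that] sm by (intro integrable_real_indicator) auto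
    have int_s: "integrable m' ?s"
      by (intro Bochner_Integration.integrable_sum integrable_mult_right ic)
    have Ss: "integral\<^sup>L m' ?s = S m'"
      unfolding S_def using ic sm
      by (subst Bochner_Integration.integral_sum) (auto intro!: sum.cong simp: space_borel
        sets_eq_imp_space_eq)
    have pw: "\<bar>f z - ?s z\<bar> \<le> \<eta> * indicator W z" for z
    proof (cases "z \<in> W")
      case True
      then obtain k where k: "k \<in> V" "z \<in> dyadic_cell r k" using WV by blast
      have "?s z = (\<Sum>k'\<in>V. if k' = k then f (corner k) else 0)"
        using k(2) by (intro sum.cong) (auto simp: grid_cell_def indicator_def prod_eq_iff)
      also have "\<dots> = f (corner k)" using k(1) finV by simp
      finally have e: "?s z = f (corner k)" .
      have "corner k \<in> W" using corner[of k] k(1) WV by blast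
      then have "dist (f z) (f (corner k)) < \<eta>"
        using dist_dyadic_cell[OF k(2) corner[of k]] rs True C(3) by (intro \<delta>(2)) auto
      then show ?thesis using True unfolding e by (simp add: dist_real_def)
    next
      case False
      then have "?s z = 0" using WV by (intro sum.neutral) (auto simp: indicator_def)
      then show ?thesis using zW[OF False] False by simp
    qed
    have "\<bar>integral\<^sup>L m' f - S m'\<bar> = \<bar>\<integral>z. f z - ?s z \<partial>m'\<bar>"
      using Ss ifn int_s by simp
    also have "\<dots> \<le> (\<integral>z. \<bar>f z - ?s z\<bar> \<partial>m')" by (rule integral_abs_bound)
    also have "\<dots> \<le> (\<integral>z. \<eta> * indicator W z \<partial>m')"
      using pw ifn int_s iW by (intro integral_mono) auto
    also have "\<dots> = \<eta> * measure m' W"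
      using Wb sm by (simp add: space_borel sets_eq_imp_space_eq)
    finally show ?thesis .
  qed
  have mW: "measure m' W = (\<Sum>k\<in>V. measure m' (dyadic_cell r k))" if m': "m' \<in> LFmeasures" for m'
    unfolding WV
  proof (rule measure_finite_Union[OF finV])
    show "emeasure m' (dyadic_cell r k) \<noteq> \<infinity>" if "k \<in> V" for k
      using Vs[OF that] emeasure_Ebounded_finite[OF m' Ebounded_grid_cell[of "2^r" "2^r" k]] by auto
  qed (use LFmeasures_sets[OF m'] disjoint_grid_cell in auto)
  \<comment> \<open>The first term yields \<open>card V * e \<le> 1\<close>, so the mass of
    \<open>W\<close> grows by at most 1; the second yields
    \<open>B * card V * e \<le> t / 4\<close>, so the step sums differ by at most a quarter of
    \<open>t\<close>. The two approximation errors take two further quarters.\<close>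
  define e where "e = min (1 / (real (card V) + 1)) (t / (4 * B * (real (card V) + 1)))"
  have e: "e > 0" unfolding e_def using t B(1) by (simp add: add_nonneg_pos)
  have e1: "real (card V) * e \<le> 1"
  proof -
    have "real (card V) * e \<le> real (card V) * (1 / (real (card V) + 1))"
      unfolding e_def by (intro mult_left_mono) auto
    also have "\<dots> \<le> 1" by (simp add: field_simps)
    finally show ?thesis .
  qed
  have e2: "B * (real (card V) * e) \<le> t / 4"
  proof -
    have "B * (real (card V) * e) \<le> B * (real (card V) * (t / (4 * B * (real (card V) + 1))))"
      unfolding e_def using B(1) by (intro mult_left_mono) auto
    also have "\<dots> = (t / 4) * (real (card V) / (real (card V) + 1))" using B(1) by (simp add:
      divide_simps)
    also have "\<dots> \<le> (t / 4) * 1" using t by (intro mult_left_mono) (auto simp: field_simps)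
    finally show ?thesis by simp
  qed
  have main: "\<bar>integral\<^sup>L m' f - integral\<^sup>L m f\<bar> < t" if m': "m' \<in> LFmeasures" and cl: "cells_close
    r e m m'" for m'
  proof -
    have d: "\<bar>measure m' (dyadic_cell r k) - measure m (dyadic_cell r k)\<bar> \<le> e" if "k \<in> V" for k
      using cl Vw that unfolding cells_close_def by (meson less_imp_le subsetD)
    have "\<bar>measure m' W - measure m W\<bar> = \<bar>\<Sum>k\<in>V. measure m' (dyadic_cell r k) - measure m
      (dyadic_cell r k)\<bar>"
      by (simp add: mW m m' sum_subtractf)
    also have "\<dots> \<le> (\<Sum>k\<in>V. e)" by (rule order_trans[OF sum_abs sum_mono]) (rule d)
    also have "\<dots> \<le> 1" using e1 by simp
    finally have a: "measure m' W \<le> measure m W + 1" by linarith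
    have "\<bar>S m' - S m\<bar> = \<bar>\<Sum>k\<in>V. f (corner k) * (measure m' (dyadic_cell r k) - measure m
      (dyadic_cell r k))\<bar>"
      unfolding S_def by (simp add: sum_subtractf right_diff_distrib)
    also have "\<dots> \<le> (\<Sum>k\<in>V. B * e)"
      using fV d nonneg B(1) by (intro order_trans[OF sum_abs sum_mono]) (auto simp: abs_mult
        intro!: mult_mono)
    also have "\<dots> \<le> t / 4" using e2 by (simp add: algebra_simps)
    finally have b: "\<bar>S m' - S m\<bar> \<le> t / 4" .
    have "t / (4 * x) * x = t / 4" if "x > 0" for x :: real using that by simp
    from this[of "measure m W + 1"] m0 have c: "\<eta> * (measure m W + 1) = t / 4"
      unfolding \<eta>_def by linarith
    have "\<eta> * measure m' W \<le> \<eta> * (measure m W + 1)" "\<eta> * measure m W \<le> \<eta> * (measure m W + 1)"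
      using a \<eta> by (intro mult_left_mono; simp)+
    then show ?thesis using b c key[OF m'] key[OF m] t by linarith
  qed
  show ?thesis using e main by blast
qed

text \<open>Induction over the generation of the topology. Subbasic sets are handled by
  \<open>integral_Cc_plus_close\<close>; for intersections, two unrelated scales \<open>r\<close>
  and \<open>r'\<close> are both refined to \<open>r + r'\<close>.\<close>

lemma vague_open_cells_close:
  assumes G: "openin vague_topology G" and m: "m \<in> G"
  shows "\<exists>r. \<exists>e>0. \<forall>m'\<in>LFmeasures. cells_close r e m m' \<longrightarrow> m' \<in> G"
proof -
  let ?S = "{{m. (\<integral>\<^sup>+ z. ennreal (f z) \<partial>m) \<in> U} | f U. f \<in> Cc_plus \<and> open U}"
  obtain T where T: "openin (topology_generated_by ?S) T" "G = T \<inter> LFmeasures"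
    using G unfolding vague_topology_def openin_subtopology by blast
  have mL: "m \<in> LFmeasures" "m \<in> T" using T(2) m by auto
  have "generate_topology_on ?S T" using T(1) by (simp add: openin_topology_generated_by_iff)
  then have "m \<in> T \<longrightarrow> (\<exists>r. \<exists>e>0. \<forall>m'\<in>LFmeasures. cells_close r e m m' \<longrightarrow> m' \<in> T)"
  proof (induction T rule: generate_topology_on.induct)
    case (Int a b)
    show ?case
    proof
      assume "m \<in> a \<inter> b"
      then obtain r e r' e' where *: "e > 0" "e' > 0"
        "\<And>m'. m' \<in> LFmeasures \<Longrightarrow> cells_close r e m m' \<Longrightarrow> m' \<in> a"
        "\<And>m'. m' \<in> LFmeasures \<Longrightarrow> cells_close r' e' m m' \<Longrightarrow> m' \<in> b"
        using Int.IH by blast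
      \<comment> \<open>The divisors are crossed: passing from scale \<open>r\<close> to
        \<open>r + r'\<close> splits a cell into 4^r' pieces, and from \<open>r'\<close> into
        4^r.\<close>
      define E where "E = min (e / 4 ^ r') (e' / 4 ^ r)"
      have "m' \<in> a \<inter> b" if m': "m' \<in> LFmeasures" and c: "cells_close (r + r') E m m'" for m'
      proof -
        have "cells_close r e m m'"
          by (rule cells_close_refine[OF mL(1) m', of r r']) (rule cells_close_mono[OF c], simp add:
            E_def)
        moreover have "cells_close r' e' m m'"
          by (rule cells_close_refine[OF mL(1) m', of r' r]) (rule cells_close_mono[OF c[unfolded
            add.commute[of r]]], simp add: E_def)
        ultimately show ?thesis using * m' by blast
      qed
      moreover have "E > 0" using * by (simp add: E_def)
      ultimately show "\<exists>r. \<exists>e>0. \<forall>m'\<in>LFmeasures. cells_close r e m m' \<longrightarrow> m' \<in> a \<inter> b" by blast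
    qed
  next
    case (UN \<K>)
    then show ?case by blast
  next
    case (Basis s)
    then obtain f U where s: "s = {m. (\<integral>\<^sup>+ z. ennreal (f z) \<partial>m) \<in> U}" "f \<in> Cc_plus" "open U" by blast
    have cont: "continuous_on UNIV f" and nonneg: "\<And>z. 0 \<le> f z" using s(2) by (auto simp: Cc_plus_def)
    show ?case
    proof
      assume ms: "m \<in> s"
      \<comment> \<open>The topology speaks of integrals in \<open>ennreal\<close>, the estimate of
        real ones. They agree because \<open>f\<close> is bounded with compact support and
        \<open>m'\<close> is finite there.\<close>
      have nn: "(\<integral>\<^sup>+ z. ennreal (f z) \<partial>m') = ennreal (integral\<^sup>L m' f)" if m': "m' \<in> LFmeasures" for m'
      proof (rule nn_integral_eq_integral)
        obtain K where K: "compact K" "K \<subseteq> Espace" "\<And>z. z \<notin> K \<Longrightarrow> f z = 0"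
          using s(2) unfolding Cc_plus_def by auto
        have sm: "sets m' = sets borel" using LFmeasures_sets[OF m'] .
        have "bounded (f ` K)"
          using K(1) cont by (meson compact_continuous_image compact_imp_bounded
            continuous_on_subset top_greatest)
        then obtain B where B: "\<And>z. z \<in> K \<Longrightarrow> norm (f z) \<le> B" unfolding bounded_iff by auto
        show "integrable m' f"
        proof (rule Bochner_Integration.integrable_bound)
          have "Ebounded K" using K unfolding Ebounded_def by (auto simp: compact_imp_closed)
          then have "integrable m' (indicator K :: _ \<Rightarrow> real)"
            using emeasure_Ebounded_finite[OF m'] sm K(1) by (intro integrable_real_indicator) (auto
              simp: compact_imp_closed)
          then show "integrable m' (\<lambda>z. B * indicator K z)" by simp
          show "f \<in> borel_measurable m'"
            using borel_measurable_continuous_onI[OF cont] sm by (simp cong: measurable_cong_sets)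
          show "AE z in m'. norm (f z) \<le> norm (B * indicator K z :: real)"
            using B K(3) by (intro AE_I2) (force simp: indicator_def)
        qed
      qed (use nonneg in auto)
      have "open {x. ennreal x \<in> U}"
        using open_vimage[OF s(3), of ennreal] continuous_on_ennreal[OF continuous_on_id] by (simp
          add: vimage_def)
      moreover have "integral\<^sup>L m f \<in> {x. ennreal x \<in> U}" using ms nn[OF mL(1)] by (simp add: s(1))
      ultimately obtain t where t: "t > 0" "\<And>x. \<bar>x - integral\<^sup>L m f\<bar> < t \<Longrightarrow> ennreal x \<in> U"
        unfolding open_dist dist_real_def by blast
      obtain r e where "e > 0" "\<forall>m'\<in>LFmeasures. cells_close r e m m' \<longrightarrow> \<bar>integral\<^sup>L m' f - integral\<^sup>L
        m f\<bar> < t"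
        using integral_Cc_plus_close[OF s(2) mL(1) t(1)] by blast
      then show "\<exists>r. \<exists>e>0. \<forall>m'\<in>LFmeasures. cells_close r e m m' \<longrightarrow> m' \<in> s"
        using t(2) nn by (intro exI[of _ r] exI[of _ e]) (auto simp: s(1))
    qed
  qed simp
  then show ?thesis using mL T(2) by blast
qed

lemma topspace_vague_topology: "topspace vague_topology = LFmeasures"
proof -
  have "(\<lambda>z. 0) \<in> Cc_plus" unfolding Cc_plus_def by (auto intro!: exI[of _ "{}"])
  then have "UNIV \<in> {{m. (\<integral>\<^sup>+ z. ennreal (f z) \<partial>m) \<in> U} | f U. f \<in> Cc_plus \<and> open U}"
    by (auto intro!: exI[of _ "\<lambda>z. 0"] exI[of _ UNIV])
  then have "\<Union> {{m. (\<integral>\<^sup>+ z. ennreal (f z) \<partial>m) \<in> U} | f U. f \<in> Cc_plus \<and> open U} = UNIV"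
    by blast
  then show ?thesis
    unfolding vague_topology_def topspace_subtopology topology_generated_by_topspace by simp
qed

section \<open>Finite vectors of cell masses as coordinates of vaguely open sets\<close>

definition cell_masses :: "nat \<Rightarrow> (real \<times> real) measure \<Rightarrow> int \<times> int \<Rightarrow> real" where
  "cell_masses r m k = (if k \<in> window r then measure m (dyadic_cell r k) else 0)"

text \<open>Mass vectors that force membership in \<open>G\<close> with some tolerance. A vector
  need not come from any measure; allowing all of them makes this an open set of functions, so its
  preimages are measurable.\<close>

definition masses_inside :: "nat \<Rightarrow> (real \<times> real) measure set \<Rightarrow> (int \<times> int \<Rightarrow> real) set" where
  "masses_inside r G = {\<phi>. \<exists>e>0. \<forall>m'\<in>LFmeasures.
     (\<forall>k\<in>window r. \<bar>measure m' (dyadic_cell r k) - \<phi> k\<bar> < e) \<longrightarrow> m' \<in> G}"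

lemma masses_inside_iff:
  "cell_masses r m \<in> masses_inside r G \<longleftrightarrow> (\<exists>e>0. \<forall>m'\<in>LFmeasures. cells_close r e m m' \<longrightarrow> m' \<in> G)"
  unfolding masses_inside_def cells_close_def cell_masses_def by auto

text \<open>Only the finitely many coordinates in the window are constrained, so a ball of half the
  tolerance is open in the product topology and the triangle inequality keeps it inside.\<close>

lemma open_masses_inside: "open (masses_inside r G)"
proof (subst open_subopen, intro ballI)
  fix \<phi> assume "\<phi> \<in> masses_inside r G"
  then obtain e where e: "e > 0" "\<And>m'. m' \<in> LFmeasures \<Longrightarrow> (\<forall>k\<in>window r. \<bar>measure m' (dyadic_cell r k)
    - \<phi> k\<bar> < e) \<Longrightarrow> m' \<in> G"
    unfolding masses_inside_def by blast
  let ?T = "\<Inter>k\<in>window r. {\<psi> :: int \<times> int \<Rightarrow> real. \<bar>\<psi> k - \<phi> k\<bar> < e / 2}"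
  have "open ?T"
    by (intro open_INT finite_window ballI open_Collect_less continuous_intros) (auto intro:
      continuous_on_product_coordinates)
  moreover have "\<phi> \<in> ?T" using e(1) by simp
  moreover have "?T \<subseteq> masses_inside r G"
  proof
    fix \<psi> assume \<psi>: "\<psi> \<in> ?T"
    have "m' \<in> G" if m': "m' \<in> LFmeasures" "\<forall>k\<in>window r. \<bar>measure m' (dyadic_cell r k) - \<psi> k\<bar> < e /
      2" for m'
    proof (rule e(2)[OF m'(1)], intro ballI)
      fix k assume "k \<in> window r"
      then have "\<bar>measure m' (dyadic_cell r k) - \<psi> k\<bar> < e / 2" "\<bar>\<psi> k - \<phi> k\<bar> < e / 2" using m'(2) \<psi>
        by auto
      then show "\<bar>measure m' (dyadic_cell r k) - \<phi> k\<bar> < e" by linarith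
    qed
    then show "\<psi> \<in> masses_inside r G" unfolding masses_inside_def using e(1) by (auto intro!: exI[of
      _ "e/2"])
  qed
  ultimately show "\<exists>T. open T \<and> \<phi> \<in> T \<and> T \<subseteq> masses_inside r G" by blast
qed

lemma masses_inside_imp: "m \<in> LFmeasures \<Longrightarrow> cell_masses r m \<in> masses_inside r G \<Longrightarrow> m \<in> G"
  unfolding masses_inside_iff cells_close_def by auto

text \<open>A tolerance \<open>e\<close> becomes \<open>e / 4\<close> at the next scale. Thus the
  events attached to \<open>G\<close> increase with \<open>r\<close>, which later permits continuity
  from below.\<close>

lemma masses_inside_Suc:
  assumes "m \<in> LFmeasures" "cell_masses r m \<in> masses_inside r G"
  shows "cell_masses (Suc r) m \<in> masses_inside (Suc r) G"
proof -
  obtain e where e: "e > 0" "\<forall>m'\<in>LFmeasures. cells_close r e m m' \<longrightarrow> m' \<in> G"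
    using assms(2) unfolding masses_inside_iff by blast
  then show ?thesis unfolding masses_inside_iff
    using cells_close_refine[OF assms(1), of _ r 1 e] by (intro exI[of _ "e/4"]) auto
qed

text \<open>Writes membership in an arbitrary vaguely open set as a countable union of conditions on
  finitely many cell masses; measurability and approximation from below both rest on it.\<close>

lemma vague_open_iff_masses:
  assumes "openin vague_topology G" "m \<in> LFmeasures"
  shows "m \<in> G \<longleftrightarrow> (\<exists>r. cell_masses r m \<in> masses_inside r G)"
  using vague_open_cells_close[OF assms(1)] masses_inside_imp[OF assms(2)] unfolding
    masses_inside_iff by blast

section \<open>Weak convergence from void probabilities\<close>

lemma measurable_vague_open:
  assumes X: "\<And>\<omega>. \<omega> \<in> space M \<Longrightarrow> X \<omega> \<in> LFmeasures"
    and meas: "\<And>r k. k \<in> window r \<Longrightarrow> (\<lambda>\<omega>. emeasure (X \<omega>) (dyadic_cell r k)) \<in> borel_measurable M"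
    and G: "openin vague_topology G"
  shows "{\<omega> \<in> space M. cell_masses r (X \<omega>) \<in> masses_inside r G} \<in> sets M"
    and "{\<omega> \<in> space M. X \<omega> \<in> G} \<in> sets M"
proof -
  have "(\<lambda>\<omega>. cell_masses r (X \<omega>) k) \<in> borel_measurable M" for r k
    using meas[of k r] unfolding cell_masses_def measure_def by (cases "k \<in> window r") auto
  \<comment> \<open>The index set \<open>int \<times> int\<close> is countable, so coordinatewise
    measurability suffices for the Borel sets of the product topology.\<close>
  then have "(\<lambda>\<omega>. cell_masses r (X \<omega>)) \<in> borel_measurable M" for r
    by (rule measurable_coordinatewise_then_product)
  from measurable_sets[OF this borel_open[OF open_masses_inside]]
  show *: "{\<omega> \<in> space M. cell_masses r (X \<omega>) \<in> masses_inside r G} \<in> sets M" for r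
    by (simp add: vimage_def Int_def conj_commute)
  have "{\<omega> \<in> space M. X \<omega> \<in> G} = (\<Union>r. {\<omega> \<in> space M. cell_masses r (X \<omega>) \<in> masses_inside r G})"
    using vague_open_iff_masses[OF G] X by auto
  then show "{\<omega> \<in> space M. X \<omega> \<in> G} \<in> sets M" using * by auto
qed

lemma openin_vague_preimage:
  assumes "continuous_map vague_topology euclidean g" "open U"
  shows "openin vague_topology {m \<in> LFmeasures. g m \<in> U}"
  using openin_continuous_map_preimage[OF assms(1), of U] assms(2) by (simp add: topspace_vague_topology)

text \<open>Inclusion and exclusion as an induction on the occupied set \<open>D\<close>: requiring
  \<open>d\<close> to be occupied means subtracting the probability with \<open>d\<close> moved to
  the void set. The void set therefore varies in the induction.\<close>

lemma tendsto_prob_occupied_void: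
  fixes Q :: "nat \<Rightarrow> 'i \<Rightarrow> 'a \<Rightarrow> bool" and Q' :: "'i \<Rightarrow> 'b \<Rightarrow> bool"
  assumes M: "prob_space M" and N: "prob_space N"
    and meas: "\<And>n i. i \<in> J \<Longrightarrow> {\<omega> \<in> space M. Q n i \<omega>} \<in> sets M"
    and meas': "\<And>i. i \<in> J \<Longrightarrow> {\<omega> \<in> space N. Q' i \<omega>} \<in> sets N"
    and fin: "finite J"
    and void: "\<And>A. A \<subseteq> J \<Longrightarrow> (\<lambda>n. measure M {\<omega> \<in> space M. \<forall>i\<in>A. \<not> Q n i \<omega>})
        \<longlonglongrightarrow> measure N {\<omega> \<in> space N. \<forall>i\<in>A. \<not> Q' i \<omega>}"
    and "finite D" "D \<subseteq> J" "A \<subseteq> J"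
  shows "(\<lambda>n. measure M {\<omega> \<in> space M. (\<forall>i\<in>A. \<not> Q n i \<omega>) \<and> (\<forall>i\<in>D. Q n i \<omega>)})
        \<longlonglongrightarrow> measure N {\<omega> \<in> space N. (\<forall>i\<in>A. \<not> Q' i \<omega>) \<and> (\<forall>i\<in>D. Q' i \<omega>)}"
  using assms(7-)
proof (induction D arbitrary: A rule: finite_induct)
  case empty
  then show ?case using void by simp
next
  case (insert d D)
  interpret M: prob_space M by fact
  interpret N: prob_space N by fact
  have split: "measure R {\<omega> \<in> space R. (\<forall>i\<in>A. \<not> q i \<omega>) \<and> (\<forall>i\<in>insert d D. q i \<omega>)} =
      measure R {\<omega> \<in> space R. (\<forall>i\<in>A. \<not> q i \<omega>) \<and> (\<forall>i\<in>D. q i \<omega>)} -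
      measure R {\<omega> \<in> space R. (\<forall>i\<in>insert d A. \<not> q i \<omega>) \<and> (\<forall>i\<in>D. q i \<omega>)}"
    if R: "prob_space R" and m: "\<And>i. i \<in> J \<Longrightarrow> {\<omega> \<in> space R. q i \<omega>} \<in> sets R"
    for R :: "'c measure" and q :: "'i \<Rightarrow> 'c \<Rightarrow> bool"
  proof -
    interpret R: prob_space R by fact
    have fA: "finite A" "finite D" using fin insert.prems insert.hyps finite_subset by auto
    have 1: "{\<omega> \<in> space R. (\<forall>i\<in>A'. \<not> q i \<omega>) \<and> (\<forall>i\<in>D. q i \<omega>)} \<in> sets R" if "A' \<subseteq> J" for A'
    proof -
      have "finite A'" using that fin finite_subset by auto
      then show ?thesis
        using m that insert.prems fA
        by (intro sets.sets_Collect_conj sets.sets_Collect_finite_All sets.sets_Collect_neg) auto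
    qed
    have "measure R ({\<omega> \<in> space R. (\<forall>i\<in>A. \<not> q i \<omega>) \<and> (\<forall>i\<in>D. q i \<omega>)} -
      {\<omega> \<in> space R. (\<forall>i\<in>insert d A. \<not> q i \<omega>) \<and> (\<forall>i\<in>D. q i \<omega>)}) =
      measure R {\<omega> \<in> space R. (\<forall>i\<in>A. \<not> q i \<omega>) \<and> (\<forall>i\<in>D. q i \<omega>)} -
      measure R {\<omega> \<in> space R. (\<forall>i\<in>insert d A. \<not> q i \<omega>) \<and> (\<forall>i\<in>D. q i \<omega>)}"
      using insert.prems by (intro R.finite_measure_Diff 1) auto
    moreover have "{\<omega> \<in> space R. (\<forall>i\<in>A. \<not> q i \<omega>) \<and> (\<forall>i\<in>D. q i \<omega>)} -
      {\<omega> \<in> space R. (\<forall>i\<in>insert d A. \<not> q i \<omega>) \<and> (\<forall>i\<in>D. q i \<omega>)} =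
      {\<omega> \<in> space R. (\<forall>i\<in>A. \<not> q i \<omega>) \<and> (\<forall>i\<in>insert d D. q i \<omega>)}" by auto
    ultimately show ?thesis by simp
  qed
  show ?case
    by (subst split[OF M meas], assumption, subst split[OF N meas'], assumption, intro tendsto_diff
      insert.IH)
      (use insert.prems in auto)
qed

text \<open>Any condition on the random set of occupied indices is a finite disjoint union, over the
  admissible sets, of the events of \<open>tendsto_prob_occupied_void\<close>.\<close>

lemma tendsto_prob_occupied_set:
  fixes Q :: "nat \<Rightarrow> 'i \<Rightarrow> 'a \<Rightarrow> bool" and Q' :: "'i \<Rightarrow> 'b \<Rightarrow> bool"
  assumes M: "prob_space M" and N: "prob_space N"
    and meas: "\<And>n i. i \<in> J \<Longrightarrow> {\<omega> \<in> space M. Q n i \<omega>} \<in> sets M"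
    and meas': "\<And>i. i \<in> J \<Longrightarrow> {\<omega> \<in> space N. Q' i \<omega>} \<in> sets N"
    and fin: "finite J"
    and void: "\<And>A. A \<subseteq> J \<Longrightarrow> (\<lambda>n. measure M {\<omega> \<in> space M. \<forall>i\<in>A. \<not> Q n i \<omega>})
        \<longlonglongrightarrow> measure N {\<omega> \<in> space N. \<forall>i\<in>A. \<not> Q' i \<omega>}"
  shows "{\<omega> \<in> space M. {i\<in>J. Q n i \<omega>} \<in> \<D>} \<in> sets M" "{\<omega> \<in> space N. {i\<in>J. Q' i \<omega>} \<in> \<D>} \<in> sets N"
    "(\<lambda>n. measure M {\<omega> \<in> space M. {i\<in>J. Q n i \<omega>} \<in> \<D>}) \<longlonglongrightarrow> measure N {\<omega> \<in> space N. {i\<in>J. Q' i \<omega>} \<in> \<D>}"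
proof -
  have eq: "{\<omega> \<in> space R. {i\<in>J. q i \<omega>} \<in> \<D>} =
     (\<Union>D\<in>\<D> \<inter> Pow J. {\<omega> \<in> space R. (\<forall>i\<in>J - D. \<not> q i \<omega>) \<and> (\<forall>i\<in>D. q i \<omega>)})"
    for R :: "'c measure" and q :: "'i \<Rightarrow> 'c \<Rightarrow> bool"
  proof (intro set_eqI iffI)
    fix \<omega> assume "\<omega> \<in> {\<omega> \<in> space R. {i\<in>J. q i \<omega>} \<in> \<D>}"
    then show "\<omega> \<in> (\<Union>D\<in>\<D> \<inter> Pow J. {\<omega> \<in> space R. (\<forall>i\<in>J - D. \<not> q i \<omega>) \<and> (\<forall>i\<in>D. q i \<omega>)})"
      by (intro UN_I[of "{i\<in>J. q i \<omega>}"]) auto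
  next
    fix \<omega> assume "\<omega> \<in> (\<Union>D\<in>\<D> \<inter> Pow J. {\<omega> \<in> space R. (\<forall>i\<in>J - D. \<not> q i \<omega>) \<and> (\<forall>i\<in>D. q i \<omega>)})"
    then obtain D where D: "D \<in> \<D>" "D \<subseteq> J" "\<omega> \<in> space R" "\<forall>i\<in>J - D. \<not> q i \<omega>" "\<forall>i\<in>D. q i \<omega>" by auto
    then have "{i\<in>J. q i \<omega>} = D" by auto
    with D show "\<omega> \<in> {\<omega> \<in> space R. {i\<in>J. q i \<omega>} \<in> \<D>}" by simp
  qed
  have ms: "{\<omega> \<in> space R. (\<forall>i\<in>J - D. \<not> q i \<omega>) \<and> (\<forall>i\<in>D. q i \<omega>)} \<in> sets R"
    if m: "\<And>i. i \<in> J \<Longrightarrow> {\<omega> \<in> space R. q i \<omega>} \<in> sets R" and "D \<subseteq> J"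
    for R :: "'c measure" and q :: "'i \<Rightarrow> 'c \<Rightarrow> bool" and D
  proof -
    have "finite D" using that(2) fin finite_subset by auto
    then show ?thesis
      using m that(2) fin
      by (intro sets.sets_Collect_conj sets.sets_Collect_finite_All sets.sets_Collect_neg) auto
  qed
  show mM: "{\<omega> \<in> space M. {i\<in>J. Q n i \<omega>} \<in> \<D>} \<in> sets M" for n
    unfolding eq[of M "Q n"] using fin by (intro sets.finite_UN ms meas) auto
  show "{\<omega> \<in> space N. {i\<in>J. Q' i \<omega>} \<in> \<D>} \<in> sets N"
    unfolding eq[of N Q'] using fin by (intro sets.finite_UN ms meas') auto
  have sum: "measure R {\<omega> \<in> space R. {i\<in>J. q i \<omega>} \<in> \<D>} =
     (\<Sum>D\<in>\<D> \<inter> Pow J. measure R {\<omega> \<in> space R. (\<forall>i\<in>J - D. \<not> q i \<omega>) \<and> (\<forall>i\<in>D. q i \<omega>)})"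
    if R: "prob_space R" and m: "\<And>i. i \<in> J \<Longrightarrow> {\<omega> \<in> space R. q i \<omega>} \<in> sets R"
    for R :: "'c measure" and q :: "'i \<Rightarrow> 'c \<Rightarrow> bool"
  proof -
    interpret R: prob_space R by fact
    show ?thesis
      unfolding eq[of R q]
    proof (rule R.finite_measure_finite_Union)
      show "disjoint_family_on (\<lambda>D. {\<omega> \<in> space R. (\<forall>i\<in>J - D. \<not> q i \<omega>) \<and> (\<forall>i\<in>D. q i \<omega>)}) (\<D> \<inter> Pow J)"
        unfolding disjoint_family_on_def by blast
    qed (use fin ms[OF m] in auto)
  qed
  show "(\<lambda>n. measure M {\<omega> \<in> space M. {i\<in>J. Q n i \<omega>} \<in> \<D>}) \<longlonglongrightarrow> measure N {\<omega> \<in> space N. {i\<in>J. Q' i \<omega>} \<in> \<D>}"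
  proof (subst sum[OF M meas], assumption, subst sum[OF N meas'], assumption, intro tendsto_sum)
    fix D assume "D \<in> \<D> \<inter> Pow J"
    then show "(\<lambda>n. measure M {\<omega> \<in> space M. (\<forall>i\<in>J - D. \<not> Q n i \<omega>) \<and> (\<forall>i\<in>D. Q n i \<omega>)})
      \<longlonglongrightarrow> measure N {\<omega> \<in> space N. (\<forall>i\<in>J - D. \<not> Q' i \<omega>) \<and> (\<forall>i\<in>D. Q' i \<omega>)}"
      using finite_subset[OF _ fin, of D]
      by (intro tendsto_prob_occupied_void[OF M N meas meas' fin void]) auto
  qed
qed

text \<open>With at most one point per strip, the mass of a dyadic cell is the number of its
  occupied strips, so the mass vector is a function of the occupied set.\<close>

lemma cell_masses_from_occupied:
  assumes m: "m \<in> LFmeasures" and K: "K > 0"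
    and J: "J = (\<Union>k\<in>window r. refine_idx K 1 k)"
    and simple: "\<And>k. k \<in> J \<Longrightarrow> emeasure m (grid_cell (2 ^ r * K) (2 ^ r) k) \<in> {0, 1}"
  shows "cell_masses r m = (\<lambda>k. if k \<in> window r
     then real (card (refine_idx K 1 k \<inter> {k\<in>J. emeasure m (grid_cell (2 ^ r * K) (2 ^ r) k) \<noteq> 0}))
       else 0)"
proof
  fix k
  let ?c = "grid_cell (2 ^ r * K) (2 ^ r)"
  show "cell_masses r m k = (if k \<in> window r
     then real (card (refine_idx K 1 k \<inter> {k\<in>J. emeasure m (?c k) \<noteq> 0})) else 0)"
  proof (cases "k \<in> window r")
    case True
    have fin: "finite (refine_idx K 1 k)" using K by (simp add: finite_refine_idx)
    have "measure m (dyadic_cell r k) = (\<Sum>k'\<in>refine_idx K 1 k. measure m (?c k'))"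
      using measure_grid_cell_refine[OF m K, of 1 "2^r" "2^r" k] window_snd[OF True] by simp
    also have "\<dots> = (\<Sum>k'\<in>refine_idx K 1 k. if k' \<in> {k\<in>J. emeasure m (?c k) \<noteq> 0} then 1 else 0)"
    proof (rule sum.cong[OF refl])
      fix k' assume "k' \<in> refine_idx K 1 k"
      then have "k' \<in> J" using J True by blast
      then show "measure m (?c k') = (if k' \<in> {k\<in>J. emeasure m (?c k) \<noteq> 0} then 1 else 0)"
        using simple[of k'] by (auto simp: measure_def)
    qed
    also have "\<dots> = real (card (refine_idx K 1 k \<inter> {k\<in>J. emeasure m (?c k) \<noteq> 0}))"
      using fin by (simp add: sum.If_cases Int_def)
    finally show ?thesis using True by (simp add: cell_masses_def)
  qed (simp add: cell_masses_def)
qed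


text \<open>The loss \<open>e\<close> is spent as follows: e/2 for replacing \<open>G\<close> by a
  condition on cell masses at one scale, e/8 and e/4 for multiple points of \<open>Y\<close> and
  \<open>X n\<close>, and e/8 for convergence of the law of the occupied set. The weight
  \<open>l\<close> depends on the row alone, so refining columns divides it by the number of
  strips.\<close>

lemma vague_liminf_open:
  fixes X :: "nat \<Rightarrow> 'a \<Rightarrow> (real \<times> real) measure" and Y :: "'b \<Rightarrow> (real \<times> real) measure"
    and l :: "nat \<Rightarrow> int \<Rightarrow> real"
  assumes M: "prob_space M" and N: "prob_space N"
    and X: "\<And>n \<omega>. \<omega> \<in> space M \<Longrightarrow> X n \<omega> \<in> LFmeasures"
    and Y: "\<And>\<omega>. \<omega> \<in> space N \<Longrightarrow> Y \<omega> \<in> LFmeasures"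
    and measX: "\<And>n a b k. a > 0 \<Longrightarrow> b > 0 \<Longrightarrow> snd k \<ge> 1 \<Longrightarrow>
        (\<lambda>\<omega>. emeasure (X n \<omega>) (grid_cell a b k)) \<in> borel_measurable M"
    and measY: "\<And>a b k. a > 0 \<Longrightarrow> b > 0 \<Longrightarrow> snd k \<ge> 1 \<Longrightarrow>
        (\<lambda>\<omega>. emeasure (Y \<omega>) (grid_cell a b k)) \<in> borel_measurable N"
    and void: "\<And>a b A. a > 0 \<Longrightarrow> b > 0 \<Longrightarrow> finite A \<Longrightarrow> (\<And>k. k \<in> A \<Longrightarrow> snd k \<ge> 1) \<Longrightarrow>
        (\<lambda>n. measure M {\<omega> \<in> space M. \<forall>k\<in>A. emeasure (X n \<omega>) (grid_cell a b k) = 0}) \<longlonglongrightarrow>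
        measure N {\<omega> \<in> space N. \<forall>k\<in>A. emeasure (Y \<omega>) (grid_cell a b k) = 0}"
    and multX: "\<And>a b k e. a > 0 \<Longrightarrow> b > 0 \<Longrightarrow> snd k \<ge> 1 \<Longrightarrow> e > 0 \<Longrightarrow>
        \<forall>\<^sub>F n in sequentially. measure M {\<omega> \<in> space M. emeasure (X n \<omega>) (grid_cell a b k) \<notin> {0, 1}}
          \<le> (l b (snd k) / real a)\<^sup>2 + e"
    and multY: "\<And>a b k. a > 0 \<Longrightarrow> b > 0 \<Longrightarrow> snd k \<ge> 1 \<Longrightarrow>
        measure N {\<omega> \<in> space N. emeasure (Y \<omega>) (grid_cell a b k) \<notin> {0, 1}} \<le> (l b (snd k) / real a)\<^sup>2"
    and G: "openin vague_topology G" and e: "e > 0"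
  shows "\<forall>\<^sub>F n in sequentially. measure M {\<omega> \<in> space M. X n \<omega> \<in> G} > measure N {\<omega> \<in> space N. Y \<omega> \<in>
    G} - e"
proof -
  interpret M: prob_space M by fact
  interpret N: prob_space N by fact
  have setsX: "{\<omega> \<in> space M. cell_masses r (X n \<omega>) \<in> masses_inside r G} \<in> sets M" "{\<omega> \<in> space M. X n
    \<omega> \<in> G} \<in> sets M" for r n
    using window_snd by (intro measurable_vague_open X measX G; simp)+
  have setsY: "{\<omega> \<in> space N. cell_masses r (Y \<omega>) \<in> masses_inside r G} \<in> sets N" for r
    using window_snd by (intro measurable_vague_open(1) Y measY G) auto
  have "(\<lambda>r. measure N {\<omega> \<in> space N. cell_masses r (Y \<omega>) \<in> masses_inside r G}) \<longlonglongrightarrow>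
      measure N (\<Union>r. {\<omega> \<in> space N. cell_masses r (Y \<omega>) \<in> masses_inside r G})"
    using setsY masses_inside_Suc[OF Y] by (intro N.finite_Lim_measure_incseq incseq_SucI) auto
  also have "(\<Union>r. {\<omega> \<in> space N. cell_masses r (Y \<omega>) \<in> masses_inside r G}) = {\<omega> \<in> space N. Y \<omega> \<in> G}"
    using vague_open_iff_masses[OF G Y] by auto
  finally have "\<forall>\<^sub>F r in sequentially. measure N {\<omega> \<in> space N. cell_masses r (Y \<omega>) \<in> masses_inside r G}
     > measure N {\<omega> \<in> space N. Y \<omega> \<in> G} - e / 2"
    using e by (intro order_tendstoD(1)) auto
  then obtain r where r: "measure N {\<omega> \<in> space N. cell_masses r (Y \<omega>) \<in> masses_inside r G}
     > measure N {\<omega> \<in> space N. Y \<omega> \<in> G} - e / 2"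
    by (auto simp: eventually_sequentially)
  \<comment> \<open>The squared weights before cutting. With \<open>K\<close> strips each square w^2
    becomes K (w / K)^2, so the sum drops to \<open>C / real K\<close>, and \<open>K\<close> is
    chosen to push this below e/8.\<close>
  define C where "C = (\<Sum>k\<in>window r. (l (2 ^ r) (snd k) / 2 ^ r)\<^sup>2)"
  have C: "C \<ge> 0" unfolding C_def by (intro sum_nonneg) auto
  obtain K :: nat where K0: "8 * C / e < real K" using reals_Archimedean2 by blast
  moreover have "8 * C / e \<ge> 0" using C e by simp
  ultimately have K: "K > 0" by (metis leD of_nat_0_less_iff le_less_trans)
  define J where "J = (\<Union>k\<in>window r. refine_idx K 1 k)"
  have finJ: "finite J" unfolding J_def using K by (intro finite_UN_I finite_refine_idx) auto
  have Jsnd: "snd k \<ge> 1" if "k \<in> J" for k using that window_snd unfolding J_def refine_idx_def by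
    fastforce
  let ?a = "2 ^ r * K" and ?b = "2 ^ r :: nat"
  let ?c = "grid_cell ?a ?b"
  have a: "?a > 0" using K by simp
  have b: "?b > 0" by simp
  have sumJ: "(\<Sum>k\<in>J. (l ?b (snd k) / real ?a)\<^sup>2) = C / real K"
  proof -
    have "(\<Sum>k\<in>J. (l ?b (snd k) / real ?a)\<^sup>2) = (\<Sum>k\<in>window r. \<Sum>k'\<in>refine_idx K 1 k. (l ?b (snd k') /
      real ?a)\<^sup>2)"
      unfolding J_def using K by (intro sum.UNION_disjoint ballI finite_refine_idx finite_window
        impI) (auto simp: refine_idx_def)
    also have "\<dots> = (\<Sum>k\<in>window r. (l ?b (snd k) / 2 ^ r)\<^sup>2 / real K)"
    proof (rule sum.cong[OF refl])
      fix k
      have "(\<Sum>k'\<in>refine_idx K 1 k. (l ?b (snd k') / real ?a)\<^sup>2) = (\<Sum>k'\<in>refine_idx K 1 k. (l ?b (snd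
        k) / real ?a)\<^sup>2)"
        by (intro sum.cong) (auto simp: refine_idx_def)
      also have "\<dots> = real K * (l ?b (snd k) / real ?a)\<^sup>2" using K by (simp add: card_refine_idx)
      also have "\<dots> = (l ?b (snd k) / 2 ^ r)\<^sup>2 / real K" using K by (simp add: power2_eq_square
        field_simps)
      finally show "(\<Sum>k'\<in>refine_idx K 1 k. (l ?b (snd k') / real ?a)\<^sup>2) = (l ?b (snd k) / 2 ^ r)\<^sup>2 /
        real K" .
    qed
    finally show ?thesis unfolding C_def by (simp add: sum_divide_distrib)
  qed
  have CK: "C / real K < e / 8" using K0 e K by (simp add: field_simps)
  \<comment> \<open>The mass vector that the occupied set \<open>D\<close> would produce if no strip
    held two points; \<open>\<D>\<close> collects the sets whose vector forces membership in
    \<open>G\<close>.\<close>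
  define \<psi> where "\<psi> D = (\<lambda>k. if k \<in> window r then real (card (refine_idx K 1 k \<inter> D)) else 0)" for D
  define \<D> where "\<D> = {D. \<psi> D \<in> masses_inside r G}"
  define BX where "BX n = {\<omega> \<in> space M. \<exists>k\<in>J. emeasure (X n \<omega>) (?c k) \<notin> {0, 1}}" for n
  define BY where "BY = {\<omega> \<in> space N. \<exists>k\<in>J. emeasure (Y \<omega>) (?c k) \<notin> {0, 1}}"
  have mX: "{\<omega> \<in> space M. emeasure (X n \<omega>) (?c k) \<notin> {0, 1}} \<in> sets M" "{\<omega> \<in> space M. emeasure (X n
    \<omega>) (?c k) \<noteq> 0} \<in> sets M"
    if "k \<in> J" for n k
    using measurable_sets[OF measX[OF a b Jsnd[OF that]], of "- {0,1}" n] measurable_sets[OF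
      measX[OF a b Jsnd[OF that]], of "- {0}" n]
    by (simp_all add: vimage_def Int_def conj_commute)
  have mY: "{\<omega> \<in> space N. emeasure (Y \<omega>) (?c k) \<notin> {0, 1}} \<in> sets N" "{\<omega> \<in> space N. emeasure (Y \<omega>)
    (?c k) \<noteq> 0} \<in> sets N"
    if "k \<in> J" for k
    using measurable_sets[OF measY[OF a b Jsnd[OF that]], of "- {0,1}"] measurable_sets[OF measY[OF
      a b Jsnd[OF that]], of "- {0}"]
    by (simp_all add: vimage_def Int_def conj_commute)
  have BXeq: "BX n = (\<Union>k\<in>J. {\<omega> \<in> space M. emeasure (X n \<omega>) (?c k) \<notin> {0, 1}})" for n unfolding BX_def
    by auto
  have BYeq: "BY = (\<Union>k\<in>J. {\<omega> \<in> space N. emeasure (Y \<omega>) (?c k) \<notin> {0, 1}})" unfolding BY_def by auto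
  have BXs: "BX n \<in> sets M" for n unfolding BXeq using finJ mX by (intro sets.finite_UN) auto
  have BYs: "BY \<in> sets N" unfolding BYeq using finJ mY by (intro sets.finite_UN) auto
  have PBY: "measure N BY \<le> e / 8"
  proof -
    have "measure N BY \<le> (\<Sum>k\<in>J. measure N {\<omega> \<in> space N. emeasure (Y \<omega>) (?c k) \<notin> {0, 1}})"
      unfolding BYeq using finJ mY by (intro N.finite_measure_subadditive_finite) auto
    also have "\<dots> \<le> (\<Sum>k\<in>J. (l ?b (snd k) / real ?a)\<^sup>2)" by (intro sum_mono multY a b Jsnd)
    finally show ?thesis using sumJ CK by linarith
  qed
  \<comment> \<open>The slack of \<open>multX\<close> is distributed over the strips so that its
    total is at most e/8.\<close>
  define e' where "e' = e / (8 * (real (card J) + 1))"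
  have e': "e' > 0" unfolding e'_def using e by (simp add: add_nonneg_pos)
  have cJ: "real (card J) * e' \<le> e / 8"
  proof -
    have "real (card J) * e' = e / 8 * (real (card J) / (real (card J) + 1))" unfolding e'_def by
      (simp add: divide_simps)
    also have "\<dots> \<le> e / 8 * 1" using e by (intro mult_left_mono) auto
    finally show ?thesis by simp
  qed
  have "\<forall>\<^sub>F n in sequentially. \<forall>k\<in>J. measure M {\<omega> \<in> space M. emeasure (X n \<omega>) (?c k) \<notin> {0, 1}}
          \<le> (l ?b (snd k) / real ?a)\<^sup>2 + e'"
    using finJ by (intro eventually_ball_finite ballI multX a b Jsnd e')
  then have PBX: "\<forall>\<^sub>F n in sequentially. measure M (BX n) \<le> e / 4"
  proof eventually_elim
    case (elim n)
    have "measure M (BX n) \<le> (\<Sum>k\<in>J. measure M {\<omega> \<in> space M. emeasure (X n \<omega>) (?c k) \<notin> {0, 1}})"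
      unfolding BXeq using finJ mX by (intro M.finite_measure_subadditive_finite) auto
    also have "\<dots> \<le> (\<Sum>k\<in>J. (l ?b (snd k) / real ?a)\<^sup>2 + e')" by (intro sum_mono) (use elim in auto)
    also have "\<dots> = C / real K + real (card J) * e'" by (simp only: sum.distrib sumJ sum_constant)
    finally show ?case using CK cJ by linarith
  qed
  note occ = tendsto_prob_occupied_set[where M = M and N = N and J = J and \<D> = \<D> and
      Q = "\<lambda>n k \<omega>. emeasure (X n \<omega>) (?c k) \<noteq> 0" and Q' = "\<lambda>k \<omega>. emeasure (Y \<omega>) (?c k) \<noteq> 0", OF M N
        mX(2) mY(2) finJ]
  have vd: "(\<lambda>n. measure M {\<omega> \<in> space M. \<forall>i\<in>A. \<not> emeasure (X n \<omega>) (?c i) \<noteq> 0}) \<longlonglongrightarrow>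
        measure N {\<omega> \<in> space N. \<forall>i\<in>A. \<not> emeasure (Y \<omega>) (?c i) \<noteq> 0}" if "A \<subseteq> J" for A
    using void[OF a b finite_subset[OF that finJ]] Jsnd that by auto
  let ?OX = "\<lambda>n. {\<omega> \<in> space M. {k\<in>J. emeasure (X n \<omega>) (?c k) \<noteq> 0} \<in> \<D>}"
  let ?OY = "{\<omega> \<in> space N. {k\<in>J. emeasure (Y \<omega>) (?c k) \<noteq> 0} \<in> \<D>}"
  have lim: "(\<lambda>n. measure M (?OX n)) \<longlonglongrightarrow> measure N ?OY" and OXs: "?OX n \<in> sets M" and OYs: "?OY \<in> sets
    N" for n
    using vd by (auto intro!: occ)
  have masses: "cell_masses r m = \<psi> {k\<in>J. emeasure m (?c k) \<noteq> 0}"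
    if "m \<in> LFmeasures" "\<And>k. k \<in> J \<Longrightarrow> emeasure m (?c k) \<in> {0, 1}" for m
    unfolding \<psi>_def using that by (intro cell_masses_from_occupied[OF _ K J_def])
  have "measure N {\<omega> \<in> space N. cell_masses r (Y \<omega>) \<in> masses_inside r G} \<le> measure N (?OY \<union> BY)"
    using masses Y OYs BYs by (intro N.finite_measure_mono) (auto simp: BY_def \<D>_def)
  also have "\<dots> \<le> measure N ?OY + measure N BY" using OYs BYs by (intro measure_Un_le)
  finally have y: "measure N ?OY \<ge> measure N {\<omega> \<in> space N. cell_masses r (Y \<omega>) \<in> masses_inside r G}
    - e / 8"
    using PBY by linarith
  \<comment> \<open>One inclusion is enough here: off \<open>BX n\<close>, an occupied set in
    \<open>\<D>\<close> puts \<open>X n \<omega>\<close> into \<open>G\<close>. The converse may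
    fail at scale \<open>r\<close>, but a lower bound is all that is claimed.\<close>
  have x: "measure M {\<omega> \<in> space M. X n \<omega> \<in> G} \<ge> measure M (?OX n) - measure M (BX n)" for n
  proof -
    have "measure M (?OX n) \<le> measure M ({\<omega> \<in> space M. X n \<omega> \<in> G} \<union> BX n)"
    proof (intro M.finite_measure_mono)
      show "?OX n \<subseteq> {\<omega> \<in> space M. X n \<omega> \<in> G} \<union> BX n"
      proof
        fix \<omega> assume \<omega>: "\<omega> \<in> ?OX n"
        show "\<omega> \<in> {\<omega> \<in> space M. X n \<omega> \<in> G} \<union> BX n"
        proof (cases "\<omega> \<in> BX n")
          case False
          then have "cell_masses r (X n \<omega>) \<in> masses_inside r G"
            using masses[OF X] \<omega> by (auto simp: BX_def \<D>_def)
          then show ?thesis using masses_inside_imp[OF X] \<omega> by auto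
        qed simp
      qed
    qed (use setsX BXs in auto)
    also have "\<dots> \<le> measure M {\<omega> \<in> space M. X n \<omega> \<in> G} + measure M (BX n)"
      using setsX BXs by (intro measure_Un_le)
    finally show ?thesis by simp
  qed
  have "\<forall>\<^sub>F n in sequentially. measure M (?OX n) > measure N ?OY - e / 8"
    using e by (intro order_tendstoD(1)[OF lim]) auto
  with PBX show ?thesis
  proof eventually_elim
    case (elim n)
    then show ?case using x[of n] y r by linarith
  qed
qed

text \<open>A portmanteau argument. Preimages of open sets under a continuous \<open>g\<close> are
  vaguely open, so the bound passes to the laws of \<open>g (X n \<omega>)\<close> on the real line,
  where weak convergence can be tested with distribution functions.\<close>

lemma conv_distr_vague_if_liminf_open:
  fixes X :: "nat \<Rightarrow> 'a \<Rightarrow> (real \<times> real) measure" and Y :: "'b \<Rightarrow> (real \<times> real) measure"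
  assumes M: "prob_space M" and N: "prob_space N"
    and X: "\<And>n \<omega>. \<omega> \<in> space M \<Longrightarrow> X n \<omega> \<in> LFmeasures"
    and Y: "\<And>\<omega>. \<omega> \<in> space N \<Longrightarrow> Y \<omega> \<in> LFmeasures"
    and openX: "\<And>G n. openin vague_topology G \<Longrightarrow> {\<omega> \<in> space M. X n \<omega> \<in> G} \<in> sets M"
    and openY: "\<And>G. openin vague_topology G \<Longrightarrow> {\<omega> \<in> space N. Y \<omega> \<in> G} \<in> sets N"
    and liminf: "\<And>G e. openin vague_topology G \<Longrightarrow> e > 0 \<Longrightarrow>
      \<forall>\<^sub>F n in sequentially. measure M {\<omega> \<in> space M. X n \<omega> \<in> G} > measure N {\<omega> \<in> space N. Y \<omega> \<in> G} - e"
  shows "conv_distr_vague M X N Y"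
  unfolding conv_distr_vague_def
proof (intro allI impI, elim conjE)
  fix g :: "(real \<times> real) measure \<Rightarrow> real"
  assume g: "continuous_map vague_topology euclidean g" and bd: "bounded (g ` LFmeasures)"
  interpret M: prob_space M by fact
  interpret N: prob_space N by fact
  have preX: "{\<omega> \<in> space M. X n \<omega> \<in> {m \<in> LFmeasures. g m \<in> U}} = {\<omega> \<in> space M. g (X n \<omega>) \<in> U}" for n U
    using X by auto
  have preY: "{\<omega> \<in> space N. Y \<omega> \<in> {m \<in> LFmeasures. g m \<in> U}} = {\<omega> \<in> space N. g (Y \<omega>) \<in> U}" for U
    using Y by auto
  have mX [measurable]: "(\<lambda>\<omega>. g (X n \<omega>)) \<in> borel_measurable M" for n
  proof (rule borel_measurableI)
    fix U :: "real set" assume "open U"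
    from openX[OF openin_vague_preimage[OF g this], of n]
    show "(\<lambda>\<omega>. g (X n \<omega>)) -` U \<inter> space M \<in> sets M" unfolding preX by (simp add: vimage_def Int_def
      conj_commute)
  qed
  have mY [measurable]: "(\<lambda>\<omega>. g (Y \<omega>)) \<in> borel_measurable N"
  proof (rule borel_measurableI)
    fix U :: "real set" assume "open U"
    from openY[OF openin_vague_preimage[OF g this]]
    show "(\<lambda>\<omega>. g (Y \<omega>)) -` U \<inter> space N \<in> sets N" unfolding preY by (simp add: vimage_def Int_def
      conj_commute)
  qed
  have lim: "\<forall>\<^sub>F n in sequentially. measure M {\<omega> \<in> space M. g (X n \<omega>) \<in> U} > measure N {\<omega> \<in> space N.
    g (Y \<omega>) \<in> U} - e"
    if "open U" "e > 0" for U e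
    using liminf[OF openin_vague_preimage[OF g that(1)] that(2)] unfolding preX preY .
  let ?m = "\<lambda>n. distr M borel (\<lambda>\<omega>. g (X n \<omega>))" and ?m' = "distr N borel (\<lambda>\<omega>. g (Y \<omega>))"
  have rd: "real_distribution (?m n)" "real_distribution ?m'" for n
    using mX mY by (auto intro: M.real_distribution_distr N.real_distribution_distr)
  interpret m: real_distribution "?m n" for n by (rule rd)
  interpret m': real_distribution ?m' by (rule rd)
  have mm: "measure (?m n) A = measure M {\<omega> \<in> space M. g (X n \<omega>) \<in> A}" if "A \<in> sets borel" for n A
    using that by (subst measure_distr) (auto simp: vimage_def Int_def conj_commute)
  have mm': "measure ?m' A = measure N {\<omega> \<in> space N. g (Y \<omega>) \<in> A}" if "A \<in> sets borel" for A
    using that by (subst measure_distr) (auto simp: vimage_def Int_def conj_commute)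
  have "weak_conv_m ?m ?m'"
    unfolding weak_conv_m_def weak_conv_def
  proof (intro allI impI)
    fix x assume "isCont (cdf ?m') x"
    then have x0: "measure ?m' {x} = 0" using m'.isCont_cdf by simp
    show "(\<lambda>n. cdf (?m n) x) \<longlonglongrightarrow> cdf ?m' x"
    proof (rule LIMSEQ_I)
      fix e :: real assume e: "e > 0"
      \<comment> \<open>Both half-lines are open. The right one bounds the distribution functions
        from above through complements, the left one from below; the gap between
        \<open>{..<x}\<close> and \<open>{..x}\<close> is closed by the absence of an atom at
        \<open>x\<close>.\<close>
      have up: "\<forall>\<^sub>F n in sequentially. measure (?m n) {x<..} > measure ?m' {x<..} - e"
        using lim[OF _ e, of "{x<..}"] by (simp add: mm mm')
      have lo: "\<forall>\<^sub>F n in sequentially. measure (?m n) {..<x} > measure ?m' {..<x} - e"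
        using lim[OF _ e, of "{..<x}"] by (simp add: mm mm')
      have c: "measure (?m n) {x<..} = 1 - cdf (?m n) x" "measure ?m' {x<..} = 1 - cdf ?m' x" for n
      proof -
        have *: "{x<..} = UNIV - {..x}" by auto
        show "measure (?m n) {x<..} = 1 - cdf (?m n) x"
          unfolding * cdf_def2 using m.prob_compl[of "{..x}" n] by simp
        show "measure ?m' {x<..} = 1 - cdf ?m' x"
          unfolding * cdf_def2 using m'.prob_compl[of "{..x}"] by simp
      qed
      have d: "measure (?m n) {..<x} \<le> cdf (?m n) x" for n
        unfolding cdf_def2 by (intro m.finite_measure_mono) auto
      have "measure ?m' ({..<x} \<union> {x}) = measure ?m' {..<x} + measure ?m' {x}"
        by (intro m'.finite_measure_Union) auto
      moreover have "{..<x} \<union> {x} = {..x}" by auto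
      ultimately have d': "measure ?m' {..<x} = cdf ?m' x" using x0 by (simp add: cdf_def2)
      have "\<forall>\<^sub>F n in sequentially. norm (cdf (?m n) x - cdf ?m' x) < e"
        using up lo
      proof eventually_elim
        case (elim n)
        then show ?case using c(1)[of n] c(2) d[of n] d' by (simp add: abs_less_iff)
      qed
      then show "\<exists>no. \<forall>n\<ge>no. norm (cdf (?m n) x - cdf ?m' x) < e" by (simp add: eventually_sequentially)
    qed
  qed
  obtain B0 where B0: "\<And>m. m \<in> LFmeasures \<Longrightarrow> norm (g m) \<le> B0" using bd unfolding bounded_iff by auto
  define B where "B = \<bar>B0\<bar>"
  have B: "\<bar>g m\<bar> \<le> B" if "m \<in> LFmeasures" for m using B0[OF that] unfolding B_def by simp
  \<comment> \<open>The identity clamped to [-B, B]: a bounded continuous test function on the whole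
    line that agrees with the identity on all values of \<open>g\<close> on
    \<open>LFmeasures\<close>.\<close>
  define f where "f t = max (- B) (min B t)" for t :: real
  have fid: "f t = t" if "\<bar>t\<bar> \<le> B" for t unfolding f_def using that by auto
  have "(\<lambda>n. integral\<^sup>L (?m n) f) \<longlonglongrightarrow> integral\<^sup>L ?m' f"
  proof (rule weak_conv_imp_integral_bdd_continuous_conv[OF rd \<open>weak_conv_m ?m ?m'\<close>])
    show "isCont f x" for x unfolding f_def by (intro continuous_intros)
    show "norm (f x) \<le> B" for x unfolding f_def B_def by auto
  qed
  moreover have [measurable]: "f \<in> borel_measurable borel" unfolding f_def by measurable
  have "integral\<^sup>L (?m n) f = integral\<^sup>L M (\<lambda>\<omega>. g (X n \<omega>))" for n
  proof -
    have "integral\<^sup>L (?m n) f = (\<integral>\<omega>. f (g (X n \<omega>)) \<partial>M)" by (intro integral_distr) auto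
    also have "\<dots> = integral\<^sup>L M (\<lambda>\<omega>. g (X n \<omega>))"
      using B[OF X] by (intro Bochner_Integration.integral_cong) (auto simp: fid)
    finally show ?thesis .
  qed
  moreover have "integral\<^sup>L ?m' f = integral\<^sup>L N (\<lambda>\<omega>. g (Y \<omega>))"
  proof -
    have "integral\<^sup>L ?m' f = (\<integral>\<omega>. f (g (Y \<omega>)) \<partial>N)" by (intro integral_distr) auto
    also have "\<dots> = integral\<^sup>L N (\<lambda>\<omega>. g (Y \<omega>))"
      using B[OF Y] by (intro Bochner_Integration.integral_cong) (auto simp: fid)
    finally show ?thesis .
  qed
  ultimately show "(\<lambda>n. integral\<^sup>L M (\<lambda>\<omega>. g (X n \<omega>))) \<longlonglongrightarrow> integral\<^sup>L N (\<lambda>\<omega>. g (Y \<omega>))" by simp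
qed

section \<open>The lower tail of a single discrepancy\<close>

lemma nn_integral_powr_Ioo:
  fixes \<kappa> t :: real
  assumes "\<kappa> > -1" "t > 0"
  shows "(\<integral>\<^sup>+v. ennreal (v powr \<kappa>) * indicator {0<..<t} v \<partial>lborel) = ennreal (t powr (\<kappa> + 1) / (\<kappa> + 1))"
  using nn_integral_has_integral_lebesgue'[of "{0<..<t}" "\<lambda>v. v powr \<kappa>"]
    has_integral_powr_from_0[OF assms(1), of t] assms(2) by (simp add: has_integral_Icc_iff_Ioo)

text \<open>Integrating over v leaves u^\<kappa> (e - u)^(\<kappa> + 1) / (\<kappa> + 1). The
  substitution u = e x extracts e^(2 \<kappa> + 2) and leaves Beta(\<kappa> + 1, \<kappa> + 2),
  which is half of Beta(\<kappa> + 1, \<kappa> + 1).\<close>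

lemma nn_integral_powr_simplex:
  fixes \<kappa> e :: real
  assumes \<kappa>: "\<kappa> > -1" and e: "e > 0"
  shows "(\<integral>\<^sup>+u. \<integral>\<^sup>+v. ennreal (u powr \<kappa> * v powr \<kappa>) * indicator {(u, v). 0 < u \<and> 0 < v \<and> u + v < e}
    (u, v) \<partial>lborel \<partial>lborel)
    = ennreal (e powr (2 * \<kappa> + 2) * (Beta (\<kappa> + 1) (\<kappa> + 1) / (2 * \<kappa> + 2)))"
proof -
  have "(\<integral>\<^sup>+v. ennreal (u powr \<kappa> * v powr \<kappa>) * indicator {(u, v). 0 < u \<and> 0 < v \<and> u + v < e} (u, v)
    \<partial>lborel)
      = ennreal (u powr \<kappa> * (e - u) powr (\<kappa> + 1) / (\<kappa> + 1)) * indicator {0<..<e} u" for u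
  proof (cases "u \<in> {0<..<e}")
    case True
    have "(\<integral>\<^sup>+v. ennreal (u powr \<kappa> * v powr \<kappa>) * indicator {(u, v). 0 < u \<and> 0 < v \<and> u + v < e} (u,
      v) \<partial>lborel)
      = (\<integral>\<^sup>+v. ennreal (u powr \<kappa>) * (ennreal (v powr \<kappa>) * indicator {0<..<e - u} v) \<partial>lborel)"
      using True by (intro nn_integral_cong) (auto simp: indicator_def ennreal_mult)
    also have "\<dots> = ennreal (u powr \<kappa>) * ennreal ((e - u) powr (\<kappa> + 1) / (\<kappa> + 1))"
      using True \<kappa> by (subst nn_integral_cmult) (auto simp: nn_integral_powr_Ioo)
    finally show ?thesis using True \<kappa> by (simp flip: ennreal_mult')
  next
    case False
    then show ?thesis by (auto simp: indicator_def intro!: nn_integral_zero')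
  qed
  then have "(\<integral>\<^sup>+u. \<integral>\<^sup>+v. ennreal (u powr \<kappa> * v powr \<kappa>) * indicator {(u, v). 0 < u \<and> 0 < v \<and> u + v <
    e} (u, v) \<partial>lborel \<partial>lborel)
    = (\<integral>\<^sup>+u. ennreal (u powr \<kappa> * (e - u) powr (\<kappa> + 1) / (\<kappa> + 1)) * indicator {0<..<e} u \<partial>lborel)" by simp
  also have "\<dots> = \<bar>e\<bar> * (\<integral>\<^sup>+x. ennreal ((0 + e * x) powr \<kappa> * (e - (0 + e * x)) powr (\<kappa> + 1) / (\<kappa> +
    1)) * indicator {0<..<e} (0 + e * x) \<partial>lborel)"
    using e by (intro nn_integral_real_affine) auto
  also have "\<dots> = \<bar>e\<bar> * (\<integral>\<^sup>+x. ennreal (e powr (2 * \<kappa> + 1) / (\<kappa> + 1)) *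
      (ennreal (x powr (\<kappa> + 1 - 1) * (1 - x) powr (\<kappa> + 1 + 1 - 1)) * indicator {0<..<1} x) \<partial>lborel)"
  proof (intro arg_cong[where f = "(*) (ennreal \<bar>e\<bar>)"] nn_integral_cong)
    fix x :: real
    show "ennreal ((0 + e * x) powr \<kappa> * (e - (0 + e * x)) powr (\<kappa> + 1) / (\<kappa> + 1)) * indicator
      {0<..<e} (0 + e * x) =
      ennreal (e powr (2 * \<kappa> + 1) / (\<kappa> + 1)) * (ennreal (x powr (\<kappa> + 1 - 1) * (1 - x) powr (\<kappa> + 1 +
        1 - 1)) * indicator {0<..<1} x)"
    proof (cases "x \<in> {0<..<1}")
      case True
      have "(e - (0 + e * x)) = e * (1 - x)" by (simp add: algebra_simps)
      then have "(0 + e * x) powr \<kappa> * (e - (0 + e * x)) powr (\<kappa> + 1) / (\<kappa> + 1)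
        = (e powr \<kappa> * e powr (\<kappa> + 1)) / (\<kappa> + 1) * (x powr (\<kappa> + 1 - 1) * (1 - x) powr (\<kappa> + 1 + 1 - 1))"
        using True e by (simp add: powr_mult add.commute[of \<kappa> 1])
      also have "e powr \<kappa> * e powr (\<kappa> + 1) = e powr (2 * \<kappa> + 1)" by (simp flip: powr_add)
      finally show ?thesis using True e \<kappa> by (simp add: ennreal_mult[symmetric])
    next
      case False
      then have "0 + e * x \<notin> {0<..<e}" using e by (auto simp: zero_less_mult_iff)
      then show ?thesis using False by simp
    qed
  qed
  also have "\<dots> = \<bar>e\<bar> * (ennreal (e powr (2 * \<kappa> + 1) / (\<kappa> + 1)) * ennreal (Beta (\<kappa> + 1) (\<kappa> + 1 + 1)))"
  proof -
    have "((\<lambda>t. t powr (\<kappa> + 1 - 1) * (1 - t) powr (\<kappa> + 1 + 1 - 1)) has_integral Beta (\<kappa> + 1) (\<kappa> + 1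
      + 1)) {0<..<1}"
      using has_integral_Beta_real[of "\<kappa> + 1" "\<kappa> + 1 + 1"] \<kappa> by (simp add: has_integral_Icc_iff_Ioo)
    then have "(\<integral>\<^sup>+x. ennreal (x powr (\<kappa> + 1 - 1) * (1 - x) powr (\<kappa> + 1 + 1 - 1)) * indicator
      {0<..<1} x \<partial>lborel) = ennreal (Beta (\<kappa> + 1) (\<kappa> + 1 + 1))"
      by (intro nn_integral_has_integral_lebesgue') auto
    then show ?thesis by (subst nn_integral_cmult) auto
  qed
  also have "\<dots> = ennreal (e * (e powr (2 * \<kappa> + 1) / (\<kappa> + 1) * Beta (\<kappa> + 1) (\<kappa> + 1 + 1)))"
    using e \<kappa> by (simp add: ennreal_mult'[symmetric])
  also have "e * (e powr (2 * \<kappa> + 1) / (\<kappa> + 1) * Beta (\<kappa> + 1) (\<kappa> + 1 + 1)) = e powr (2 * \<kappa> + 2) *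
    (Beta (\<kappa> + 1) (\<kappa> + 1) / (2 * \<kappa> + 2))"
  proof -
    have "\<kappa> + 1 \<notin> \<int>\<^sub>\<le>\<^sub>0" using \<kappa> by (auto elim!: nonpos_Ints_cases)
    from Beta_plus1_right[OF this, of "\<kappa> + 1"]
    have "Beta (\<kappa> + 1) (\<kappa> + 1 + 1) / (\<kappa> + 1) = Beta (\<kappa> + 1) (\<kappa> + 1) / (2 * \<kappa> + 2)"
      using \<kappa> by (simp add: field_simps)
    moreover have "e * e powr (2 * \<kappa> + 1) = e powr (2 * \<kappa> + 2)"
      using e powr_add[of e 1 "2 * \<kappa> + 1"] by (simp add: algebra_simps)
    moreover have "e * (e powr (2 * \<kappa> + 1) / (\<kappa> + 1) * Beta (\<kappa> + 1) (\<kappa> + 1 + 1)) =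
      (e * e powr (2 * \<kappa> + 1)) * (Beta (\<kappa> + 1) (\<kappa> + 1 + 1) / (\<kappa> + 1))" by simp
    ultimately show ?thesis by simp
  qed
  finally show ?thesis .
qed

lemma Beta_pos_real: "a > 0 \<Longrightarrow> b > 0 \<Longrightarrow> Beta a b > (0::real)"
  unfolding Beta_def by (intro divide_pos_pos mult_pos_pos Gamma_real_pos) auto

section \<open>Two values of the disorder near opposite edges\<close>

locale edge_disorder = prob_space M for M :: "'a measure" +
  fixes F :: "int \<Rightarrow> 'a \<Rightarrow> real" and \<rho> :: "real \<Rightarrow> real" and c q \<kappa> :: real
  assumes c_pos: "c > 0" and q_pos: "q > 0" and kappa: "\<kappa> > -1"
    and rho_even: "\<And>t. \<rho> (- t) = \<rho> t"
    and rho_pos: "\<And>t. t \<in> {-c<..<c} \<Longrightarrow> \<rho> t > 0"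
    and rho_zero: "\<And>t. t \<notin> {-c<..<c} \<Longrightarrow> \<rho> t = 0"
    and rho_edge: "((\<lambda>t. \<rho> t / \<bar>c - t\<bar> powr \<kappa>) \<longlongrightarrow> q) (at_left c)"
    and F_indep: "indep_vars (\<lambda>_. borel) F UNIV"
    and F_distr: "\<And>x. distributed M lborel (F x) (\<lambda>t. ennreal (\<rho> t))"
begin

lemma rho_nonneg: "\<rho> t \<ge> 0"
  using rho_pos[of t] rho_zero[of t] by (cases "t \<in> {-c<..<c}") auto

lemma rho_measurable [measurable]: "\<rho> \<in> borel_measurable borel"
  using distributed_real_measurable[OF rho_nonneg F_distr] by simp

lemma F_measurable [measurable]: "F x \<in> borel_measurable M"
  using distributed_measurable[OF F_distr[of x]] by simp

lemma F_indep_pair: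
  assumes "x \<noteq> y"
  shows "indep_var lborel (F x) lborel (F y)"
proof -
  have "indep_var (PiM {x} (\<lambda>_. borel)) (\<lambda>\<omega>. restrict (\<lambda>i. F i \<omega>) {x}) (PiM {y} (\<lambda>_. borel)) (\<lambda>\<omega>.
    restrict (\<lambda>i. F i \<omega>) {y})"
    using assms by (intro indep_var_restrict[OF F_indep]) auto
  from indep_var_compose[OF this, of "\<lambda>f. f x" lborel "\<lambda>f. f y" lborel]
  show ?thesis by (simp add: comp_def measurable_component_singleton)
qed

text \<open>The substitution s = -c + u, t = c - v uses the distances to the two opposite edges: the
  condition t - s > 2c - e becomes u + v < e, and evenness turns the density at -c + u into the one
  at c - u. The right-hand side is free of the sites, which later gives stationarity.\<close>

lemma emeasure_diff_gt:
  assumes "x \<noteq> y"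
  shows "emeasure M {\<omega> \<in> space M. F y \<omega> - F x \<omega> > 2 * c - e} =
    (\<integral>\<^sup>+u. \<integral>\<^sup>+v. ennreal (\<rho> (c - u) * \<rho> (c - v)) * indicator {(u, v). u + v < e} (u, v) \<partial>lborel \<partial>lborel)"
proof -
  let ?A = "{z :: real \<times> real. snd z - fst z > 2 * c - e}"
  have A: "?A \<in> sets (lborel \<Otimes>\<^sub>M lborel)"
  proof -
    have "{z \<in> space (borel \<Otimes>\<^sub>M borel). snd z - fst z > 2 * c - e} \<in> sets (borel \<Otimes>\<^sub>M (borel :: real
      measure))" by measurable
    then show ?thesis by (simp add: borel_prod lborel_prod)
  qed
  have D: "distributed M (lborel \<Otimes>\<^sub>M lborel) (\<lambda>\<omega>. (F x \<omega>, F y \<omega>)) (\<lambda>(s, t). ennreal (\<rho> s) * ennreal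
    (\<rho> t))"
    by (intro distributed_joint_indep F_distr F_indep_pair[OF assms] lborel.sigma_finite_measure_axioms)
  have "emeasure M {\<omega> \<in> space M. F y \<omega> - F x \<omega> > 2 * c - e} = emeasure M ((\<lambda>\<omega>. (F x \<omega>, F y \<omega>)) -` ?A
    \<inter> space M)"
    by (intro arg_cong[where f = "emeasure M"]) auto
  also have "\<dots> = (\<integral>\<^sup>+z. (case z of (s, t) \<Rightarrow> ennreal (\<rho> s) * ennreal (\<rho> t)) * indicator ?A z \<partial>(lborel
    \<Otimes>\<^sub>M lborel))"
    by (rule distributed_emeasure[OF D A])
  also have "\<dots> = (\<integral>\<^sup>+s. \<integral>\<^sup>+t. ennreal (\<rho> s) * ennreal (\<rho> t) * indicator ?A (s, t) \<partial>lborel \<partial>lborel)"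
    using A by (subst lborel.nn_integral_fst[symmetric]) auto
  also have "\<dots> = (\<integral>\<^sup>+u. \<integral>\<^sup>+t. ennreal (\<rho> (- c + 1 * u)) * ennreal (\<rho> t) * indicator ?A (- c + 1 * u,
    t) \<partial>lborel \<partial>lborel)"
  proof -
    have "(\<lambda>s. \<integral>\<^sup>+t. ennreal (\<rho> s) * ennreal (\<rho> t) * indicator ?A (s, t) \<partial>lborel) \<in> borel_measurable
      borel"
      by measurable
    from nn_integral_real_affine[OF this, of 1 "-c"] show ?thesis by simp
  qed
  also have "\<dots> = (\<integral>\<^sup>+u. \<integral>\<^sup>+v. ennreal (\<rho> (c - u) * \<rho> (c - v)) * indicator {(u, v). u + v < e} (u, v)
    \<partial>lborel \<partial>lborel)"
  proof (rule nn_integral_cong)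
    fix u :: real
    have "(\<lambda>t. ennreal (\<rho> (- c + 1 * u)) * ennreal (\<rho> t) * indicator ?A (- c + 1 * u, t)) \<in>
      borel_measurable borel"
      by measurable
    from nn_integral_real_affine[OF this, of "-1" c]
    have "(\<integral>\<^sup>+t. ennreal (\<rho> (- c + 1 * u)) * ennreal (\<rho> t) * indicator ?A (- c + 1 * u, t) \<partial>lborel)
      = (\<integral>\<^sup>+v. ennreal (\<rho> (- (c - u))) * ennreal (\<rho> (c - v)) * indicator ?A (- c + u, c - v) \<partial>lborel)"
      by simp
    also have "\<dots> = (\<integral>\<^sup>+v. ennreal (\<rho> (c - u) * \<rho> (c - v)) * indicator {(u, v). u + v < e} (u, v)
      \<partial>lborel)"
      unfolding rho_even by (intro nn_integral_cong) (auto simp: indicator_def ennreal_mult rho_nonneg)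
    finally show "(\<integral>\<^sup>+t. ennreal (\<rho> (- c + 1 * u)) * ennreal (\<rho> t) * indicator ?A (- c + 1 * u, t)
      \<partial>lborel)
      = (\<integral>\<^sup>+v. ennreal (\<rho> (c - u) * \<rho> (c - v)) * indicator {(u, v). u + v < e} (u, v) \<partial>lborel)" .
  qed
  finally show ?thesis .
qed

lemma rho_edge_bounds:
  assumes "\<delta> > 0"
  shows "\<exists>\<eta>>0. \<forall>u\<in>{0<..<\<eta>}. (q - \<delta>) * u powr \<kappa> \<le> \<rho> (c - u) \<and> \<rho> (c - u) \<le> (q + \<delta>) * u powr \<kappa>"
proof -
  have "\<forall>\<^sub>F t in at_left c. dist (\<rho> t / \<bar>c - t\<bar> powr \<kappa>) q < \<delta>"
    using rho_edge assms by (rule tendstoD)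
  then obtain b where b: "b < c" "\<And>t. b < t \<Longrightarrow> t < c \<Longrightarrow> dist (\<rho> t / \<bar>c - t\<bar> powr \<kappa>) q < \<delta>"
    unfolding eventually_at_left_field by auto
  have "(q - \<delta>) * u powr \<kappa> \<le> \<rho> (c - u) \<and> \<rho> (c - u) \<le> (q + \<delta>) * u powr \<kappa>" if "u \<in> {0<..<c - b}" for u
  proof -
    have "\<bar>\<rho> (c - u) / u powr \<kappa> - q\<bar> < \<delta>" using b(2)[of "c - u"] that by (simp add: dist_real_def)
    then have "q - \<delta> \<le> \<rho> (c - u) / u powr \<kappa>" "\<rho> (c - u) / u powr \<kappa> \<le> q + \<delta>" by linarith+
    then show ?thesis using that by (simp add: field_simps)
  qed
  then show ?thesis using b(1) by (intro exI[of _ "c - b"]) auto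
qed

text \<open>For e > 0 this is the value of the integral in
  \<open>nn_integral_powr_simplex\<close>.\<close>

definition simplex_mass :: "real \<Rightarrow> real" where
  "simplex_mass e = e powr (2 * \<kappa> + 2) * (Beta (\<kappa> + 1) (\<kappa> + 1) / (2 * \<kappa> + 2))"

text \<open>On the simplex u + v < e both distances are below \<eta>, where the density is squeezed
  between multiples of u^\<kappa>. The condition \<delta> < q keeps the lower factors nonnegative,
  so that the bounds can be multiplied.\<close>

lemma prob_diff_gt_bounds:
  assumes \<delta>: "0 < \<delta>" "\<delta> < q"
  shows "\<exists>\<eta>>0. \<forall>e\<in>{0<..<\<eta>}. \<forall>x y. x \<noteq> y \<longrightarrow>
    prob {\<omega> \<in> space M. F y \<omega> - F x \<omega> > 2 * c - e} \<in> {(q - \<delta>)\<^sup>2 * simplex_mass e .. (q + \<delta>)\<^sup>2 *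
      simplex_mass e}"
proof -
  obtain \<eta> where \<eta>: "\<eta> > 0" and bd: "\<And>u. u \<in> {0<..<\<eta>} \<Longrightarrow> (q - \<delta>) * u powr \<kappa> \<le> \<rho> (c - u)"
    "\<And>u. u \<in> {0<..<\<eta>} \<Longrightarrow> \<rho> (c - u) \<le> (q + \<delta>) * u powr \<kappa>"
    using rho_edge_bounds[OF \<delta>(1)] by blast
  have "prob {\<omega> \<in> space M. F y \<omega> - F x \<omega> > 2 * c - e} \<in> {(q - \<delta>)\<^sup>2 * simplex_mass e .. (q + \<delta>)\<^sup>2 *
    simplex_mass e}"
    if e: "e \<in> {0<..<\<eta>}" and xy: "x \<noteq> y" for e x y
  proof -
    let ?S = "{(u, v). 0 < u \<and> 0 < v \<and> u + v < e} :: (real \<times> real) set"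
    let ?J = "\<integral>\<^sup>+u. \<integral>\<^sup>+v. ennreal (\<rho> (c - u) * \<rho> (c - v)) * indicator {(u, v). u + v < e} (u, v)
      \<partial>lborel \<partial>lborel"
    let ?f = "\<lambda>u v. ennreal (u powr \<kappa> * v powr \<kappa>) * indicator ?S (u, v)"
    have I0: "simplex_mass e \<ge> 0" unfolding simplex_mass_def using kappa Beta_pos_real[of "\<kappa>+1"
      "\<kappa>+1"] by simp
    have S: "?S \<in> sets (borel \<Otimes>\<^sub>M borel)"
    proof -
      have "{z \<in> space (borel \<Otimes>\<^sub>M borel). 0 < fst z \<and> 0 < snd z \<and> fst z + snd z < e} \<in> sets (borel
        \<Otimes>\<^sub>M (borel :: real measure))"
        by measurable
      moreover have "{z \<in> space (borel \<Otimes>\<^sub>M borel). 0 < fst z \<and> 0 < snd z \<and> fst z + snd z < e} = ?S"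
        by (auto simp: space_pair_measure)
      ultimately show ?thesis by simp
    qed
    have fm: "(\<lambda>z. ennreal (fst z powr \<kappa> * snd z powr \<kappa>) * indicator ?S z) \<in> borel_measurable
      (lborel \<Otimes>\<^sub>M lborel)"
    proof (rule borel_measurable_times_ennreal)
      show "(\<lambda>z. ennreal (fst z powr \<kappa> * snd z powr \<kappa>)) \<in> borel_measurable (lborel \<Otimes>\<^sub>M lborel)" by
        measurable
      show "indicator ?S \<in> borel_measurable (lborel \<Otimes>\<^sub>M lborel)"
        using S by (intro borel_measurable_indicator) (simp add: borel_prod lborel_prod)
    qed
    have fm1: "?f u \<in> borel_measurable lborel" for u
      using measurable_Pair2[OF fm, of u] by (simp only: fst_conv snd_conv space_lborel space_borel
        UNIV_I)
    have fm2: "(\<lambda>u. \<integral>\<^sup>+v. ?f u v \<partial>lborel) \<in> borel_measurable lborel"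
      using lborel.borel_measurable_nn_integral_fst[OF fm] by (simp only: fst_conv snd_conv)
    have scale: "(\<integral>\<^sup>+u. \<integral>\<^sup>+v. ennreal (a\<^sup>2) * ?f u v \<partial>lborel \<partial>lborel) = ennreal (a\<^sup>2 * simplex_mass
      e)" for a
    proof -
      have "(\<integral>\<^sup>+u. \<integral>\<^sup>+v. ennreal (a\<^sup>2) * ?f u v \<partial>lborel \<partial>lborel) = (\<integral>\<^sup>+u. ennreal (a\<^sup>2) * (\<integral>\<^sup>+v. ?f
        u v \<partial>lborel) \<partial>lborel)"
        by (intro nn_integral_cong nn_integral_cmult fm1)
      also have "\<dots> = ennreal (a\<^sup>2) * (\<integral>\<^sup>+u. \<integral>\<^sup>+v. ?f u v \<partial>lborel \<partial>lborel)"
        by (intro nn_integral_cmult fm2)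
      also have "\<dots> = ennreal (a\<^sup>2) * ennreal (simplex_mass e)"
        using e kappa by (subst nn_integral_powr_simplex) (auto simp: simplex_mass_def)
      finally show ?thesis using I0 by (simp add: ennreal_mult)
    qed
    have P: "ennreal (prob {\<omega> \<in> space M. F y \<omega> - F x \<omega> > 2 * c - e}) = ?J"
      using emeasure_diff_gt[OF xy, of e] by (simp add: emeasure_eq_measure)
    have "ennreal ((q - \<delta>)\<^sup>2 * simplex_mass e) \<le> ?J"
      unfolding scale[of "q - \<delta>", symmetric]
    proof (intro nn_integral_mono)
      fix u v :: real
      show "ennreal ((q - \<delta>)\<^sup>2) * ?f u v \<le> ennreal (\<rho> (c - u) * \<rho> (c - v)) * indicator {(u, v). u +
        v < e} (u, v)"
      proof (cases "(u, v) \<in> ?S")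
        case True
        then have "((q - \<delta>) * u powr \<kappa>) * ((q - \<delta>) * v powr \<kappa>) \<le> \<rho> (c - u) * \<rho> (c - v)"
          using e \<delta> by (intro mult_mono[OF bd(1) bd(1)] rho_nonneg) auto
        then show ?thesis using True by (simp add: ennreal_mult[symmetric] power2_eq_square mult_ac
          ennreal_leI)
      qed simp
    qed
    then have 1: "(q - \<delta>)\<^sup>2 * simplex_mass e \<le> prob {\<omega> \<in> space M. F y \<omega> - F x \<omega> > 2 * c - e}"
      unfolding P[symmetric] by simp
    have "?J \<le> ennreal ((q + \<delta>)\<^sup>2 * simplex_mass e)"
      unfolding scale[of "q + \<delta>", symmetric]
    proof (intro nn_integral_mono)
      fix u v :: real
      show "ennreal (\<rho> (c - u) * \<rho> (c - v)) * indicator {(u, v). u + v < e} (u, v) \<le> ennreal ((q +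
        \<delta>)\<^sup>2) * ?f u v"
      proof (cases "(u, v) \<in> ?S")
        case True
        then have "\<rho> (c - u) * \<rho> (c - v) \<le> ((q + \<delta>) * u powr \<kappa>) * ((q + \<delta>) * v powr \<kappa>)"
          using e \<delta> q_pos by (intro mult_mono[OF bd(2) bd(2)] rho_nonneg) auto
        then show ?thesis using True by (simp add: ennreal_mult[symmetric] power2_eq_square mult_ac
          ennreal_leI)
      next
        case False
        \<comment> \<open>Outside the simplex but with u + v < e, one distance is not positive; the
          corresponding value is at or beyond the edge c and has density 0.\<close>
        then have "\<not> (u + v < e) \<or> \<rho> (c - u) = 0 \<or> \<rho> (c - v) = 0"
          using rho_zero[of "c - u"] rho_zero[of "c - v"] by auto
        then show ?thesis by auto
      qed
    qed
    then have 2: "prob {\<omega> \<in> space M. F y \<omega> - F x \<omega> > 2 * c - e} \<le> (q + \<delta>)\<^sup>2 * simplex_mass e"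
      unfolding P[symmetric] using I0 by (simp add: ennreal_le_iff)
    show ?thesis using 1 2 by simp
  qed
  then show ?thesis using \<eta> by blast
qed

lemma discrepancy_measurable [measurable]: "(\<lambda>\<omega>. discrepancy c F \<omega> x) \<in> borel_measurable M"
  unfolding discrepancy_def by measurable

text \<open>For e at most 2c the threshold 2c - e is nonnegative, so the difference cannot exceed it
  with both signs. The two disjoint cases produce the factor 2 of the intensity.\<close>

lemma prob_discrepancy_less:
  assumes "e \<le> 2 * c"
  shows "prob {\<omega> \<in> space M. discrepancy c F \<omega> x < e} =
    prob {\<omega> \<in> space M. F (x + 1) \<omega> - F x \<omega> > 2 * c - e} + prob {\<omega> \<in> space M. F x \<omega> - F (x + 1) \<omega> > 2
      * c - e}"
proof -
  have "{\<omega> \<in> space M. discrepancy c F \<omega> x < e} =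
    {\<omega> \<in> space M. F (x + 1) \<omega> - F x \<omega> > 2 * c - e} \<union> {\<omega> \<in> space M. F x \<omega> - F (x + 1) \<omega> > 2 * c - e}"
    by (auto simp: discrepancy_def)
  then show ?thesis using assms by (simp, intro finite_measure_Union) auto
qed

text \<open>The constant combines q^2 from the densities at the two edges, 2 from the two signs and
  the simplex integral. The squeeze holds for each fixed \<delta> near 0, and \<delta> is chosen
  after the level \<open>a\<close> to be beaten.\<close>

lemma prob_discrepancy_asymp:
  "((\<lambda>e. prob {\<omega> \<in> space M. discrepancy c F \<omega> x < e} / e powr (2 * \<kappa> + 2))
    \<longlongrightarrow> q\<^sup>2 * (2 * Beta (\<kappa> + 1) (\<kappa> + 1)) / (2 * \<kappa> + 2)) (at_right 0)"
proof -
  define C where "C = 2 * Beta (\<kappa> + 1) (\<kappa> + 1) / (2 * \<kappa> + 2)"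
  define f where "f e = prob {\<omega> \<in> space M. discrepancy c F \<omega> x < e} / e powr (2 * \<kappa> + 2)" for e
  have bnd: "\<forall>\<^sub>F e in at_right 0. (q - \<delta>)\<^sup>2 * C \<le> f e \<and> f e \<le> (q + \<delta>)\<^sup>2 * C" if \<delta>: "0 < \<delta>" "\<delta> < q" for \<delta>
  proof -
    obtain \<eta> where \<eta>: "\<eta> > 0" and b: "\<forall>e\<in>{0<..<\<eta>}. \<forall>x y. x \<noteq> y \<longrightarrow>
      prob {\<omega> \<in> space M. F y \<omega> - F x \<omega> > 2 * c - e} \<in> {(q - \<delta>)\<^sup>2 * simplex_mass e .. (q + \<delta>)\<^sup>2 *
        simplex_mass e}"
      using prob_diff_gt_bounds[OF \<delta>] by auto
    have "\<forall>\<^sub>F e in at_right 0. e \<in> {0<..<min \<eta> (2 * c)}"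
      using \<eta> c_pos by (intro eventually_at_right_real) auto
    then show ?thesis
    proof eventually_elim
      case (elim e)
      then have e: "e \<in> {0<..<\<eta>}" "e \<le> 2 * c" "e powr (2 * \<kappa> + 2) > 0" by auto
      have "prob {\<omega> \<in> space M. F y \<omega> - F x \<omega> > 2 * c - e} \<in> {(q - \<delta>)\<^sup>2 * simplex_mass e .. (q + \<delta>)\<^sup>2
        * simplex_mass e}"
        if "x \<noteq> y" for x y using b e(1) that by blast
      from this[of x "x + 1"] this[of "x + 1" x]
      have "(q - \<delta>)\<^sup>2 * (2 * simplex_mass e) \<le> prob {\<omega> \<in> space M. discrepancy c F \<omega> x < e}"
        "prob {\<omega> \<in> space M. discrepancy c F \<omega> x < e} \<le> (q + \<delta>)\<^sup>2 * (2 * simplex_mass e)"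
        unfolding prob_discrepancy_less[OF e(2)] by simp_all
      moreover have "2 * simplex_mass e = C * e powr (2 * \<kappa> + 2)" unfolding simplex_mass_def C_def
        by simp
      ultimately show ?case unfolding f_def using e(3) by (simp add: field_simps)
    qed
  qed
  have "(f \<longlongrightarrow> q\<^sup>2 * C) (at_right 0)"
  proof (rule order_tendstoI)
    fix a assume a: "a < q\<^sup>2 * C"
    have "((\<lambda>\<delta>. (q - \<delta>)\<^sup>2 * C) \<longlongrightarrow> (q - 0)\<^sup>2 * C) (at_right 0)" by (intro tendsto_intros)
    then have "\<forall>\<^sub>F \<delta> in at_right 0. (q - \<delta>)\<^sup>2 * C > a" using a by (intro order_tendstoD(1)) auto
    moreover have "\<forall>\<^sub>F \<delta> in at_right 0. \<delta> \<in> {0<..<q}" by (rule eventually_at_right_real[OF q_pos])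
    ultimately have "\<forall>\<^sub>F \<delta> in at_right 0. (q - \<delta>)\<^sup>2 * C > a \<and> \<delta> \<in> {0<..<q}" by eventually_elim auto
    then obtain \<delta> where \<delta>: "(q - \<delta>)\<^sup>2 * C > a" "0 < \<delta>" "\<delta> < q"
      using eventually_happens'[of "at_right (0::real)"] by auto
    show "\<forall>\<^sub>F e in at_right 0. a < f e" using bnd[OF \<delta>(2,3)] by eventually_elim (use \<delta>(1) in linarith)
  next
    fix a assume a: "q\<^sup>2 * C < a"
    have "((\<lambda>\<delta>. (q + \<delta>)\<^sup>2 * C) \<longlongrightarrow> (q + 0)\<^sup>2 * C) (at_right 0)" by (intro tendsto_intros)
    then have "\<forall>\<^sub>F \<delta> in at_right 0. (q + \<delta>)\<^sup>2 * C < a" using a by (intro order_tendstoD(2)) auto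
    moreover have "\<forall>\<^sub>F \<delta> in at_right 0. \<delta> \<in> {0<..<q}" by (rule eventually_at_right_real[OF q_pos])
    ultimately have "\<forall>\<^sub>F \<delta> in at_right 0. (q + \<delta>)\<^sup>2 * C < a \<and> \<delta> \<in> {0<..<q}" by eventually_elim auto
    then obtain \<delta> where \<delta>: "(q + \<delta>)\<^sup>2 * C < a" "0 < \<delta>" "\<delta> < q"
      using eventually_happens'[of "at_right (0::real)"] by auto
    show "\<forall>\<^sub>F e in at_right 0. f e < a" using bnd[OF \<delta>(2,3)] by eventually_elim (use \<delta>(1) in linarith)
  qed
  then show ?thesis unfolding f_def C_def by simp
qed

end

section \<open>Void probabilities of one-dependent events\<close>

text \<open>From 1 - p <= exp(-p) <= 1 / (1 + p) <= 1 - p + p^2, the last step being (1 - p + p^2)(1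
  + p) = 1 + p^3.\<close>

lemma exp_minus_approx:
  fixes p :: real
  assumes "0 \<le> p"
  shows "\<bar>(1 - p) - exp (- p)\<bar> \<le> p\<^sup>2"
proof -
  have 1: "1 - p \<le> exp (- p)" using exp_ge_add_one_self[of "-p"] by simp
  have "exp (- p) * (1 + p) \<le> exp (- p) * exp p" by (intro mult_left_mono) auto
  also have "\<dots> = 1" by (simp flip: exp_add)
  finally have "exp (- p) * (1 + p) \<le> 1" .
  also have "1 \<le> (1 - p + p\<^sup>2) * (1 + p)"
  proof -
    have "(1 - p + p\<^sup>2) * (1 + p) = 1 + p ^ 3" by (simp add: algebra_simps power2_eq_square
      power3_eq_cube)
    then show ?thesis using assms by simp
  qed
  finally have "exp (- p) \<le> 1 - p + p\<^sup>2" using assms by simp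
  with 1 show ?thesis by simp
qed

text \<open>For events with dependence range one, peeling off the last event costs only the probability
  that two
  neighbouring events occur together, so the void probability is almost a product.\<close>

lemma (in prob_space) void_prob_exp_bound:
  fixes E :: "nat \<Rightarrow> 'a set"
  defines "V \<equiv> \<lambda>k. {\<omega> \<in> space M. \<forall>i<k. \<omega> \<notin> E i}"
  assumes E: "\<And>i. E i \<in> events"
    and indep: "\<And>k. prob (V k \<inter> E (Suc k)) = prob (V k) * prob (E (Suc k))"
    and s: "\<And>i. prob (E i \<inter> E (Suc i)) \<le> s" and p: "\<And>i. prob (E i) \<le> p"
  shows "\<bar>prob (V m) - exp (- (\<Sum>i<m. prob (E i)))\<bar> \<le> real m * (s + 2 * p\<^sup>2)"
proof -
  have V: "V k \<in> events" for k
  proof -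
    have "V k = space M - (\<Union>i<k. E i)" unfolding V_def by auto
    then show ?thesis using E by auto
  qed
  have s0: "s \<ge> 0" using s[of 0] measure_nonneg[of M "E 0 \<inter> E (Suc 0)"] by linarith
  have p0: "p \<ge> 0" using p[of 0] measure_nonneg[of M "E 0"] by linarith
  have VSuc: "V (Suc k) = V k - E k" for k unfolding V_def by (auto simp: less_Suc_eq)
  have PSuc: "prob (V (Suc k)) = prob (V k) - prob (V k \<inter> E k)" for k
  proof -
    have "V (Suc k) = V k - (V k \<inter> E k)" using VSuc by auto
    then show ?thesis using V E by (simp add: finite_measure_Diff)
  qed
  have step: "\<bar>prob (V k \<inter> E k) - prob (V k) * prob (E k)\<bar> \<le> s + p\<^sup>2" for k
  proof (cases k)
    case 0
    have "V 0 = space M" unfolding V_def by simp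
    then show ?thesis using 0 s0 sets.sets_into_space[OF E] by (simp add: prob_space Int_absorb1)
  next
    case (Suc j)
    \<comment> \<open>\<open>E (Suc j)\<close> is compared with \<open>V j\<close>, which skips the
      neighbour \<open>E j\<close> and is independent of it. Putting the neighbour back costs one
      term bounded by \<open>s\<close> and one bounded by \<open>p\<close> squared.\<close>
    have "V (Suc j) \<inter> E (Suc j) = V j \<inter> E (Suc j) - V j \<inter> E j \<inter> E (Suc j)" using VSuc by auto
    then have "prob (V (Suc j) \<inter> E (Suc j)) = prob (V j \<inter> E (Suc j)) - prob (V j \<inter> E j \<inter> E (Suc j))"
      using V E by (simp add: finite_measure_Diff Int_assoc le_infI2)
    moreover have "prob (V (Suc j)) * prob (E (Suc j)) = prob (V j) * prob (E (Suc j)) - prob (V j \<inter>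
      E j) * prob (E (Suc j))"
      unfolding PSuc by (simp add: left_diff_distrib)
    ultimately have e: "prob (V (Suc j) \<inter> E (Suc j)) - prob (V (Suc j)) * prob (E (Suc j)) =
       prob (V j \<inter> E j) * prob (E (Suc j)) - prob (V j \<inter> E j \<inter> E (Suc j))" using indep[of j] by simp
    have "prob (V j \<inter> E j \<inter> E (Suc j)) \<le> s"
      using V E by (intro order_trans[OF finite_measure_mono s[of j]]) auto
    moreover have "prob (V j \<inter> E j) * prob (E (Suc j)) \<le> p\<^sup>2"
      unfolding power2_eq_square using V E p0
      by (intro mult_mono p order_trans[OF finite_measure_mono p[of j]]) auto
    moreover have "prob (V j \<inter> E j) * prob (E (Suc j)) \<ge> 0" "prob (V j \<inter> E j \<inter> E (Suc j)) \<ge> 0" by auto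
    ultimately show ?thesis unfolding Suc e using s0 zero_le_power2[of p] by linarith
  qed
  \<comment> \<open>Each step multiplies by \<open>1 - prob (E m)\<close>, a factor of modulus at
    most 1, so earlier errors are not amplified and the step errors add up.\<close>
  have prod: "\<bar>prob (V m) - (\<Prod>i<m. 1 - prob (E i))\<bar> \<le> real m * (s + p\<^sup>2)"
  proof (induction m)
    case 0
    show ?case unfolding V_def by (simp add: prob_space)
  next
    case (Suc m)
    have "prob (V (Suc m)) - (\<Prod>i<Suc m. 1 - prob (E i)) =
      (prob (V m) - (\<Prod>i<m. 1 - prob (E i))) * (1 - prob (E m)) - (prob (V m \<inter> E m) - prob (V m) *
        prob (E m))"
      unfolding PSuc by (simp add: algebra_simps)
    also have "\<bar>\<dots>\<bar> \<le> \<bar>(prob (V m) - (\<Prod>i<m. 1 - prob (E i))) * (1 - prob (E m))\<bar> + (s + p\<^sup>2)"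
      using step[of m] by linarith
    also have "\<bar>(prob (V m) - (\<Prod>i<m. 1 - prob (E i))) * (1 - prob (E m))\<bar> \<le> \<bar>prob (V m) - (\<Prod>i<m. 1 -
      prob (E i))\<bar> * 1"
      unfolding abs_mult by (intro mult_left_mono) (auto simp: abs_le_iff intro: order_trans[OF
        prob_le_1])
    finally show ?case using Suc.IH by (simp add: algebra_simps)
  qed
  \<comment> \<open>All factors of both products have modulus at most 1, so the products differ by
    at most the sum of the factorwise differences.\<close>
  have "\<bar>(\<Prod>i<m. 1 - prob (E i)) - (\<Prod>i<m. exp (- prob (E i)))\<bar> \<le> (\<Sum>i<m. \<bar>(1 - prob (E i)) - exp (-
    prob (E i))\<bar>)"
    using norm_prod_diff[of "{..<m}" "\<lambda>i. 1 - prob (E i)" "\<lambda>i. exp (- prob (E i))"] by simp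
  also have "\<dots> \<le> (\<Sum>i<m. p\<^sup>2)"
    by (intro sum_mono order_trans[OF exp_minus_approx] power_mono p) auto
  finally have "\<bar>(\<Prod>i<m. 1 - prob (E i)) - exp (- (\<Sum>i<m. prob (E i)))\<bar> \<le> real m * p\<^sup>2"
    by (simp add: exp_sum flip: sum_negf)
  then show ?thesis using prod by (simp add: algebra_simps)
qed

section \<open>Dependence between discrepancies\<close>

context edge_disorder
begin

lemma prob_restrict_indep:
  assumes "A \<inter> B = {}" "P \<in> sets (PiM A (\<lambda>_. borel))" "Q \<in> sets (PiM B (\<lambda>_. borel))"
  shows "prob ({\<omega> \<in> space M. restrict (\<lambda>i. F i \<omega>) A \<in> P} \<inter> {\<omega> \<in> space M. restrict (\<lambda>i. F i \<omega>) B \<in> Q})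
    = prob {\<omega> \<in> space M. restrict (\<lambda>i. F i \<omega>) A \<in> P} * prob {\<omega> \<in> space M. restrict (\<lambda>i. F i \<omega>) B \<in> Q}"
proof -
  let ?f = "\<lambda>\<omega>. restrict (\<lambda>i. F i \<omega>) A" and ?g = "\<lambda>\<omega>. restrict (\<lambda>i. F i \<omega>) B"
  have "{\<omega> \<in> space M. ?f \<omega> \<in> P} \<inter> {\<omega> \<in> space M. ?g \<omega> \<in> Q} = (\<lambda>\<omega>. (?f \<omega>, ?g \<omega>)) -` (P \<times> Q) \<inter> space M"
    "{\<omega> \<in> space M. ?f \<omega> \<in> P} = ?f -` P \<inter> space M" "{\<omega> \<in> space M. ?g \<omega> \<in> Q} = ?g -` Q \<inter> space M"
    by auto
  then show ?thesis
    using indep_varD[OF indep_var_restrict[OF F_indep assms(1) subset_UNIV subset_UNIV] assms(2,3)]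
    by simp
qed

lemma discrepancy_less_iff: "discrepancy c F \<omega> x < e \<longleftrightarrow> 2 * c - e < \<bar>F (x + 1) \<omega> - F x \<omega>\<bar>"
  by (auto simp: discrepancy_def)

text \<open>Both signed differences have probabilities given by a formula in which the sites do not
  occur (\<open>emeasure_diff_gt\<close>).\<close>

lemma prob_discrepancy_stationary:
  assumes "e \<le> 2 * c"
  shows "prob {\<omega> \<in> space M. discrepancy c F \<omega> x < e} = prob {\<omega> \<in> space M. discrepancy c F \<omega> 0 < e}"
proof -
  have "prob {\<omega> \<in> space M. F y \<omega> - F x \<omega> > 2 * c - e} = prob {\<omega> \<in> space M. F y' \<omega> - F x' \<omega> > 2 * c - e}"
    if "x \<noteq> y" "x' \<noteq> y'" for x y x' y'
    unfolding measure_def emeasure_diff_gt[OF that(1)] emeasure_diff_gt[OF that(2)] ..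
  from this[of x "x + 1" 0 1] this[of "x + 1" x 1 0] show ?thesis
    unfolding prob_discrepancy_less[OF assms] by simp
qed

lemma AE_abs_F_less: "AE \<omega> in M. \<bar>F x \<omega>\<bar> < c"
proof -
  have "\<bar>t\<bar> < c" if "\<rho> t > 0" for t using rho_zero[of t] that by (cases "t \<in> {-c<..<c}") auto
  then have "AE t in density lborel (\<lambda>t. ennreal (\<rho> t)). \<bar>t\<bar> < c"
    by (subst AE_density) auto
  then have "AE t in distr M lborel (F x). \<bar>t\<bar> < c"
    by (simp only: distributed_distr_eq_density[OF F_distr])
  then show ?thesis by (subst (asm) AE_distr_iff) auto
qed

text \<open>The events decrease to a null event as e decreases to 0. Monotonicity in e covers all
  smaller e, and equality of the laws makes the bound uniform in the site.\<close>

lemma prob_abs_F_near_edge: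
  assumes "\<eta> > 0"
  shows "\<exists>e0>0. \<forall>e\<le>e0. \<forall>x. prob {\<omega> \<in> space M. \<bar>F x \<omega>\<bar> > c - e} < \<eta>"
proof -
  have same: "prob {\<omega> \<in> space M. \<bar>F x \<omega>\<bar> > c - e} = prob {\<omega> \<in> space M. \<bar>F 0 \<omega>\<bar> > c - e}" for x e
  proof -
    have "prob {\<omega> \<in> space M. \<bar>F x \<omega>\<bar> > c - e} = measure (distr M lborel (F x)) {t. \<bar>t\<bar> > c - e}" for x
      by (subst measure_distr) (auto intro!: arg_cong[where f = prob])
    then show ?thesis by (simp add: distributed_distr_eq_density[OF F_distr])
  qed
  let ?A = "\<lambda>n::nat. {\<omega> \<in> space M. \<bar>F 0 \<omega>\<bar> > c - 1 / (real n + 1)}"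
  have "(\<lambda>n. prob (?A n)) \<longlonglongrightarrow> prob (\<Inter>n. ?A n)"
  proof (rule finite_Lim_measure_decseq)
    have "1 / (real n + 1) \<le> 1 / (real m + 1)" if "m \<le> n" for m n using that by (simp add: frac_le)
    then show "decseq ?A" unfolding decseq_def by (auto intro: le_less_trans[OF diff_left_mono])
  qed auto
  also have "prob (\<Inter>n. ?A n) = 0"
  proof -
    have "AE \<omega> in M. \<omega> \<notin> (\<Inter>n. ?A n)"
      using AE_abs_F_less[of 0]
    proof eventually_elim
      case (elim \<omega>)
      then obtain n where "inverse (real (Suc n)) < c - \<bar>F 0 \<omega>\<bar>" using reals_Archimedean[of "c - \<bar>F
        0 \<omega>\<bar>"] by auto
      then have "\<not> \<bar>F 0 \<omega>\<bar> > c - 1 / (real n + 1)" by (simp add: inverse_eq_divide add.commute)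
      then show ?case by auto
    qed
    then show ?thesis by (subst prob_eq_0) auto
  qed
  finally have "\<forall>\<^sub>F n in sequentially. prob (?A n) < \<eta>" using assms by (intro order_tendstoD(2)) auto
  then obtain n where n: "prob (?A n) < \<eta>" by (auto simp: eventually_sequentially)
  have "prob {\<omega> \<in> space M. \<bar>F x \<omega>\<bar> > c - e} < \<eta>" if "e \<le> 1 / (real n + 1)" for e x
    using that by (subst same) (intro le_less_trans[OF finite_measure_mono n], auto)
  then show ?thesis by (intro exI[of _ "1 / (real n + 1)"]) auto
qed

text \<open>Almost surely |F(x + 1)| < c, so a small discrepancy at x + 1 forces F(x + 2) near an
  edge. That event is independent of the discrepancy at x, and its probability tends to 0 with e;
  two small neighbours are thus negligible against one.\<close>

lemma prob_adjacent_discrepancies: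
  "prob ({\<omega> \<in> space M. discrepancy c F \<omega> x < e} \<inter> {\<omega> \<in> space M. discrepancy c F \<omega> (x + 1) < e})
    \<le> prob {\<omega> \<in> space M. discrepancy c F \<omega> x < e} * prob {\<omega> \<in> space M. \<bar>F (x + 2) \<omega>\<bar> > c - e}"
proof -
  let ?A = "{x, x + 1}" and ?B = "{x + 2}"
  let ?P = "{f \<in> space (PiM ?A (\<lambda>_. borel)). 2 * c - e < \<bar>f (x + 1) - f x\<bar>}"
  let ?Q = "{f \<in> space (PiM ?B (\<lambda>_. borel)). \<bar>f (x + 2)\<bar> > c - e}"
  have P: "?P \<in> sets (PiM ?A (\<lambda>_. borel))" by measurable
  have Q: "?Q \<in> sets (PiM ?B (\<lambda>_. borel))" by measurable
  have 1: "{\<omega> \<in> space M. restrict (\<lambda>i. F i \<omega>) ?A \<in> ?P} = {\<omega> \<in> space M. discrepancy c F \<omega> x < e}"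
    by (auto simp: space_PiM discrepancy_less_iff)
  have 2: "{\<omega> \<in> space M. restrict (\<lambda>i. F i \<omega>) ?B \<in> ?Q} = {\<omega> \<in> space M. \<bar>F (x + 2) \<omega>\<bar> > c - e}"
    by (auto simp: space_PiM)
  have "prob ({\<omega> \<in> space M. discrepancy c F \<omega> x < e} \<inter> {\<omega> \<in> space M. discrepancy c F \<omega> (x + 1) < e})
    \<le> prob ({\<omega> \<in> space M. discrepancy c F \<omega> x < e} \<inter> {\<omega> \<in> space M. \<bar>F (x + 2) \<omega>\<bar> > c - e})"
  proof (rule finite_measure_mono_AE)
    show "AE \<omega> in M. \<omega> \<in> {\<omega> \<in> space M. discrepancy c F \<omega> x < e} \<inter> {\<omega> \<in> space M. discrepancy c F \<omega> (x
      + 1) < e}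
      \<longrightarrow> \<omega> \<in> {\<omega> \<in> space M. discrepancy c F \<omega> x < e} \<inter> {\<omega> \<in> space M. \<bar>F (x + 2) \<omega>\<bar> > c - e}"
      using AE_abs_F_less[of "x + 1"]
    proof eventually_elim
      case (elim \<omega>)
      have 2: "x + 1 + 1 = x + 2" by simp
      have "c - e < \<bar>F (x + 2) \<omega>\<bar>" if "2 * c - e < \<bar>F (x + 2) \<omega> - F (x + 1) \<omega>\<bar>" using elim that by
        linarith
      then show ?case unfolding discrepancy_less_iff mem_Collect_eq Int_iff 2 by blast
    qed
  qed auto
  also have "\<dots> = prob {\<omega> \<in> space M. discrepancy c F \<omega> x < e} * prob {\<omega> \<in> space M. \<bar>F (x + 2) \<omega>\<bar> > c - e}"
    using prob_restrict_indep[OF _ P Q] unfolding 1 2 by simp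
  finally show ?thesis .
qed

text \<open>Brings the sequence bound to a window of integer sites starting at \<open>- R\<close>;
  the events at i use only the values at i and i + 1.\<close>

lemma void_prob_one_dependent:
  fixes H :: "int \<Rightarrow> real \<Rightarrow> real \<Rightarrow> bool" and R :: int
  defines "E \<equiv> \<lambda>x. {\<omega> \<in> space M. H x (F x \<omega>) (F (x + 1) \<omega>)}"
  assumes H: "\<And>x. {z. H x (fst z) (snd z)} \<in> sets (borel \<Otimes>\<^sub>M borel)"
    and s: "\<And>x. prob (E x \<inter> E (x + 1)) \<le> s" and p: "\<And>x. prob (E x) \<le> p"
  shows "\<bar>prob {\<omega> \<in> space M. \<forall>i<m. \<omega> \<notin> E (int i - R)} - exp (- (\<Sum>i<m. prob (E (int i - R))))\<bar> \<le> real
    m * (s + 2 * p\<^sup>2)"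
proof (rule void_prob_exp_bound)
  have Em: "{f \<in> space (PiM A (\<lambda>_. borel)). H x (f x) (f (x + 1))} \<in> sets (PiM A (\<lambda>_. borel))"
    if "x \<in> A" "x + 1 \<in> A" for x A
  proof -
    have "(\<lambda>f. (f x, f (x + 1))) \<in> measurable (PiM A (\<lambda>_. borel)) (borel \<Otimes>\<^sub>M (borel :: real measure))"
      using that by (intro measurable_Pair measurable_component_singleton)
    from measurable_sets[OF this H[of x]] show ?thesis by (simp add: vimage_def Int_def conj_commute)
  qed
  show E: "E (int i - R) \<in> events" for i
  proof -
    have "(\<lambda>\<omega>. (F (int i - R) \<omega>, F (int i - R + 1) \<omega>)) \<in> measurable M (borel \<Otimes>\<^sub>M borel)" by measurable
    from measurable_sets[OF this H[of "int i - R"]] show ?thesis by (simp add: E_def vimage_def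
      Int_def conj_commute)
  qed
  show "prob (E (int i - R)) \<le> p" for i by (rule p)
  show "prob (E (int i - R) \<inter> E (int (Suc i) - R)) \<le> s" for i using s[of "int i - R"] by (simp add:
    algebra_simps)
  fix k
  \<comment> \<open>The events before index k read values up to site k - R, and the event k + 1
    reads the next two. These ranges are disjoint precisely because the event k is skipped.\<close>
  let ?A = "{x. x \<le> int k - R}" and ?B = "{int k + 1 - R, int k + 2 - R}"
  let ?P = "{f \<in> space (PiM ?A (\<lambda>_. borel)). \<forall>i\<in>{..<k}. \<not> H (int i - R) (f (int i - R)) (f (int i -
    R + 1))}"
  let ?Q = "{f \<in> space (PiM ?B (\<lambda>_. borel)). H (int (Suc k) - R) (f (int (Suc k) - R)) (f (int (Suc
    k) - R + 1))}"
  have P: "?P \<in> sets (PiM ?A (\<lambda>_. borel))"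
    by (intro sets.sets_Collect_finite_All sets.sets_Collect_neg Em) auto
  have Q: "?Q \<in> sets (PiM ?B (\<lambda>_. borel))"
    by (intro Em) auto
  have 1: "{\<omega> \<in> space M. restrict (\<lambda>i. F i \<omega>) ?A \<in> ?P} = {\<omega> \<in> space M. \<forall>i<k. \<omega> \<notin> E (int i - R)}"
    by (auto simp: space_PiM E_def)
  have 2: "{\<omega> \<in> space M. restrict (\<lambda>i. F i \<omega>) ?B \<in> ?Q} = E (int (Suc k) - R)"
    by (auto simp: space_PiM E_def add.commute add.left_commute)
  show "prob ({\<omega> \<in> space M. \<forall>i<k. \<omega> \<notin> E (int i - R)} \<inter> E (int (Suc k) - R)) =
      prob {\<omega> \<in> space M. \<forall>i<k. \<omega> \<notin> E (int i - R)} * prob (E (int (Suc k) - R))"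
    using prob_restrict_indep[OF _ P Q] unfolding 1 2 by auto
qed

subsection \<open>Rescaling\<close>

abbreviation \<zeta> :: real where
  "\<zeta> \<equiv> (2 * \<kappa> + 2) / (2 * \<kappa> + 3)"

lemma zeta_pos: "\<zeta> > 0" and one_minus_zeta: "1 - \<zeta> = 1 / (2 * \<kappa> + 3)" and one_minus_zeta_pos: "1 - \<zeta> > 0"
  using kappa by (auto simp: field_simps)

definition disc_cdf :: "real \<Rightarrow> real" where
  "disc_cdf e = prob {\<omega> \<in> space M. discrepancy c F \<omega> 0 < e}"

text \<open>The limit in \<open>prob_discrepancy_asymp\<close>. Multiplied by y^(2 \<kappa> + 2) it
  is the antiderivative in y of the intensity of the limit process.\<close>

definition edge_const :: real where
  "edge_const = q\<^sup>2 * (2 * Beta (\<kappa> + 1) (\<kappa> + 1)) / (2 * \<kappa> + 2)"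

lemma edge_const_pos: "edge_const > 0"
  unfolding edge_const_def using q_pos kappa Beta_pos_real[of "\<kappa> + 1" "\<kappa> + 1"] by simp

lemma tendsto_powr_neg_sequentially: "s > 0 \<Longrightarrow> (\<lambda>n. t / real n powr s) \<longlonglongrightarrow> 0"
  using tendsto_mult[OF tendsto_const[of t] tendsto_neg_powr[of "-s" "\<lambda>n. real n", OF _
    filterlim_real_sequentially]]
  by (simp add: powr_minus_divide)

lemma scaled_disc_cdf:
  assumes t: "t > 0"
  shows "(\<lambda>n. real n powr \<zeta> * disc_cdf (t / real n powr (1 - \<zeta>))) \<longlonglongrightarrow> edge_const * t powr (2 * \<kappa> + 2)"
proof -
  have "filterlim (\<lambda>n. t / real n powr (1 - \<zeta>)) (at_right 0) sequentially"
  proof (rule tendsto_imp_filterlim_at_right)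
    show "(\<lambda>n. t / real n powr (1 - \<zeta>)) \<longlonglongrightarrow> 0" by (rule tendsto_powr_neg_sequentially[OF
      one_minus_zeta_pos])
    show "\<forall>\<^sub>F n in sequentially. 0 < t / real n powr (1 - \<zeta>)"
      using eventually_gt_at_top[of 0] by eventually_elim (use t in simp)
  qed
  from filterlim_compose[OF prob_discrepancy_asymp[of 0] this]
  have "(\<lambda>n. disc_cdf (t / real n powr (1 - \<zeta>)) / (t / real n powr (1 - \<zeta>)) powr (2 * \<kappa> + 2)) \<longlonglongrightarrow>
    edge_const"
    unfolding disc_cdf_def edge_const_def .
  then have "(\<lambda>n. disc_cdf (t / real n powr (1 - \<zeta>)) / (t / real n powr (1 - \<zeta>)) powr (2 * \<kappa> + 2) *
    t powr (2 * \<kappa> + 2)) \<longlonglongrightarrow> edge_const * t powr (2 * \<kappa> + 2)"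
    by (intro tendsto_intros)
  moreover have "\<forall>\<^sub>F n in sequentially. disc_cdf (t / real n powr (1 - \<zeta>)) / (t / real n powr (1 -
    \<zeta>)) powr (2 * \<kappa> + 2) * t powr (2 * \<kappa> + 2)
      = real n powr \<zeta> * disc_cdf (t / real n powr (1 - \<zeta>))"
    using eventually_gt_at_top[of 0]
  proof eventually_elim
    case (elim n)
    have "(t / real n powr (1 - \<zeta>)) powr (2 * \<kappa> + 2) = t powr (2 * \<kappa> + 2) / real n powr ((1 - \<zeta>) *
      (2 * \<kappa> + 2))"
      using t by (simp add: powr_divide powr_powr)
    \<comment> \<open>The balance that determines \<zeta>: the normalisation of the tail becomes
      exactly the number of sites per unit length.\<close>
    also have "(1 - \<zeta>) * (2 * \<kappa> + 2) = \<zeta>" unfolding one_minus_zeta by simp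
    finally show ?case using t elim by (simp add: field_simps)
  qed
  ultimately show ?thesis by (rule Lim_transform_eventually)
qed

lemma disc_cdf_tendsto_0:
  assumes "t > 0"
  shows "(\<lambda>n. disc_cdf (t / real n powr (1 - \<zeta>))) \<longlonglongrightarrow> 0"
proof -
  have "(\<lambda>n. real n powr \<zeta> * disc_cdf (t / real n powr (1 - \<zeta>)) * (1 / real n powr \<zeta>)) \<longlonglongrightarrow> edge_const
    * t powr (2 * \<kappa> + 2) * 0"
    by (intro tendsto_mult scaled_disc_cdf[OF assms] tendsto_powr_neg_sequentially zeta_pos)
  moreover have "\<forall>\<^sub>F n in sequentially. real n powr \<zeta> * disc_cdf (t / real n powr (1 - \<zeta>)) * (1 /
    real n powr \<zeta>) = disc_cdf (t / real n powr (1 - \<zeta>))"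
    using eventually_gt_at_top[of 0] by eventually_elim simp
  ultimately show ?thesis by (simp add: tendsto_cong)
qed

definition site_prob :: "nat \<Rightarrow> nat \<Rightarrow> int \<Rightarrow> real" where
  "site_prob n b j = disc_cdf ((real_of_int j + 1) / real b / real n powr (1 - \<zeta>)) - disc_cdf
    (real_of_int j / real b / real n powr (1 - \<zeta>))"

text \<open>The intensity mass of row \<open>j\<close> over a horizontal interval of length 1; a
  grid cell of column scale \<open>a\<close> thus has mass
  \<open>cell_weight b j / a\<close>.\<close>

definition cell_weight :: "nat \<Rightarrow> int \<Rightarrow> real" where
  "cell_weight b j = edge_const * (((real_of_int j + 1) / real b) powr (2 * \<kappa> + 2) - (real_of_int j
    / real b) powr (2 * \<kappa> + 2))"

lemma scaled_site_prob:
  assumes "b > 0" "j \<ge> 1"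
  shows "(\<lambda>n. real n powr \<zeta> * site_prob n b j) \<longlonglongrightarrow> cell_weight b j"
proof -
  have "(\<lambda>n. real n powr \<zeta> * disc_cdf ((real_of_int j + 1) / real b / real n powr (1 - \<zeta>)) - real n
    powr \<zeta> * disc_cdf (real_of_int j / real b / real n powr (1 - \<zeta>)))
    \<longlonglongrightarrow> edge_const * ((real_of_int j + 1) / real b) powr (2 * \<kappa> + 2) - edge_const * (real_of_int j /
      real b) powr (2 * \<kappa> + 2)"
    using assms by (intro tendsto_diff scaled_disc_cdf) auto
  then show ?thesis unfolding site_prob_def cell_weight_def by (simp only: right_diff_distrib)
qed

section \<open>Sites whose rescaled points fall into grid cells\<close>

definition pp_point :: "nat \<Rightarrow> 'a \<Rightarrow> int \<Rightarrow> real \<times> real" where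
  "pp_point n \<omega> x = (real n powr (- \<zeta>) * real_of_int x, real n powr (1 - \<zeta>) * discrepancy c F \<omega> x)"

definition hit :: "nat \<Rightarrow> nat \<Rightarrow> nat \<Rightarrow> (int \<times> int) set \<Rightarrow> int \<Rightarrow> 'a set" where
  "hit n a b A x = {\<omega> \<in> space M. \<exists>k\<in>A. pp_point n \<omega> x \<in> grid_cell a b k}"

text \<open>The sites whose first rescaled coordinate lies in column i, about n^\<zeta> / a many.
  For n = 0 every site lands in column 0 because \<open>0 powr s\<close> is 0, hence the restriction
  \<open>n > 0\<close> in \<open>column_eq\<close>.\<close>

definition column :: "nat \<Rightarrow> nat \<Rightarrow> int \<Rightarrow> int set" where
  "column n a i = {x. \<lfloor>real a * (real n powr (- \<zeta>) * real_of_int x)\<rfloor> = i}"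

lemma pp_point_cell_iff:
  "pp_point n \<omega> x \<in> grid_cell a b k \<longleftrightarrow> x \<in> column n a (fst k) \<and> \<lfloor>real b * (real n powr (1 - \<zeta>) *
    discrepancy c F \<omega> x)\<rfloor> = snd k"
  by (simp add: pp_point_def grid_cell_def column_def)

lemma hit_measurable: "hit n a b A x \<in> events" if "finite A"
proof -
  have "hit n a b A x = (\<Union>k\<in>A. {\<omega> \<in> space M. x \<in> column n a (fst k) \<and> \<lfloor>real b * (real n powr (1 - \<zeta>)
    * discrepancy c F \<omega> x)\<rfloor> = snd k})"
    unfolding hit_def pp_point_cell_iff by auto
  moreover have "{\<omega> \<in> space M. x \<in> column n a (fst k) \<and> \<lfloor>real b * (real n powr (1 - \<zeta>) * discrepancy
    c F \<omega> x)\<rfloor> = snd k} \<in> events" for k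
    by measurable
  ultimately show ?thesis using that by auto
qed

lemma column_eq:
  assumes "n > 0" "a > 0"
  shows "column n a i = {\<lceil>real_of_int i * (real n powr \<zeta> / real a)\<rceil>..<\<lceil>(real_of_int i + 1) * (real n
    powr \<zeta> / real a)\<rceil>}"
proof -
  have p: "real n powr \<zeta> > 0" using assms by simp
  have "x \<in> column n a i \<longleftrightarrow> real_of_int i * (real n powr \<zeta> / real a) \<le> real_of_int x \<and> real_of_int x
    < (real_of_int i + 1) * (real n powr \<zeta> / real a)" for x
    unfolding column_def using p assms by (simp add: floor_eq_iff powr_minus_divide field_simps)
  then show ?thesis by (intro set_eqI) (simp only: atLeastLessThan_iff ceiling_le_iff less_ceiling_iff)
qed

lemma card_column:
  assumes "a > 0"
  shows "(\<lambda>n. real (card (column n a i)) / real n powr \<zeta>) \<longlonglongrightarrow> 1 / real a"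
proof (rule tendsto_sandwich)
  have "(\<lambda>n. 1 / real a - 1 / real n powr \<zeta>) \<longlonglongrightarrow> 1 / real a - 0"
    by (intro tendsto_intros tendsto_powr_neg_sequentially zeta_pos)
  then show "(\<lambda>n. 1 / real a - 1 / real n powr \<zeta>) \<longlonglongrightarrow> 1 / real a" by simp
  have "(\<lambda>n. 1 / real a + 1 / real n powr \<zeta>) \<longlonglongrightarrow> 1 / real a + 0"
    by (intro tendsto_intros tendsto_powr_neg_sequentially zeta_pos)
  then show "(\<lambda>n. 1 / real a + 1 / real n powr \<zeta>) \<longlonglongrightarrow> 1 / real a" by simp
  have bounds: "real n powr \<zeta> / real a - 1 \<le> real (card (column n a i)) \<and> real (card (column n a i))
    \<le> real n powr \<zeta> / real a + 1" if "n > 0" for n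
  proof -
    define L where "L = real n powr \<zeta> / real a"
    have L: "L > 0" using that assms unfolding L_def by simp
    have le: "\<lceil>real_of_int i * L\<rceil> \<le> \<lceil>(real_of_int i + 1) * L\<rceil>" using L by (intro ceiling_mono
      mult_right_mono) auto
    have "real (card (column n a i)) = real_of_int \<lceil>(real_of_int i + 1) * L\<rceil> - real_of_int
      \<lceil>real_of_int i * L\<rceil>"
      unfolding column_eq[OF that assms] L_def[symmetric] using le by simp
    moreover have "(real_of_int i + 1) * L = real_of_int i * L + L" by (simp add: algebra_simps)
    ultimately show ?thesis unfolding L_def[symmetric] by linarith
  qed
  show "\<forall>\<^sub>F n in sequentially. 1 / real a - 1 / real n powr \<zeta> \<le> real (card (column n a i)) / real n
    powr \<zeta>"
    using eventually_gt_at_top[of 0]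
  proof eventually_elim
    case (elim n)
    have "(real n powr \<zeta> / real a - 1) / real n powr \<zeta> \<le> real (card (column n a i)) / real n powr \<zeta>"
      using bounds[OF elim] by (intro divide_right_mono) auto
    then show ?case using elim by (simp add: diff_divide_distrib)
  qed
  show "\<forall>\<^sub>F n in sequentially. real (card (column n a i)) / real n powr \<zeta> \<le> 1 / real a + 1 / real n
    powr \<zeta>"
    using eventually_gt_at_top[of 0]
  proof eventually_elim
    case (elim n)
    have "real (card (column n a i)) / real n powr \<zeta> \<le> (real n powr \<zeta> / real a + 1) / real n powr \<zeta>"
      using bounds[OF elim] by (intro divide_right_mono) auto
    then show ?case using elim by (simp add: add_divide_distrib)
  qed
qed

text \<open>Half-open rows make the event exactly a difference of two nested sublevel events of the
  discrepancy. The bound 2c allows both to be evaluated at site 0 by stationarity.\<close>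

lemma prob_hit_single:
  assumes n: "n > 0" and b: "b > 0" and small: "(real_of_int (snd k) + 1) / real b / real n powr (1
    - \<zeta>) \<le> 2 * c"
  shows "prob (hit n a b {k} x) = (if x \<in> column n a (fst k) then site_prob n b (snd k) else 0)"
proof (cases "x \<in> column n a (fst k)")
  case True
  let ?N = "real n powr (1 - \<zeta>)"
  have N: "?N > 0" using n by simp
  let ?D = "\<lambda>e. {\<omega> \<in> space M. discrepancy c F \<omega> x < e}"
  let ?t = "(real_of_int (snd k) + 1) / real b / ?N" and ?s = "real_of_int (snd k) / real b / ?N"
  have st: "?s \<le> ?t" using N b by (intro divide_right_mono) auto
  have "\<lfloor>real b * (N * d)\<rfloor> = j \<longleftrightarrow> d < (real_of_int j + 1) / real b / N \<and> \<not> d < real_of_int j / real b / N"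
    if "N > 0" for N d :: real and j
    using that b by (auto simp: floor_eq_iff field_simps)
  from this[OF N] have h: "hit n a b {k} x = ?D ?t - ?D ?s"
    unfolding hit_def using True by (auto simp: pp_point_cell_iff)
  have "?D ?s \<subseteq> ?D ?t" using st by auto
  then have "prob (hit n a b {k} x) = prob (?D ?t) - prob (?D ?s)"
    unfolding h by (intro finite_measure_Diff) auto
  moreover have "prob (?D ?t) = disc_cdf ?t"
    unfolding disc_cdf_def by (rule prob_discrepancy_stationary[OF small])
  moreover have "prob (?D ?s) = disc_cdf ?s"
    unfolding disc_cdf_def by (rule prob_discrepancy_stationary[OF order_trans[OF st small]])
  ultimately show ?thesis using True by (simp only: site_prob_def if_True)
next
  case False
  then have "hit n a b {k} x = {}" unfolding hit_def by (simp add: pp_point_cell_iff)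
  then show ?thesis using False by simp
qed

lemma prob_hit_eq_sum:
  assumes "finite A"
  shows "prob (hit n a b A x) = (\<Sum>k\<in>A. prob (hit n a b {k} x))"
proof -
  have "hit n a b A x = (\<Union>k\<in>A. hit n a b {k} x)" unfolding hit_def by auto
  moreover have "disjoint_family_on (\<lambda>k. hit n a b {k} x) A"
    unfolding disjoint_family_on_def hit_def pp_point_cell_iff column_def by (auto simp: prod_eq_iff)
  ultimately show ?thesis using assms hit_measurable by (simp add: finite_measure_finite_Union
    image_subset_iff)
qed

lemma eventually_small:
  "\<forall>\<^sub>F n in sequentially. t / real n powr (1 - \<zeta>) \<le> 2 * c"
  using order_tendstoD(2)[OF tendsto_powr_neg_sequentially[OF one_minus_zeta_pos], of "2 * c" t] c_pos
  by (auto elim: eventually_mono)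

text \<open>About n^\<zeta> / a sites in the column, each hitting with probability about
  \<open>cell_weight b (snd k)\<close> / n^\<zeta>.\<close>

lemma expected_hits:
  assumes a: "a > 0" and b: "b > 0" and k: "snd k \<ge> 1"
  shows "(\<lambda>n. \<Sum>x\<in>column n a (fst k). prob (hit n a b {k} x)) \<longlonglongrightarrow> cell_weight b (snd k) / real a"
proof -
  have "(\<lambda>n. (real (card (column n a (fst k))) / real n powr \<zeta>) * (real n powr \<zeta> * site_prob n b
    (snd k))) \<longlonglongrightarrow> (1 / real a) * cell_weight b (snd k)"
    by (intro tendsto_mult card_column a scaled_site_prob b k)
  moreover have "\<forall>\<^sub>F n in sequentially. (real (card (column n a (fst k))) / real n powr \<zeta>) * (real n
    powr \<zeta> * site_prob n b (snd k)) =
     (\<Sum>x\<in>column n a (fst k). prob (hit n a b {k} x))"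
    using eventually_gt_at_top[of 0] eventually_small[of "(real_of_int (snd k) + 1) / real b"]
  proof eventually_elim
    case (elim n)
    then show ?case by (simp add: prob_hit_single[OF elim(1) b elim(2)])
  qed
  ultimately show ?thesis by (simp add: tendsto_cong)
qed

lemma hit_subset_discrepancy:
  assumes n: "n > 0" and b: "b > 0" and T: "\<And>k. k \<in> A \<Longrightarrow> (real_of_int (snd k) + 1) / real b \<le> T"
  shows "hit n a b A x \<subseteq> {\<omega> \<in> space M. discrepancy c F \<omega> x < T / real n powr (1 - \<zeta>)}"
proof
  fix \<omega> assume "\<omega> \<in> hit n a b A x"
  then obtain k where k: "k \<in> A" "\<omega> \<in> space M" "\<lfloor>real b * (real n powr (1 - \<zeta>) * discrepancy c F \<omega>
    x)\<rfloor> = snd k"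
    unfolding hit_def pp_point_cell_iff by auto
  define N d where "N = real n powr (1 - \<zeta>)" and "d = discrepancy c F \<omega> x"
  have N: "N > 0" using n by (simp add: N_def)
  have "real b * (N * d) < real_of_int (snd k) + 1" using k(3) unfolding N_def d_def by (simp add:
    floor_eq_iff)
  then have "N * d < (real_of_int (snd k) + 1) / real b" using b by (simp add: field_simps)
  also have "\<dots> \<le> T" by (rule T[OF k(1)])
  finally have "d < T / N" using N by (simp add: field_simps)
  then show "\<omega> \<in> {\<omega> \<in> space M. discrepancy c F \<omega> x < T / real n powr (1 - \<zeta>)}" using k(2) unfolding
    N_def d_def by simp
qed

text \<open>With p the probability of a discrepancy below T / n^(1 - \<zeta>), each event has
  probability at most p and two neighbours at most p \<eta>. There are of order n^\<zeta> events, so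
  the error is a constant times (n^\<zeta> p)(\<eta> + 2 p); the first factor stays bounded and the
  second can be made small.\<close>

lemma hit_approx:
  assumes n: "n > 0" and a: "a > 0" and b: "b > 0" and A: "finite A"
    and T: "\<And>k. k \<in> A \<Longrightarrow> (real_of_int (snd k) + 1) / real b \<le> T"
    and r: "\<And>k. k \<in> A \<Longrightarrow> \<bar>fst k\<bar> \<le> int r"
    and small: "T / real n powr (1 - \<zeta>) \<le> 2 * c"
    and edge: "\<And>x. prob {\<omega> \<in> space M. \<bar>F x \<omega>\<bar> > c - T / real n powr (1 - \<zeta>)} \<le> \<eta>"
  shows "\<bar>prob {\<omega> \<in> space M. \<forall>x. \<omega> \<notin> hit n a b A x} - exp (- (\<Sum>k\<in>A. \<Sum>x\<in>column n a (fst k). prob (hit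
    n a b {k} x)))\<bar>
    \<le> (2 * (real r + 1) / real a + 2) * (real n powr \<zeta> * disc_cdf (T / real n powr (1 - \<zeta>))) * (\<eta> +
      2 * disc_cdf (T / real n powr (1 - \<zeta>)))"
proof -
  define L where "L = real n powr \<zeta> / real a"
  define e where "e = T / real n powr (1 - \<zeta>)"
  \<comment> \<open>Every column met by \<open>A\<close> lies among the sites from
    \<open>- R\<close> to \<open>R - 1\<close>, because its index is at most \<open>r\<close> in
    modulus.\<close>
  define R where "R = \<lceil>(real r + 1) * L\<rceil>"
  define m where "m = nat (2 * R)"
  define H where "H x s t \<longleftrightarrow> (\<exists>k\<in>A. x \<in> column n a (fst k) \<and> \<lfloor>real b * (real n powr (1 - \<zeta>) * (2 * c
    - \<bar>t - s\<bar>))\<rfloor> = snd k)" for x s t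
  have L: "L > 0" using n a unfolding L_def by simp
  have "(real r + 1) * L \<ge> 0" using L by simp
  then have R0: "R \<ge> 0" unfolding R_def by linarith
  have hitH: "hit n a b A x = {\<omega> \<in> space M. H x (F x \<omega>) (F (x + 1) \<omega>)}" for x
    unfolding hit_def H_def pp_point_cell_iff discrepancy_def ..
  have H: "{z. H x (fst z) (snd z)} \<in> sets (borel \<Otimes>\<^sub>M borel)" for x
  proof -
    have "{z \<in> space (borel \<Otimes>\<^sub>M borel). \<exists>k\<in>A. x \<in> column n a (fst k) \<and> \<lfloor>real b * (real n powr (1 -
      \<zeta>) * (2 * c - \<bar>snd z - fst z\<bar>))\<rfloor> = snd k} \<in> sets (borel \<Otimes>\<^sub>M (borel :: real measure))"
      using A by (intro sets.sets_Collect_finite_Ex) measurable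
    then show ?thesis unfolding H_def by (simp add: space_pair_measure)
  qed
  have sub: "hit n a b A x \<subseteq> {\<omega> \<in> space M. discrepancy c F \<omega> x < e}" for x
    unfolding e_def by (rule hit_subset_discrepancy[OF n b T])
  have D: "prob {\<omega> \<in> space M. discrepancy c F \<omega> x < e} = disc_cdf e" for x
    unfolding disc_cdf_def e_def by (rule prob_discrepancy_stationary[OF small])
  have p: "prob (hit n a b A x) \<le> disc_cdf e" for x
    unfolding D[of x, symmetric] by (intro finite_measure_mono sub) auto
  have s: "prob (hit n a b A x \<inter> hit n a b A (x + 1)) \<le> disc_cdf e * \<eta>" for x
  proof -
    have "prob (hit n a b A x \<inter> hit n a b A (x + 1)) \<le> prob ({\<omega> \<in> space M. discrepancy c F \<omega> x < e}
      \<inter> {\<omega> \<in> space M. discrepancy c F \<omega> (x + 1) < e})"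
      by (intro finite_measure_mono Int_mono sub) auto
    also have "\<dots> \<le> disc_cdf e * prob {\<omega> \<in> space M. \<bar>F (x + 2) \<omega>\<bar> > c - e}"
      using prob_adjacent_discrepancies[of x e] unfolding D .
    also have "\<dots> \<le> disc_cdf e * \<eta>" using edge[of "x + 2"] unfolding e_def disc_cdf_def by (intro
      mult_left_mono) auto
    finally show ?thesis .
  qed
  have bound: "\<bar>prob {\<omega> \<in> space M. \<forall>i<m. \<omega> \<notin> hit n a b A (int i - R)} - exp (- (\<Sum>i<m. prob (hit n a
    b A (int i - R))))\<bar> \<le> real m * (disc_cdf e * \<eta> + 2 * (disc_cdf e)\<^sup>2)"
    using void_prob_one_dependent[of H "disc_cdf e * \<eta>" "disc_cdf e" m R, OF H] s p unfolding hitH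
      by blast
  have col: "column n a (fst k) \<subseteq> {- R..<R}" if "k \<in> A" for k
  proof -
    have "real_of_int (fst k) \<le> real r" "- real r \<le> real_of_int (fst k)" using r[OF that] by linarith+
    then have 1: "(real_of_int (fst k) + 1) * L \<le> (real r + 1) * L" "- real r * L \<le> real_of_int (fst
      k) * L"
      using L by (intro mult_right_mono; simp)+
    have "- (real r + 1) * L \<le> - real r * L" using L by (intro mult_right_mono) auto
    then have "- R \<le> \<lceil>real_of_int (fst k) * L\<rceil>" using 1(2) unfolding R_def by linarith
    moreover have "\<lceil>(real_of_int (fst k) + 1) * L\<rceil> \<le> R" unfolding R_def by (intro ceiling_mono 1)
    ultimately show ?thesis unfolding column_eq[OF n a] L_def[symmetric] by auto
  qed
  have ex: "\<exists>i<m. x = int i - R" if "x \<in> {- R..<R}" for x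
    using that R0 unfolding m_def by (intro exI[of _ "nat (x + R)"]) auto
  have hit_col: "x \<in> {- R..<R}" if "\<omega> \<in> hit n a b A x" for \<omega> x
    using that col unfolding hit_def pp_point_cell_iff by blast
  \<comment> \<open>No site outside the window can hit a cell of \<open>A\<close>, so the void event
    over all sites is one over \<open>m\<close> sites.\<close>
  have V: "{\<omega> \<in> space M. \<forall>i<m. \<omega> \<notin> hit n a b A (int i - R)} = {\<omega> \<in> space M. \<forall>x. \<omega> \<notin> hit n a b A x}"
    using ex hit_col by blast
  have bij: "bij_betw (\<lambda>i. int i - R) {..<m} {- R..<R}"
    by (rule bij_betwI[where g = "\<lambda>x. nat (x + R)"]) (use R0 in \<open>auto simp: m_def\<close>)
  have "(\<Sum>i<m. prob (hit n a b A (int i - R))) = (\<Sum>x\<in>{- R..<R}. prob (hit n a b A x))"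
    by (rule sum.reindex_bij_betw[OF bij])
  also have "\<dots> = (\<Sum>x\<in>{- R..<R}. \<Sum>k\<in>A. prob (hit n a b {k} x))" by (simp add: prob_hit_eq_sum[OF A])
  also have "\<dots> = (\<Sum>k\<in>A. \<Sum>x\<in>{- R..<R}. prob (hit n a b {k} x))" by (rule sum.swap)
  also have "\<dots> = (\<Sum>k\<in>A. \<Sum>x\<in>column n a (fst k). prob (hit n a b {k} x))"
  proof (rule sum.cong[OF refl], rule sum.mono_neutral_right)
    fix k assume "k \<in> A"
    show "\<forall>x\<in>{- R..<R} - column n a (fst k). prob (hit n a b {k} x) = 0"
    proof
      fix x assume "x \<in> {- R..<R} - column n a (fst k)"
      then have "hit n a b {k} x = {}" unfolding hit_def pp_point_cell_iff by auto
      then show "prob (hit n a b {k} x) = 0" by simp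
    qed
  qed (use col in auto)
  finally have S: "(\<Sum>i<m. prob (hit n a b A (int i - R))) = (\<Sum>k\<in>A. \<Sum>x\<in>column n a (fst k). prob (hit
    n a b {k} x))" .
  \<comment> \<open>The ceiling in \<open>R\<close> adds at most 2 to the number of sites; since
    n^\<zeta> is at least 1, this is absorbed into the constant.\<close>
  have N1: "real n powr \<zeta> \<ge> 1" using n zeta_pos by (intro ge_one_powr_ge_zero) auto
  have "real m \<le> 2 * ((real r + 1) * L + 1)"
  proof -
    have "real m = 2 * real_of_int R" unfolding m_def using R0 by simp
    also have "\<dots> \<le> 2 * ((real r + 1) * L + 1)"
      unfolding R_def by (intro mult_left_mono of_int_ceiling_le_add_one) auto
    finally show ?thesis .
  qed
  also have "\<dots> = 2 * (real r + 1) / real a * real n powr \<zeta> + 2 * 1" unfolding L_def by simp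
  also have "\<dots> \<le> 2 * (real r + 1) / real a * real n powr \<zeta> + 2 * real n powr \<zeta>" using N1 by simp
  finally have m: "real m \<le> (2 * (real r + 1) / real a + 2) * real n powr \<zeta>" by (simp add: algebra_simps)
  have \<eta>0: "\<eta> \<ge> 0" using edge[of 0] measure_nonneg order_trans by blast
  have d0: "disc_cdf e \<ge> 0" unfolding disc_cdf_def by simp
  have "real m * (disc_cdf e * \<eta> + 2 * (disc_cdf e)\<^sup>2) \<le> ((2 * (real r + 1) / real a + 2) * real n
    powr \<zeta>) * (disc_cdf e * \<eta> + 2 * (disc_cdf e)\<^sup>2)"
    using m \<eta>0 d0 by (intro mult_right_mono) auto
  also have "\<dots> = (2 * (real r + 1) / real a + 2) * (real n powr \<zeta> * disc_cdf e) * (\<eta> + 2 * disc_cdf e)"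
  proof -
    have "(C * N) * (d * \<eta> + 2 * d\<^sup>2) = C * (N * d) * (\<eta> + 2 * d)" for C N d \<eta> :: real by algebra
    then show ?thesis .
  qed
  finally show ?thesis using bound unfolding V S e_def by linarith
qed

text \<open>\<open>hit_approx\<close> compares with the exponential of the expected number of hits
  at finite n; \<open>expected_hits\<close> then replaces that number by its limit.\<close>

lemma void_hits:
  assumes a: "a > 0" and b: "b > 0" and A: "finite A" and A1: "\<And>k. k \<in> A \<Longrightarrow> snd k \<ge> 1"
  shows "(\<lambda>n. prob {\<omega> \<in> space M. \<forall>x. \<omega> \<notin> hit n a b A x}) \<longlonglongrightarrow> exp (- (\<Sum>k\<in>A. cell_weight b (snd k) /
    real a))"
proof -
  \<comment> \<open>A sum of nonnegative terms dominates each of them; the added 1 keeps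
    \<open>T\<close> positive when \<open>A\<close> is empty.\<close>
  define T where "T = (\<Sum>k\<in>A. (real_of_int (snd k) + 1) / real b) + 1"
  define r where "r = nat (\<Sum>k\<in>A. \<bar>fst k\<bar>)"
  have pos: "0 \<le> (real_of_int (snd k) + 1) / real b" if "k \<in> A" for k using A1[OF that] b by simp
  have T: "(real_of_int (snd k) + 1) / real b \<le> T" if "k \<in> A" for k
    unfolding T_def using member_le_sum[OF that, of "\<lambda>k. (real_of_int (snd k) + 1) / real b"] pos A
      by force
  have T0: "T > 0" unfolding T_def by (intro add_nonneg_pos sum_nonneg pos) auto
  have r: "\<bar>fst k\<bar> \<le> int r" if "k \<in> A" for k
    unfolding r_def using member_le_sum[OF that, of "\<lambda>k. \<bar>fst k\<bar>"] A by (simp add: sum_nonneg)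
  let ?p = "\<lambda>n. disc_cdf (T / real n powr (1 - \<zeta>))"
  let ?N = "\<lambda>n. real n powr \<zeta> * ?p n"
  define K where "K = edge_const * T powr (2 * \<kappa> + 2)"
  define C where "C = 2 * (real r + 1) / real a + 2"
  have K0: "K \<ge> 0" unfolding K_def using edge_const_pos by simp
  have C0: "C > 0" unfolding C_def using a by (simp add: add_nonneg_pos)
  define S where "S n = (\<Sum>k\<in>A. \<Sum>x\<in>column n a (fst k). prob (hit n a b {k} x))" for n
  let ?V = "\<lambda>n. prob {\<omega> \<in> space M. \<forall>x. \<omega> \<notin> hit n a b A x}"
  have "(\<lambda>n. ?V n - exp (- S n)) \<longlonglongrightarrow> 0"
  proof (rule tendstoI)
    fix \<epsilon> :: real assume \<epsilon>: "\<epsilon> > 0"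
    \<comment> \<open>Calibrated so that \<open>C * (K + 1) * (2 * \<eta>) = \<epsilon>\<close>,
      using that eventually n^\<zeta> p < K + 1 and 2 p < \<eta>.\<close>
    define \<eta> where "\<eta> = \<epsilon> / (2 * (C * (K + 1)))"
    have CK: "C * (K + 1) > 0" using C0 K0 by simp
    have \<eta>: "\<eta> > 0" unfolding \<eta>_def using \<epsilon> CK by simp
    obtain e0 where e0: "e0 > 0" "\<forall>e\<le>e0. \<forall>x. prob {\<omega> \<in> space M. \<bar>F x \<omega>\<bar> > c - e} < \<eta>"
      using prob_abs_F_near_edge[OF \<eta>] by blast
    have ev1: "\<forall>\<^sub>F n in sequentially. T / real n powr (1 - \<zeta>) < e0"
      by (rule order_tendstoD(2)[OF tendsto_powr_neg_sequentially[OF one_minus_zeta_pos] e0(1)])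
    have ev2: "\<forall>\<^sub>F n in sequentially. ?N n < K + 1"
      using scaled_disc_cdf[OF T0] by (intro order_tendstoD(2)[where y = K]) (auto simp: K_def)
    have ev3: "\<forall>\<^sub>F n in sequentially. ?p n < \<eta> / 2"
      using disc_cdf_tendsto_0[OF T0] \<eta> by (intro order_tendstoD(2)) auto
    show "\<forall>\<^sub>F n in sequentially. dist (?V n - exp (- S n)) 0 < \<epsilon>"
      using ev1 ev2 ev3 eventually_small[of T] eventually_gt_at_top[of 0]
    proof eventually_elim
      case (elim n)
      have "\<bar>?V n - exp (- S n)\<bar> \<le> C * ?N n * (\<eta> + 2 * ?p n)"
        unfolding S_def C_def using e0(2) elim by (intro hit_approx a b A T r) (auto intro!: less_imp_le)
      also have "\<dots> \<le> C * (K + 1) * (\<eta> + 2 * ?p n)"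
        using elim(2) C0 \<eta> by (intro mult_right_mono mult_left_mono) (auto simp: disc_cdf_def
          add_nonneg_nonneg)
      also have "\<dots> < C * (K + 1) * (2 * \<eta>)" using elim(3) CK by (intro mult_strict_left_mono) auto
      also have "\<dots> = \<epsilon>"
      proof -
        have "x * (2 * (\<epsilon> / (2 * x))) = \<epsilon>" if "x > 0" for x using that by simp
        then show ?thesis unfolding \<eta>_def using CK by blast
      qed
      finally show ?case by (simp add: dist_real_def)
    qed
  qed
  moreover have "(\<lambda>n. exp (- S n)) \<longlonglongrightarrow> exp (- (\<Sum>k\<in>A. cell_weight b (snd k) / real a))"
    unfolding S_def by (intro tendsto_intros expected_hits a b A1)
  ultimately have "(\<lambda>n. (?V n - exp (- S n)) + exp (- S n)) \<longlonglongrightarrow> 0 + exp (- (\<Sum>k\<in>A. cell_weight b (snd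
    k) / real a))"
    by (rule tendsto_add)
  then show ?thesis by simp
qed

section \<open>The rescaled process as a locally finite measure\<close>

lemma rescaled_pp_eq:
  "rescaled_pp c \<zeta> F n \<omega> = distr (count_space {x. pp_point n \<omega> x \<in> Espace}) borel (pp_point n \<omega>)"
  unfolding rescaled_pp_def Let_def pp_point_def by simp

lemma finite_pp_cell:
  assumes "a > 0" "snd k \<ge> 1"
  shows "finite {x. pp_point n \<omega> x \<in> grid_cell a b k}"
proof (cases "n = 0")
  \<comment> \<open>\<open>0 powr s\<close> is 0, so for n = 0 all points sit at the origin, in row
    0, outside every cell considered.\<close>
  case True
  then have "{x. pp_point n \<omega> x \<in> grid_cell a b k} = {}"
    using assms by (auto simp: pp_point_def grid_cell_def)
  then show ?thesis by simp
next
  case False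
  have "{x. pp_point n \<omega> x \<in> grid_cell a b k} \<subseteq> column n a (fst k)" by (auto simp: pp_point_cell_iff)
  then show ?thesis using column_eq[of n a "fst k"] False assms by (auto intro: finite_subset)
qed

lemma emeasure_pp_cell:
  assumes "a > 0" "b > 0" "snd k \<ge> 1"
  shows "emeasure (rescaled_pp c \<zeta> F n \<omega>) (grid_cell a b k) = of_nat (card {x. pp_point n \<omega> x \<in>
    grid_cell a b k})"
proof -
  have "grid_cell a b k \<subseteq> Espace" using Ebounded_grid_cell[OF assms] unfolding Ebounded_def by auto
  then have eq: "pp_point n \<omega> -` grid_cell a b k \<inter> {x. pp_point n \<omega> x \<in> Espace} = {x. pp_point n \<omega> x
    \<in> grid_cell a b k}"
    and sub: "{x. pp_point n \<omega> x \<in> grid_cell a b k} \<subseteq> {x. pp_point n \<omega> x \<in> Espace}"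
    by auto
  show ?thesis
    unfolding rescaled_pp_eq using emeasure_count_space_finite[OF sub finite_pp_cell[OF assms(1,3)]]
    by (subst emeasure_distr) (auto simp: eq)
qed

text \<open>Holds for every outcome, not only almost surely: a grid cell of positive row receives
  finitely many sites whatever the discrepancies are, and finitely many such cells cover a compact
  set.\<close>

lemma rescaled_pp_LF: "rescaled_pp c \<zeta> F n \<omega> \<in> LFmeasures"
proof -
  let ?m = "rescaled_pp c \<zeta> F n \<omega>"
  have sets: "sets ?m = sets borel" unfolding rescaled_pp_eq by simp
  have "open Espace" unfolding Espace_def by (intro open_Times) auto
  then have "- Espace \<in> sets borel" by auto
  moreover have "pp_point n \<omega> -` (- Espace) \<inter> {x. pp_point n \<omega> x \<in> Espace} = {}" by auto
  ultimately have "emeasure ?m (- Espace) = 0" unfolding rescaled_pp_eq by (subst emeasure_distr) auto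
  moreover have "emeasure ?m K < \<infinity>" if K: "compact K" "K \<subseteq> Espace" for K
  proof -
    obtain r where r: "K \<subseteq> (\<Union>k\<in>window r. dyadic_cell r k)" using compact_covered_by_window[OF K] by blast
    have "emeasure ?m K \<le> emeasure ?m (\<Union>k\<in>window r. dyadic_cell r k)"
      using r by (intro emeasure_mono) (auto simp: sets)
    also have "\<dots> \<le> (\<Sum>k\<in>window r. emeasure ?m (dyadic_cell r k))"
      by (intro emeasure_subadditive_finite) (auto simp: sets)
    also have "\<dots> < \<infinity>"
      by (simp add: emeasure_pp_cell window_snd[of _ r] of_nat_less_top flip: of_nat_sum)
    finally show ?thesis .
  qed
  ultimately show ?thesis unfolding LFmeasures_def using sets by blast
qed

lemma card_pp_cell_eq_sum:
  assumes "n > 0" "a > 0" "\<omega> \<in> space M"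
  shows "real (card {x. pp_point n \<omega> x \<in> grid_cell a b k}) = (\<Sum>x\<in>column n a (fst k). indicator (hit
    n a b {k} x) \<omega>)"
proof -
  have fin: "finite (column n a (fst k))" using column_eq[OF assms(1,2)] by simp
  have "(\<Sum>x\<in>column n a (fst k). indicator (hit n a b {k} x) \<omega> :: real) = (\<Sum>x\<in>column n a (fst k). if
    pp_point n \<omega> x \<in> grid_cell a b k then 1 else 0)"
    using assms(3) by (intro sum.cong) (auto simp: hit_def)
  also have "\<dots> = real (card (column n a (fst k) \<inter> {x. pp_point n \<omega> x \<in> grid_cell a b k}))"
    using fin by (simp add: sum.If_cases)
  also have "column n a (fst k) \<inter> {x. pp_point n \<omega> x \<in> grid_cell a b k} = {x. pp_point n \<omega> x \<in>
    grid_cell a b k}"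
    by (auto simp: pp_point_cell_iff)
  finally show ?thesis by simp
qed

lemma measurable_card_pp_cell:
  assumes "a > 0" "snd k \<ge> 1"
  shows "(\<lambda>\<omega>. real (card {x. pp_point n \<omega> x \<in> grid_cell a b k})) \<in> borel_measurable M"
proof (cases "n = 0")
  case True
  then have "{x. pp_point n \<omega> x \<in> grid_cell a b k} = {}" for \<omega>
    using assms by (auto simp: pp_point_def grid_cell_def)
  then show ?thesis by simp
next
  case False
  have "(\<lambda>\<omega>. \<Sum>x\<in>column n a (fst k). indicator (hit n a b {k} x) \<omega> :: real) \<in> borel_measurable M"
    by (intro borel_measurable_sum borel_measurable_indicator hit_measurable) auto
  then show ?thesis using False assms(1) by (simp add: card_pp_cell_eq_sum cong: measurable_cong)
qed

lemma measurable_emeasure_pp_cell: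
  assumes "a > 0" "b > 0" "snd k \<ge> 1"
  shows "(\<lambda>\<omega>. emeasure (rescaled_pp c \<zeta> F n \<omega>) (grid_cell a b k)) \<in> borel_measurable M"
  using measurable_compose[OF measurable_card_pp_cell[OF assms(1,3), of n b] measurable_ennreal]
  by (simp add: emeasure_pp_cell[OF assms] ennreal_of_nat_eq_real_of_nat)

lemma void_pp:
  assumes "a > 0" "b > 0" "finite A" "\<And>k. k \<in> A \<Longrightarrow> snd k \<ge> 1"
  shows "(\<lambda>n. prob {\<omega> \<in> space M. \<forall>k\<in>A. emeasure (rescaled_pp c \<zeta> F n \<omega>) (grid_cell a b k) = 0})
    \<longlonglongrightarrow> exp (- (\<Sum>k\<in>A. cell_weight b (snd k) / real a))"
proof -
  have "{\<omega> \<in> space M. \<forall>k\<in>A. emeasure (rescaled_pp c \<zeta> F n \<omega>) (grid_cell a b k) = 0} = {\<omega> \<in> space M.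
    \<forall>x. \<omega> \<notin> hit n a b A x}" for n
    using assms(4) finite_pp_cell[OF assms(1)]
    by (auto simp: emeasure_pp_cell[OF assms(1,2)] hit_def card_eq_0_iff)
  then show ?thesis using void_hits[OF assms] by simp
qed

lemma cell_weight_nonneg: "b > 0 \<Longrightarrow> j \<ge> 1 \<Longrightarrow> cell_weight b j \<ge> 0"
  unfolding cell_weight_def using edge_const_pos kappa
  by (intro mult_nonneg_nonneg) (auto intro!: powr_mono2 divide_right_mono)

text \<open>The indicator of two or more points is at most N minus the indicator of N >= 1, so only
  the mean and the void probability enter.\<close>

lemma multiple_pp:
  assumes a: "a > 0" and b: "b > 0" and k: "snd k \<ge> 1" and e: "e > 0"
  shows "\<forall>\<^sub>F n in sequentially. prob {\<omega> \<in> space M. emeasure (rescaled_pp c \<zeta> F n \<omega>) (grid_cell a b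
    k) \<notin> {0, 1}}
    \<le> (cell_weight b (snd k) / real a)\<^sup>2 + e"
proof -
  define w where "w = cell_weight b (snd k) / real a"
  have w0: "w \<ge> 0" unfolding w_def using cell_weight_nonneg[OF b k] by simp
  define N where "N n \<omega> = card {x. pp_point n \<omega> x \<in> grid_cell a b k}" for n \<omega>
  let ?S = "\<lambda>n. \<Sum>x\<in>column n a (fst k). prob (hit n a b {k} x)"
  have em: "emeasure (rescaled_pp c \<zeta> F n \<omega>) (grid_cell a b k) = of_nat (N n \<omega>)" for n \<omega>
    unfolding N_def by (rule emeasure_pp_cell[OF a b k])
  have mN: "(\<lambda>\<omega>. real (N n \<omega>)) \<in> borel_measurable M" for n
    unfolding N_def by (rule measurable_card_pp_cell[OF a k])
  have set: "{\<omega> \<in> space M. real (N n \<omega>) \<in> B} \<in> events" if "B \<in> sets borel" for n B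
    using measurable_sets[OF mN that] by (simp add: vimage_def Int_def conj_commute)
  have key: "prob {\<omega> \<in> space M. of_nat (N n \<omega>) \<notin> {0, 1::ennreal}} \<le> ?S n - (1 - prob {\<omega> \<in> space M.
    of_nat (N n \<omega>) = (0::ennreal)})"
    if n: "n > 0" for n
  proof -
    let ?M = "{\<omega> \<in> space M. real (N n \<omega>) \<in> - {0, 1}}" and ?Z = "{\<omega> \<in> space M. real (N n \<omega>) \<in> {0}}"
    have fin: "finite (column n a (fst k))" using column_eq[OF n a] by simp
    have int: "integrable M (indicator (hit n a b {k} x) :: 'a \<Rightarrow> real)" for x
      using hit_measurable[of "{k}"] by (intro integrable_real_indicator) (auto simp:
        emeasure_eq_measure)
    have Ms: "?M \<in> events" "?Z \<in> events" by (intro set; auto)+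
    have "prob ?M = (\<integral>\<omega>. indicator ?M \<omega> \<partial>M)" using Ms by simp
    also have "\<dots> \<le> (\<integral>\<omega>. (\<Sum>x\<in>column n a (fst k). indicator (hit n a b {k} x) \<omega>) - (1 - indicator ?Z
      \<omega>) \<partial>M)"
    proof (rule integral_mono)
      show "integrable M (indicator ?M :: 'a \<Rightarrow> real)" using Ms by (intro integrable_real_indicator)
        (auto simp: emeasure_eq_measure)
      have "integrable M (indicator ?Z :: 'a \<Rightarrow> real)" using Ms by (intro integrable_real_indicator)
        (auto simp: emeasure_eq_measure)
      then show "integrable M (\<lambda>\<omega>. (\<Sum>x\<in>column n a (fst k). indicator (hit n a b {k} x) \<omega>) - (1 -
        indicator ?Z \<omega> :: real))"
        using int by (intro Bochner_Integration.integrable_diff Bochner_Integration.integrable_sum) auto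
      fix \<omega> assume \<omega>: "\<omega> \<in> space M"
      have "(\<Sum>x\<in>column n a (fst k). indicator (hit n a b {k} x) \<omega>) = real (N n \<omega>)"
        unfolding N_def card_pp_cell_eq_sum[OF n a \<omega>] ..
      moreover have "indicator ?M \<omega> \<le> real (N n \<omega>) - (1 - indicator ?Z \<omega> :: real)"
        using \<omega> by (cases "N n \<omega> = 0"; cases "N n \<omega> = 1") (auto simp: indicator_def)
      ultimately show "indicator ?M \<omega> \<le> (\<Sum>x\<in>column n a (fst k). indicator (hit n a b {k} x) \<omega>) - (1
        - indicator ?Z \<omega> :: real)" by simp
    qed
    also have "\<dots> = ?S n - (1 - prob ?Z)"
    proof -
      have "integrable M (indicator ?Z :: 'a \<Rightarrow> real)" using Ms by (intro integrable_real_indicator)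
        (auto simp: emeasure_eq_measure)
      moreover have "integrable M (\<lambda>\<omega>. \<Sum>x\<in>column n a (fst k). indicator (hit n a b {k} x) \<omega> :: real)"
        using int by (intro Bochner_Integration.integrable_sum) auto
      moreover have "(\<integral>\<omega>. (\<Sum>x\<in>column n a (fst k). indicator (hit n a b {k} x) \<omega>) \<partial>M) = ?S n"
        using int hit_measurable[of "{k}"] by (subst Bochner_Integration.integral_sum) auto
      ultimately show ?thesis using Ms by (simp add: prob_space)
    qed
    also have "?Z = {\<omega> \<in> space M. of_nat (N n \<omega>) = (0::ennreal)}" by auto
    also have "?M = {\<omega> \<in> space M. of_nat (N n \<omega>) \<notin> {0, 1::ennreal}}" by auto
    finally show ?thesis .
  qed
  have void: "(\<lambda>n. prob {\<omega> \<in> space M. of_nat (N n \<omega>) = (0::ennreal)}) \<longlonglongrightarrow> exp (- w)"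
    using void_pp[OF a b, of "{k}"] k by (simp add: em w_def)
  have "(\<lambda>n. ?S n - (1 - prob {\<omega> \<in> space M. of_nat (N n \<omega>) = (0::ennreal)})) \<longlonglongrightarrow> w - (1 - exp (- w))"
    unfolding w_def by (intro tendsto_intros expected_hits[OF a b k] void[unfolded w_def])
  \<comment> \<open>The deficit w - (1 - exp(-w)) is at most w^2 by \<open>exp_minus_approx\<close>;
    the positive \<open>e\<close> supplies the strict inequality needed to pass from the limit to
    large n.\<close>
  moreover have "w - (1 - exp (- w)) < w\<^sup>2 + e" using exp_minus_approx[OF w0] e by linarith
  ultimately have "\<forall>\<^sub>F n in sequentially. ?S n - (1 - prob {\<omega> \<in> space M. of_nat (N n \<omega>) =
    (0::ennreal)}) < w\<^sup>2 + e"
    by (rule order_tendstoD(2))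
  then show ?thesis using eventually_gt_at_top[of 0] unfolding em w_def[symmetric]
  proof eventually_elim
    case (elim n)
    then show ?case using key[OF elim(2)] by linarith
  qed
qed

subsection \<open>Comparison with the Poisson process\<close>

abbreviation edge_density :: "real \<times> real \<Rightarrow> real" where
  "edge_density \<equiv> (\<lambda>(x, y). q\<^sup>2 * (2 * Beta (\<kappa> + 1) (\<kappa> + 1)) * y powr (2 * \<kappa> + 1))"

text \<open>The exponent 2 \<kappa> + 1 may be negative; s > 0 keeps the interval away from the
  singularity at 0, so the fundamental theorem of calculus applies.\<close>

lemma nn_integral_powr_Ico:
  assumes "0 < s" "s \<le> t"
  shows "(\<integral>\<^sup>+y. ennreal (y powr (2 * \<kappa> + 1)) * indicator {s..<t} y \<partial>lborel) = ennreal ((t powr (2 *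
    \<kappa> + 2) - s powr (2 * \<kappa> + 2)) / (2 * \<kappa> + 2))"
proof -
  have deg: "2 * \<kappa> + 1 > -1" "2 * \<kappa> + 1 + 1 = 2 * \<kappa> + 2" using kappa by auto
  have mono: "s powr (2 * \<kappa> + 2) \<le> t powr (2 * \<kappa> + 2)" using assms kappa by (intro powr_mono2) auto
  have I: "((\<lambda>y. y powr (2 * \<kappa> + 1)) has_integral (t powr (2 * \<kappa> + 2) / (2 * \<kappa> + 2) - s powr (2 * \<kappa>
    + 2) / (2 * \<kappa> + 2))) {s..t}"
  proof (rule fundamental_theorem_of_calculus[OF assms(2)])
    fix y assume "y \<in> {s..t}"
    then have "y > 0" using assms by simp
    then have "((\<lambda>y. y powr (2 * \<kappa> + 2)) has_real_derivative (2 * \<kappa> + 2) * y powr (2 * \<kappa> + 2 - 1))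
      (at y within {s..t})"
      by (intro has_field_derivative_at_within[OF has_real_derivative_powr])
    from DERIV_cdivide[OF this, of "2 * \<kappa> + 2"]
    have "((\<lambda>y. y powr (2 * \<kappa> + 2) / (2 * \<kappa> + 2)) has_real_derivative y powr (2 * \<kappa> + 1)) (at y
      within {s..t})"
      using kappa by (simp add: add.commute)
    then show "((\<lambda>y. y powr (2 * \<kappa> + 2) / (2 * \<kappa> + 2)) has_vector_derivative y powr (2 * \<kappa> + 1)) (at
      y within {s..t})"
      by (simp add: has_real_derivative_iff_has_vector_derivative)
  qed
  have "(\<integral>\<^sup>+y. ennreal (y powr (2 * \<kappa> + 1)) * indicator {s..<t} y \<partial>lborel) = (\<integral>\<^sup>+y. ennreal (y powr
    (2 * \<kappa> + 1)) * indicator {s..t} y \<partial>lborel)"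
    using AE_lborel_singleton[of t] by (intro nn_integral_cong_AE, elim eventually_mono) (auto simp:
      indicator_def)
  also have "\<dots> = ennreal (t powr (2 * \<kappa> + 2) / (2 * \<kappa> + 2) - s powr (2 * \<kappa> + 2) / (2 * \<kappa> + 2))"
    by (intro nn_integral_has_integral_lebesgue' I) auto
  finally show ?thesis by (simp add: diff_divide_distrib)
qed

lemma edge_density_measurable [measurable]: "edge_density \<in> borel_measurable borel"
  unfolding borel_prod[symmetric] by measurable

text \<open>The point where the intensity of the Poisson process meets the limit found in
  \<open>expected_hits\<close>.\<close>

lemma emeasure_edge_density_cell:
  assumes "a > 0" "b > 0" "snd k \<ge> 1"
  shows "emeasure (density lborel (\<lambda>z. ennreal (edge_density z))) (grid_cell a b k) = ennreal
    (cell_weight b (snd k) / real a)"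
proof -
  let ?I = "{real_of_int (fst k) / real a ..< (real_of_int (fst k) + 1) / real a}"
  let ?s = "real_of_int (snd k) / real b" and ?t = "(real_of_int (snd k) + 1) / real b"
  let ?C = "q\<^sup>2 * (2 * Beta (\<kappa> + 1) (\<kappa> + 1))"
  have C0: "?C \<ge> 0" using Beta_pos_real[of "\<kappa> + 1" "\<kappa> + 1"] kappa by simp
  have st: "0 < ?s" "?s \<le> ?t" using assms by (auto intro: divide_right_mono)
  have meas: "(\<lambda>z. ennreal (edge_density z) * indicator (grid_cell a b k) z) \<in> borel_measurable
    (lborel \<Otimes>\<^sub>M lborel)"
    unfolding lborel_prod by measurable
  have "emeasure (density lborel (\<lambda>z. ennreal (edge_density z))) (grid_cell a b k)
    = (\<integral>\<^sup>+z. ennreal (edge_density z) * indicator (grid_cell a b k) z \<partial>lborel)"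
    by (intro emeasure_density) auto
  also have "\<dots> = (\<integral>\<^sup>+z. ennreal (edge_density z) * indicator (grid_cell a b k) z \<partial>(lborel \<Otimes>\<^sub>M lborel))"
    by (simp add: lborel_prod)
  also have "\<dots> = (\<integral>\<^sup>+x. \<integral>\<^sup>+y. ennreal (edge_density (x, y)) * indicator (grid_cell a b k) (x, y)
    \<partial>lborel \<partial>lborel)"
    by (rule lborel.nn_integral_fst[OF meas, symmetric])
  also have "\<dots> = (\<integral>\<^sup>+x. \<integral>\<^sup>+y. (ennreal ?C * indicator ?I x) * (ennreal (y powr (2 * \<kappa> + 1)) *
    indicator {?s..<?t} y) \<partial>lborel \<partial>lborel)"
  proof -
    have "ennreal (edge_density (x, y)) = ennreal ?C * ennreal (y powr (2 * \<kappa> + 1))" for x y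
      unfolding case_prod_conv by (rule ennreal_mult[OF C0]) simp
    then show ?thesis
      unfolding grid_cell_eq_Times[OF assms(1,2)]
      by (intro nn_integral_cong) (simp only: indicator_times fst_conv snd_conv mult_ac)
  qed
  also have "\<dots> = (\<integral>\<^sup>+x. (ennreal ?C * ennreal ((?t powr (2 * \<kappa> + 2) - ?s powr (2 * \<kappa> + 2)) / (2 * \<kappa>
    + 2))) * indicator ?I x \<partial>lborel)"
  proof (rule nn_integral_cong)
    fix x :: real
    have "(\<integral>\<^sup>+y. (ennreal ?C * indicator ?I x) * (ennreal (y powr (2 * \<kappa> + 1)) * indicator {?s..<?t}
      y) \<partial>lborel)
      = (ennreal ?C * indicator ?I x) * (\<integral>\<^sup>+y. ennreal (y powr (2 * \<kappa> + 1)) * indicator {?s..<?t} y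
        \<partial>lborel)"
      by (rule nn_integral_cmult) measurable
    then show "(\<integral>\<^sup>+y. (ennreal ?C * indicator ?I x) * (ennreal (y powr (2 * \<kappa> + 1)) * indicator
      {?s..<?t} y) \<partial>lborel)
      = (ennreal ?C * ennreal ((?t powr (2 * \<kappa> + 2) - ?s powr (2 * \<kappa> + 2)) / (2 * \<kappa> + 2))) *
        indicator ?I x"
      unfolding nn_integral_powr_Ico[OF st] by (simp only: mult_ac)
  qed
  also have "\<dots> = ennreal ?C * ennreal ((?t powr (2 * \<kappa> + 2) - ?s powr (2 * \<kappa> + 2)) / (2 * \<kappa> + 2)) *
    emeasure lborel ?I"
    by (rule nn_integral_cmult_indicator) simp
  also have "emeasure lborel ?I = ennreal (1 / real a)"
    using assms by (subst emeasure_lborel_Ico) (auto simp: divide_right_mono add_divide_distrib)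
  also have "ennreal ?C * ennreal ((?t powr (2 * \<kappa> + 2) - ?s powr (2 * \<kappa> + 2)) / (2 * \<kappa> + 2)) *
    ennreal (1 / real a)
    = ennreal (?C * ((?t powr (2 * \<kappa> + 2) - ?s powr (2 * \<kappa> + 2)) / (2 * \<kappa> + 2)) * (1 / real a))"
  proof -
    have "?s powr (2 * \<kappa> + 2) \<le> ?t powr (2 * \<kappa> + 2)" using st kappa by (intro powr_mono2) auto
    then have "(?t powr (2 * \<kappa> + 2) - ?s powr (2 * \<kappa> + 2)) / (2 * \<kappa> + 2) \<ge> 0" using kappa by simp
    moreover have "ennreal x * ennreal y * ennreal z = ennreal (x * y * z)" if "x \<ge> 0" "y \<ge> 0" for x y z
      using that by (simp add: ennreal_mult')
    ultimately show ?thesis using C0 by blast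
  qed
  also have "?C * ((?t powr (2 * \<kappa> + 2) - ?s powr (2 * \<kappa> + 2)) / (2 * \<kappa> + 2)) * (1 / real a) =
    cell_weight b (snd k) / real a"
    unfolding cell_weight_def edge_const_def by simp
  finally show ?thesis .
qed

lemma intensity_cells:
  assumes "a > 0" "b > 0" "finite A" "\<And>k. k \<in> A \<Longrightarrow> snd k \<ge> 1"
  shows "intensity edge_density (\<Union>k\<in>A. grid_cell a b k) = (\<Sum>k\<in>A. cell_weight b (snd k) / real a)"
proof -
  let ?D = "density lborel (\<lambda>z. ennreal (edge_density z))"
  have "(\<integral>\<^sup>+z\<in>(\<Union>k\<in>A. grid_cell a b k). ennreal (edge_density z) \<partial>lborel) = emeasure ?D (\<Union>k\<in>A.
    grid_cell a b k)"
    using assms(3) by (intro emeasure_density[symmetric]) auto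
  also have "\<dots> = (\<Sum>k\<in>A. emeasure ?D (grid_cell a b k))"
    using assms(3) disjoint_grid_cell by (intro sum_emeasure[symmetric]) auto
  also have "\<dots> = (\<Sum>k\<in>A. ennreal (cell_weight b (snd k) / real a))"
    using assms by (intro sum.cong emeasure_edge_density_cell) auto
  also have "\<dots> = ennreal (\<Sum>k\<in>A. cell_weight b (snd k) / real a)"
    using assms cell_weight_nonneg by (intro sum_ennreal) auto
  finally show ?thesis
    unfolding intensity_def using assms cell_weight_nonneg by (simp add: sum_nonneg)
qed

text \<open>Both processes have the same limiting void probabilities on unions of cells and the same
  bound for multiple points, with \<open>cell_weight\<close> as the row weight in
  \<open>vague_liminf_open\<close>.\<close>

theorem rescaled_pp_converges:
  assumes Y: "poisson_process N Y edge_density"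
  shows "conv_distr_vague M (rescaled_pp c \<zeta> F) N Y"
proof -
  have N: "prob_space N" and YL: "\<And>\<omega>. \<omega> \<in> space N \<Longrightarrow> Y \<omega> \<in> LFmeasures"
    and pmf: "\<And>B k. Ebounded B \<Longrightarrow> measure N {\<omega> \<in> space N. emeasure (Y \<omega>) B = of_nat k}
            = intensity edge_density B ^ k / fact k * exp (- intensity edge_density B)"
    using Y unfolding poisson_process_def by auto
  interpret N: prob_space N by fact
  \<comment> \<open>\<open>poisson_process\<close> records measurability of the counts inside
    independence; a family with a single index extracts it.\<close>
  have measB: "(\<lambda>\<omega>. emeasure (Y \<omega>) B) \<in> borel_measurable N" if "Ebounded B" for B
  proof -
    have "N.indep_vars (\<lambda>_. borel) (\<lambda>i \<omega>. emeasure (Y \<omega>) B) {0::nat}"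
      using Y that unfolding poisson_process_def
      by (elim conjE allE[of _ "\<lambda>_::nat. B"] allE[of _ "{0::nat}"]) (auto simp: disjoint_family_on_def)
    then show ?thesis unfolding N.indep_vars_def by simp
  qed
  have measY: "(\<lambda>\<omega>. emeasure (Y \<omega>) (grid_cell a b k)) \<in> borel_measurable N" if "a > 0" "b > 0" "snd
    k \<ge> 1" for a b k
    by (rule measB[OF Ebounded_grid_cell[OF that]])
  \<comment> \<open>All cells are empty exactly when their union is, and the union is one bounded
    set, so the count law with \<open>k = 0\<close> gives the value.\<close>
  have voidY: "measure N {\<omega> \<in> space N. \<forall>k\<in>A. emeasure (Y \<omega>) (grid_cell a b k) = 0} = exp (- (\<Sum>k\<in>A.
    cell_weight b (snd k) / real a))"
    if "a > 0" "b > 0" "finite A" "\<And>k. k \<in> A \<Longrightarrow> snd k \<ge> 1" for a b A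
  proof -
    have "emeasure (Y \<omega>) (\<Union>k\<in>A. grid_cell a b k) = 0 \<longleftrightarrow> (\<forall>k\<in>A. emeasure (Y \<omega>) (grid_cell a b k) = 0)"
      if "\<omega> \<in> space N" for \<omega>
    proof -
      have "emeasure (Y \<omega>) (\<Union>k\<in>A. grid_cell a b k) = (\<Sum>k\<in>A. emeasure (Y \<omega>) (grid_cell a b k))"
        using \<open>finite A\<close> disjoint_grid_cell LFmeasures_sets[OF YL[OF that]] by (intro
          sum_emeasure[symmetric]) auto
      then show ?thesis using \<open>finite A\<close> by simp
    qed
    then have "measure N {\<omega> \<in> space N. \<forall>k\<in>A. emeasure (Y \<omega>) (grid_cell a b k) = 0} = measure N {\<omega> \<in>
      space N. emeasure (Y \<omega>) (\<Union>k\<in>A. grid_cell a b k) = of_nat 0}"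
      by (intro arg_cong[where f = "measure N"]) auto
    also have "\<dots> = exp (- (\<Sum>k\<in>A. cell_weight b (snd k) / real a))"
      using that by (subst pmf) (auto intro!: Ebounded_UN Ebounded_grid_cell simp: intensity_cells)
    finally show ?thesis .
  qed
  have multY: "measure N {\<omega> \<in> space N. emeasure (Y \<omega>) (grid_cell a b k) \<notin> {0, 1}} \<le> (cell_weight b
    (snd k) / real a)\<^sup>2"
    if "a > 0" "b > 0" "snd k \<ge> 1" for a b k
  proof -
    define w where "w = cell_weight b (snd k) / real a"
    have w0: "w \<ge> 0" unfolding w_def using cell_weight_nonneg that by simp
    have int: "intensity edge_density (grid_cell a b k) = w"
      using intensity_cells[of a b "{k}"] that unfolding w_def by simp
    let ?E = "\<lambda>j::nat. {\<omega> \<in> space N. emeasure (Y \<omega>) (grid_cell a b k) = of_nat j}"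
    have E: "?E j \<in> sets N" for j
      using measurable_sets[OF measY[OF that], of "{of_nat j}"] by (simp add: vimage_def Int_def
        conj_commute)
    have "{\<omega> \<in> space N. emeasure (Y \<omega>) (grid_cell a b k) \<notin> {0, 1}} = space N - (?E 0 \<union> ?E 1)" by auto
    then have "measure N {\<omega> \<in> space N. emeasure (Y \<omega>) (grid_cell a b k) \<notin> {0, 1}} = 1 - measure N
      (?E 0 \<union> ?E 1)"
      using N.prob_compl[OF sets.Un[OF E[of 0] E[of 1]]] by simp
    also have "measure N (?E 0 \<union> ?E 1) = measure N (?E 0) + measure N (?E 1)"
      by (rule N.finite_measure_Union[OF E E]) auto
    also have "\<dots> = exp (- w) + w * exp (- w)"
      using pmf[OF Ebounded_grid_cell[OF that], of 0] pmf[OF Ebounded_grid_cell[OF that], of 1] by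
        (simp add: int)
    also have "\<dots> = (1 + w) * exp (- w)" by (simp add: algebra_simps)
    also have "1 - \<dots> \<le> w\<^sup>2"
    proof -
      \<comment> \<open>Two or more points have probability 1 - (1 + w) exp(-w), and exp(-w) >= 1 -
        w bounds it by 1 - (1 - w^2).\<close>
      have "(1 + w) * (1 - w) \<le> (1 + w) * exp (- w)"
        using exp_ge_add_one_self[of "-w"] w0 by (intro mult_left_mono) auto
      then show ?thesis by (simp add: algebra_simps power2_eq_square)
    qed
    finally show ?thesis unfolding w_def .
  qed
  have M: "prob_space M" by (rule prob_space_axioms)
  show ?thesis
  proof (rule conv_distr_vague_if_liminf_open[OF M N rescaled_pp_LF YL])
    fix G assume G: "openin vague_topology G"
    show "{\<omega> \<in> space M. rescaled_pp c \<zeta> F n \<omega> \<in> G} \<in> sets M" for n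
      using window_snd by (intro measurable_vague_open(2)[OF _ _ G] rescaled_pp_LF
        measurable_emeasure_pp_cell) auto
    show "{\<omega> \<in> space N. Y \<omega> \<in> G} \<in> sets N"
      using window_snd by (intro measurable_vague_open(2)[OF _ _ G] YL measY) auto
    fix e :: real assume e: "e > 0"
    show "\<forall>\<^sub>F n in sequentially. measure N {\<omega> \<in> space N. Y \<omega> \<in> G} - e < measure M {\<omega> \<in> space M.
      rescaled_pp c \<zeta> F n \<omega> \<in> G}"
    proof (rule vague_liminf_open[where l = cell_weight, OF M N rescaled_pp_LF YL
      measurable_emeasure_pp_cell measY _ _ _ G e])
      fix a b :: nat and A :: "(int \<times> int) set"
      assume *: "a > 0" "b > 0" "finite A" "\<And>k. k \<in> A \<Longrightarrow> snd k \<ge> 1"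
      show "(\<lambda>n. measure M {\<omega> \<in> space M. \<forall>k\<in>A. emeasure (rescaled_pp c \<zeta> F n \<omega>) (grid_cell a b k) = 0}) \<longlonglongrightarrow>
        measure N {\<omega> \<in> space N. \<forall>k\<in>A. emeasure (Y \<omega>) (grid_cell a b k) = 0}"
        using void_pp[OF *] voidY[OF *] by simp
    qed (assumption | rule multiple_pp multY)+
  qed
qed

end

section \<open>The limit theorem\<close>

theorem theorem2p5:
  fixes M :: "'a measure" and F :: "int \<Rightarrow> 'a \<Rightarrow> real"
    and N :: "'b measure" and mu :: "'b \<Rightarrow> (real \<times> real) measure"
    and \<rho> :: "real \<Rightarrow> real" and c q \<kappa> :: real
  assumes c_pos: "c > 0" and q_pos: "q > 0" and kappa: "\<kappa> > -1"
    and rho_even: "\<And>t. \<rho> (- t) = \<rho> t"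
    and rho_cont: "continuous_on {-c<..<c} \<rho>"
    and rho_pos: "\<And>t. t \<in> {-c<..<c} \<Longrightarrow> \<rho> t > 0"
    and rho_zero: "\<And>t. t \<notin> {-c<..<c} \<Longrightarrow> \<rho> t = 0"
    and rho_edge: "((\<lambda>t. \<rho> t / \<bar>c - t\<bar> powr \<kappa>) \<longlongrightarrow> q) (at_left c)"
    and M: "prob_space M"
    and F_indep: "prob_space.indep_vars M (\<lambda>_. borel) F UNIV"
    and F_distr: "\<And>x. distributed M lborel (F x) (\<lambda>t. ennreal (\<rho> t))"
    and mu_poisson: "poisson_process N mu
        (\<lambda>(x, y). q\<^sup>2 * (2 * Beta (\<kappa> + 1) (\<kappa> + 1)) * y powr (2 * \<kappa> + 1))"
  shows "conv_distr_vague M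
           (rescaled_pp c ((2 * \<kappa> + 2) / (2 * \<kappa> + 3)) F) N mu"
proof -
  interpret edge_disorder M F \<rho> c q \<kappa>
    by (intro edge_disorder.intro M edge_disorder_axioms.intro) (use assms in auto)
  show ?thesis by (rule rescaled_pp_converges[OF mu_poisson])
qed

end
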